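(* Let $A=(A_n)_{n\in\mathbb{N}}$ be a sequence of square complex matrices (of arbitrary, possibly unbounded, sizes) with eigenvalues in the open unit disc $\mathbb{D}$, and let $H=(H_n)_{n\in\mathbb{N}}$ be the associated sequence of model spaces, $H_n=\mathrm{H}^2\ominus\{f\in\mathrm{H}^2 : f(A_n)=0\}$. Then $A$ is interpolating if and only if $H$ is a weakly separated Bessel system.
   Context: $\mathrm{H}^2$ is the Hardy space on the unit disc $\mathbb{D}$ (power series centered at $0$ with square-summable Taylor coefficients, with the $\ell^2$ inner product of the coefficients), and $\mathrm{H}^\infty$ is the algebra of bounded holomorphic functions on $\mathbb{D}$. Holomorphic functions on $\mathbb{D}$ are applied to square matrices with spectrum in $\mathbb{D}$ through the Riesz–Dunford functional calculus. The sequence $A$ is interpolating if for every bounded sequence $(w_n)_{n\in\mathbb{N}}$ in $\mathbb{C}$ there exists $\phi\in\mathrm{H}^\infty$ such that $\phi(A_n)=w_n\,\mathrm{Id}$ for every $n\in\mathbb{N}$. The space $H_n$ is the model space $\mathrm{H}^2\ominus B_n\mathrm{H}^2$, where $B_n$ is the finite Blaschke product whose zeros are the eigenvalues of $A_n$, each with multiplicity equal to its multiplicity as a root of the minimal polynomial of $A_n$; the functions in $\mathrm{H}^2$ vanishing at $A_n$ are precisely the multiples of $B_n$ in $\mathrm{H}^2$. For closed subspaces $K_1,K_2$ of a Hilbert space, $\sin(K_1,K_2)$ is the infimum of the sines of the angles between a nonzero vector of $K_1$ and a nonzero vector of $K_2$; equivalently $\sin(K_1,K_2)=\inf\{\mathrm{dist}(x,K_2):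 x\in K_1,\ \|x\|=1\}$. A sequence $(H_n)_{n\in\mathbb{N}}$ of closed subspaces of a Hilbert space is weakly separated if $\inf_{n\neq j}\sin(H_n,H_j)>0$; it is a Bessel system if there is a finite constant $C\ge1$ such that, for every choice of unit vectors $h_n\in H_n$ ($n\in\mathbb{N}$) and every $(a_n)_{n\in\mathbb{N}}\in\ell^2$, $\left\|\sum_n a_nh_n\right\|^2\le C^2\sum_n|a_n|^2$. *)

theory Defs
  imports
    "HOL-Complex_Analysis.Complex_Analysis"
    "Jordan_Normal_Form.Spectral_Radius"
begin

section \<open>The Hardy space on the unit disc\<close>

typedef hardy = "{f :: complex fps. summable (\<lambda>n. (cmod (fps_nth f n))\<^sup>2)}"
  morphisms taylor Hardy
  by (rule exI[of _ 0]) simp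

setup_lifting type_definition_hardy

definition hardy_fun :: "hardy \<Rightarrow> complex \<Rightarrow> complex" where
  "hardy_fun f = eval_fps (taylor f)"

lemma summable_taylor: "summable (\<lambda>n. (cmod (fps_nth (taylor f) n))\<^sup>2)"
  using taylor[of f] by simp

lemma square_summable_mult:
  fixes a b :: "nat \<Rightarrow> complex"
  assumes "summable (\<lambda>n. (cmod (a n))\<^sup>2)" "summable (\<lambda>n. (cmod (b n))\<^sup>2)"
  shows "summable (\<lambda>n. a n * cnj (b n))"
proof (rule summable_comparison_test'[where N = 0])
  show "summable (\<lambda>n. (cmod (a n))\<^sup>2 + (cmod (b n))\<^sup>2)"
    by (intro summable_add assms)
  fix n
  have "2 * (cmod (a n) * cmod (b n)) \<le> (cmod (a n))\<^sup>2 + (cmod (b n))\<^sup>2"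
    using sum_squares_bound[of "cmod (a n)" "cmod (b n)"] by simp
  moreover have "0 \<le> cmod (a n) * cmod (b n)" by simp
  ultimately show "norm (a n * cnj (b n)) \<le> (cmod (a n))\<^sup>2 + (cmod (b n))\<^sup>2"
    unfolding norm_mult complex_mod_cnj by linarith
qed

lemma square_summable_add:
  fixes a b :: "nat \<Rightarrow> complex"
  assumes "summable (\<lambda>n. (cmod (a n))\<^sup>2)" "summable (\<lambda>n. (cmod (b n))\<^sup>2)"
  shows "summable (\<lambda>n. (cmod (a n + b n))\<^sup>2)"
proof (rule summable_comparison_test'[where N = 0])
  show "summable (\<lambda>n. 2 * (cmod (a n))\<^sup>2 + 2 * (cmod (b n))\<^sup>2)"
    by (intro summable_add summable_mult assms)
  fix n
  have "(cmod (a n + b n))\<^sup>2 \<le> (cmod (a n) + cmod (b n))\<^sup>2"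
    by (intro power_mono norm_triangle_ineq) auto
  also have "\<dots> \<le> 2 * (cmod (a n))\<^sup>2 + 2 * (cmod (b n))\<^sup>2"
    using sum_squares_bound[of "cmod (a n)" "cmod (b n)"] by (simp add: power2_sum)
  finally show "norm ((cmod (a n + b n))\<^sup>2) \<le> 2 * (cmod (a n))\<^sup>2 + 2 * (cmod (b n))\<^sup>2"
    by simp
qed

lemma square_summable_diff:
  fixes a b :: "nat \<Rightarrow> complex"
  assumes "summable (\<lambda>n. (cmod (a n))\<^sup>2)" "summable (\<lambda>n. (cmod (b n))\<^sup>2)"
  shows "summable (\<lambda>n. (cmod (a n - b n))\<^sup>2)"
  using square_summable_add[of a "\<lambda>n. - b n"] assms by simp

lemma square_summable_scale:
  fixes a :: "nat \<Rightarrow> complex"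
  assumes "summable (\<lambda>n. (cmod (a n))\<^sup>2)"
  shows "summable (\<lambda>n. (cmod (c * a n))\<^sup>2)"
  using summable_mult[OF assms, of "(cmod c)\<^sup>2"] by (simp add: norm_mult power_mult_distrib)

lift_definition cscale :: "complex \<Rightarrow> hardy \<Rightarrow> hardy" is "\<lambda>c f. fps_const c * f"
  using square_summable_scale by simp

definition cinner :: "hardy \<Rightarrow> hardy \<Rightarrow> complex" where
  "cinner f g = (\<Sum>n. fps_nth (taylor f) n * cnj (fps_nth (taylor g) n))"

lemma summable_cinner: "summable (\<lambda>n. fps_nth (taylor f) n * cnj (fps_nth (taylor g) n))"
  by (intro square_summable_mult summable_taylor)

text \<open>The library has no class of complex inner product spaces, so the norm and topology come
  from the underlying real inner product space, whose inner product is the real part of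
  \<^const>\<open>cinner\<close>. Orthogonality and angles below use \<^const>\<open>cinner\<close> itself.\<close>

instantiation hardy :: real_inner
begin

lift_definition zero_hardy :: hardy is 0 by simp
lift_definition plus_hardy :: "hardy \<Rightarrow> hardy \<Rightarrow> hardy" is "(+)"
  using square_summable_add by simp
lift_definition uminus_hardy :: "hardy \<Rightarrow> hardy" is uminus by simp
lift_definition minus_hardy :: "hardy \<Rightarrow> hardy \<Rightarrow> hardy" is "(-)"
  using square_summable_diff by simp

definition scaleR_hardy :: "real \<Rightarrow> hardy \<Rightarrow> hardy" where
  "scaleR_hardy r f = cscale (complex_of_real r) f"
definition inner_hardy :: "hardy \<Rightarrow> hardy \<Rightarrow> real" where
  "inner_hardy f g = Re (cinner f g)"
definition norm_hardy :: "hardy \<Rightarrow> real" where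
  "norm_hardy f = sqrt (\<Sum>n. (cmod (fps_nth (taylor f) n))\<^sup>2)"
definition sgn_hardy :: "hardy \<Rightarrow> hardy" where
  "sgn_hardy f = inverse (norm f) *\<^sub>R f"
definition dist_hardy :: "hardy \<Rightarrow> hardy \<Rightarrow> real" where
  "dist_hardy f g = norm (f - g)"
definition uniformity_hardy :: "(hardy \<times> hardy) filter" where
  "uniformity_hardy = (INF e\<in>{0 <..}. principal {(x, y). dist x y < e})"
definition open_hardy :: "hardy set \<Rightarrow> bool" where
  "open_hardy U \<longleftrightarrow> (\<forall>x\<in>U. eventually (\<lambda>(x', y). x' = x \<longrightarrow> y \<in> U) uniformity)"

instance
proof
  fix f g h :: hardy and r s :: real
  show "f + g + h = f + (g + h)" "f + g = g + f" "0 + f = f" "- f + f = 0" "f - g = f + - g"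
    by (transfer, simp add: algebra_simps)+
  show "r *\<^sub>R (f + g) = r *\<^sub>R f + r *\<^sub>R g" "(r + s) *\<^sub>R f = r *\<^sub>R f + s *\<^sub>R f"
    "r *\<^sub>R s *\<^sub>R f = (r * s) *\<^sub>R f" "1 *\<^sub>R f = f"
    unfolding scaleR_hardy_def by (transfer, simp add: fps_eq_iff algebra_simps)+
  show "dist f g = norm (f - g)" by (rule dist_hardy_def)
  show "sgn f = inverse (norm f) *\<^sub>R f" by (rule sgn_hardy_def)
  show "inner f g = inner g f"
  proof -
    have "cinner g f = (\<Sum>n. cnj (fps_nth (taylor f) n * cnj (fps_nth (taylor g) n)))"
      unfolding cinner_def by (simp add: mult.commute)
    also have "\<dots> = cnj (cinner f g)"
      unfolding cinner_def by (rule bounded_linear.suminf[OF bounded_linear_cnj summable_cinner, symmetric])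
    finally show ?thesis unfolding inner_hardy_def by simp
  qed
  show "inner (f + g) h = inner f h + inner g h"
    unfolding inner_hardy_def cinner_def
    by (simp add: suminf_add[OF summable_cinner summable_cinner] plus_hardy.rep_eq ring_distribs
        flip: plus_complex.sel)
  show "inner (r *\<^sub>R f) g = r * inner f g"
    unfolding inner_hardy_def cinner_def
    by (simp add: suminf_mult[OF summable_cinner] scaleR_hardy_def cscale.rep_eq mult.assoc)
  have sq: "fps_nth (taylor f) n * cnj (fps_nth (taylor f) n)
      = complex_of_real ((cmod (fps_nth (taylor f) n))\<^sup>2)" for n
    by (rule complex_norm_square[symmetric])
  have self: "inner f f = (\<Sum>n. (cmod (fps_nth (taylor f) n))\<^sup>2)"
    unfolding inner_hardy_def cinner_def sq
    by (simp only: suminf_of_real[OF summable_taylor, symmetric] Re_complex_of_real)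
  show "0 \<le> inner f f"
    unfolding self by (intro suminf_nonneg summable_taylor) simp
  show "inner f f = 0 \<longleftrightarrow> f = 0"
    unfolding self
    by (subst suminf_eq_zero_iff[OF summable_taylor])
      (auto simp: zero_hardy.rep_eq fps_eq_iff simp flip: taylor_inject)
  show "norm f = sqrt (inner f f)"
    unfolding self norm_hardy_def ..
qed (rule uniformity_hardy_def open_hardy_def)+

end

section \<open>Riesz--Dunford functional calculus\<close>

definition resolvent :: "complex mat \<Rightarrow> complex \<Rightarrow> complex mat" where
  "resolvent A z = the (mat_inverse (z \<cdot>\<^sub>m 1\<^sub>m (dim_row A) - A))"

text \<open>For \<open>f\<close> holomorphic on the unit disc and a square matrix \<open>A\<close> whose spectrum lies in the disc,
  this is \<open>f(A) = (1/2\<pi>i) \<ointegral> f(z) (z - A)\<^sup>-\<^sup>1 dz\<close>, taken entrywise over a circle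
  in the disc, centred at the origin, that encloses the spectrum. By Cauchy's theorem any
  radius strictly between the spectral radius and 1 gives the same matrix.\<close>

definition riesz_dunford :: "(complex \<Rightarrow> complex) \<Rightarrow> complex mat \<Rightarrow> complex mat" where
  "riesz_dunford f A = mat (dim_row A) (dim_row A) (\<lambda>(i, j).
     1 / (2 * of_real pi * \<i>) *
     contour_integral (circlepath 0 ((1 + spectral_radius A) / 2))
       (\<lambda>z. f z * resolvent A z $$ (i, j)))"

section \<open>Interpolating sequences of matrices and their model spaces\<close>

definition H_infinity :: "(complex \<Rightarrow> complex) set" where
  "H_infinity = {\<phi>. \<phi> holomorphic_on ball 0 1 \<and> bounded (\<phi> ` ball 0 1)}"

definition interpolating :: "(nat \<Rightarrow> complex mat) \<Rightarrow> bool" where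
  "interpolating A \<longleftrightarrow> (\<forall>w :: nat \<Rightarrow> complex. bounded (range w) \<longrightarrow>
     (\<exists>\<phi>\<in>H_infinity. \<forall>n. riesz_dunford \<phi> (A n) = w n \<cdot>\<^sub>m 1\<^sub>m (dim_row (A n))))"

definition orthogonal_complement :: "hardy set \<Rightarrow> hardy set" where
  "orthogonal_complement S = {g. \<forall>f\<in>S. cinner g f = 0}"

definition model_space :: "complex mat \<Rightarrow> hardy set" where
  "model_space A =
     orthogonal_complement {f. riesz_dunford (hardy_fun f) A = 0\<^sub>m (dim_row A) (dim_row A)}"

section \<open>Separation and Bessel systems\<close>

definition angle :: "hardy \<Rightarrow> hardy \<Rightarrow> real" where
  "angle x y = arccos (cmod (cinner x y) / (norm x * norm y))"

definition sine :: "hardy set \<Rightarrow> hardy set \<Rightarrow> real" where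
  "sine K L = Inf {sin (angle x y) | x y. x \<in> K - {0} \<and> y \<in> L - {0}}"

definition weakly_separated :: "(nat \<Rightarrow> hardy set) \<Rightarrow> bool" where
  "weakly_separated H \<longleftrightarrow> Inf {sine (H n) (H j) | n j. n \<noteq> j} > 0"

definition bessel_system :: "(nat \<Rightarrow> hardy set) \<Rightarrow> bool" where
  "bessel_system H \<longleftrightarrow> (\<exists>C\<ge>1. \<forall>(h :: nat \<Rightarrow> hardy) (a :: nat \<Rightarrow> complex).
     (\<forall>n. h n \<in> H n \<and> norm (h n) = 1) \<longrightarrow> summable (\<lambda>n. (cmod (a n))\<^sup>2) \<longrightarrow>
     summable (\<lambda>n. cscale (a n) (h n)) \<and>
     (norm (\<Sum>n. cscale (a n) (h n)))\<^sup>2 \<le> C\<^sup>2 * (\<Sum>n. (cmod (a n))\<^sup>2))"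

end

theory Submission
  imports Defs
begin

text \<open>Since \<open>f(A) = \<Sum>\<^sub>k f\<^sub>k A\<^sup>k\<close>, every entry of \<open>f(A)\<close> is the inner product of \<open>f\<close> with an element of the
  model space, so that \<open>f(A) = 0\<close> if and only if \<open>f\<close> is orthogonal to the model space.

  If \<open>A\<close> is interpolating, a gliding hump argument and Montel's theorem give a common bound \<open>M\<close> for
  interpolants of all \<open>w\<close> with \<open>|w\<^sub>n| \<le> 1\<close>. If \<open>\<phi>(A\<^sub>n) = w\<^sub>n\<close> and \<open>h\<^sub>n \<in> H\<^sub>n\<close>, put \<open>x = \<Sum> h\<^sub>n\<close> and let \<open>y\<close> be the
  sum of the \<open>h\<^sub>n\<close> with the conjugate weights. Then \<open>\<parallel>y\<parallel>\<^sup>2 = \<langle>\<phi>y, x\<rangle>\<close>, whence \<open>\<parallel>y\<parallel> \<le> M\<parallel>x\<parallel>\<close>. A choice of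
  signs turns this into the Bessel property, and \<open>w = (1, 0)\<close> into weak separation.

  Conversely, a commutant lifting argument produces functions from inequalities on the model spaces.
  Weak separation with constant \<open>s\<close> yields \<open>|\<psi>\<^sub>n\<^sub>j| \<le> 1/s\<close> with \<open>\<psi>\<^sub>n\<^sub>j(A\<^sub>n) = 1\<close> and \<open>\<psi>\<^sub>n\<^sub>j(A\<^sub>j) = 0\<close>, and the
  Bessel property with constant \<open>C\<close> yields, for every \<open>N\<close>, functions with \<open>\<Sum>\<^sub>j |\<phi>\<^sub>j|\<^sup>2 \<le> C\<^sup>2\<close> and
  \<open>\<phi>\<^sub>j(A\<^sub>j) = 1\<close> for \<open>j < N\<close>. Then \<open>\<Sum>\<^sub>n w\<^sub>n \<phi>\<^sub>n\<^sup>2 \<Prod>\<^sub>j (1 - \<phi>\<^sub>j\<^sup>2 (1 - \<psi>\<^sub>n\<^sub>j))\<close>, the product being over \<open>j \<noteq> n\<close>,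
  has the value \<open>w\<^sub>n\<close> at \<open>A\<^sub>n\<close> for all \<open>n < N\<close> and is bounded independently of \<open>N\<close>; let \<open>N\<close> tend to
  infinity.\<close>

section \<open>The Hardy space as a Hilbert space\<close>

abbreviation coef :: "hardy \<Rightarrow> nat \<Rightarrow> complex" where
  "coef f k \<equiv> fps_nth (taylor f) k"

lemma hardy_eqI: "(\<And>k. coef f k = coef g k) \<Longrightarrow> f = g"
  by (simp add: fps_eq_iff flip: taylor_inject)

lemma coef_zero [simp]: "coef 0 k = 0"
  by (simp add: zero_hardy.rep_eq)

lemma coef_add [simp]: "coef (f + g) k = coef f k + coef g k"
  by (simp add: plus_hardy.rep_eq)

lemma coef_diff [simp]: "coef (f - g) k = coef f k - coef g k"
  by (simp add: minus_hardy.rep_eq)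

lemma coef_minus [simp]: "coef (- f) k = - coef f k"
  by (simp add: uminus_hardy.rep_eq)

lemma coef_cscale [simp]: "coef (cscale c f) k = c * coef f k"
  by (simp add: cscale.rep_eq)

lemma coef_scaleR [simp]: "coef (r *\<^sub>R f) k = of_real r * coef f k"
  by (simp add: scaleR_hardy_def)

lemma coef_sum [simp]: "coef (\<Sum>i\<in>S. f i) k = (\<Sum>i\<in>S. coef (f i) k)"
  by (induction S rule: infinite_finite_induct) auto

definition of_coeffs :: "(nat \<Rightarrow> complex) \<Rightarrow> hardy" where
  "of_coeffs a = Hardy (Abs_fps a)"

lemma coef_of_coeffs:
  assumes "summable (\<lambda>n. (cmod (a n))\<^sup>2)"
  shows "coef (of_coeffs a) k = a k"
  using assms by (simp add: of_coeffs_def Hardy_inverse)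

lemma coef_of_coeffs_finite [simp]:
  "coef (of_coeffs (\<lambda>n. if n < N then a n else 0)) k = (if k < N then a k else 0)"
proof -
  have "summable (\<lambda>n. (cmod (if n < N then a n else 0))\<^sup>2)"
    by (rule summable_finite[of "{..<N}"]) auto
  then show ?thesis by (subst coef_of_coeffs) auto
qed

lemma norm_hardy_sums: "(\<lambda>k. (cmod (coef f k))\<^sup>2) sums (norm f)\<^sup>2"
  using summable_sums[OF summable_taylor[of f]]
  by (simp add: norm_hardy_def suminf_nonneg[OF summable_taylor])

lemma norm_hardy_partial: "(\<Sum>k<n. (cmod (coef f k))\<^sup>2) \<le> (norm f)\<^sup>2"
  using sum_le_suminf[OF summable_taylor, of "{..<n}" f] norm_hardy_sums[of f]
  by (simp add: sums_iff)

lemma norm_hardy_le: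
  assumes "\<And>n. (\<Sum>k<n. (cmod (coef f k))\<^sup>2) \<le> B"
  shows "(norm f)\<^sup>2 \<le> B"
  using norm_hardy_sums[of f, unfolded sums_def] by (rule LIMSEQ_le_const2) (use assms in auto)

lemma square_summableI:
  assumes "\<And>n. (\<Sum>k<n. (cmod (a k))\<^sup>2) \<le> B"
  shows "summable (\<lambda>k. (cmod (a k))\<^sup>2)"
  by (rule bounded_imp_summable[of _ B]) (use assms[of "Suc _"] in \<open>auto simp: lessThan_Suc_atMost\<close>)

lemma cmod_coef_le: "cmod (coef f k) \<le> norm f"
proof (rule power2_le_imp_le)
  have "(cmod (coef f k))\<^sup>2 \<le> (\<Sum>i<Suc k. (cmod (coef f i))\<^sup>2)"
    by (rule member_le_sum) auto
  also have "\<dots> \<le> (norm f)\<^sup>2" by (rule norm_hardy_partial)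
  finally show "(cmod (coef f k))\<^sup>2 \<le> (norm f)\<^sup>2" .
qed simp

lemma norm_hardy_finite:
  "(norm (of_coeffs (\<lambda>n. if n < N then a n else 0)))\<^sup>2 = (\<Sum>k<N. (cmod (a k))\<^sup>2)"
proof -
  define g where "g = of_coeffs (\<lambda>n. if n < N then a n else 0)"
  have g: "coef g k = (if k < N then a k else 0)" for k
    by (simp add: g_def)
  have "(\<lambda>k. (cmod (coef g k))\<^sup>2) sums (\<Sum>k<N. (cmod (coef g k))\<^sup>2)"
    by (rule sums_finite) (auto simp: g)
  from sums_unique2[OF norm_hardy_sums this] show ?thesis by (simp add: g flip: g_def)
qed

lemma cinner_add_left: "cinner (f + g) h = cinner f h + cinner g h"
  using suminf_add[OF summable_cinner summable_cinner] by (simp add: cinner_def ring_distribs)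

lemma cinner_cscale_left: "cinner (cscale c f) g = c * cinner f g"
  by (simp add: cinner_def suminf_mult[OF summable_cinner] mult.assoc)

lemma cinner_commute: "cinner g f = cnj (cinner f g)"
proof -
  have "cinner g f = (\<Sum>n. cnj (coef f n * cnj (coef g n)))"
    unfolding cinner_def by (simp add: mult.commute)
  also have "\<dots> = cnj (cinner f g)"
    unfolding cinner_def
    by (rule bounded_linear.suminf[OF bounded_linear_cnj summable_cinner, symmetric])
  finally show ?thesis .
qed

lemma cinner_add_right: "cinner f (g + h) = cinner f g + cinner f h"
  by (simp add: cinner_commute[of f] cinner_add_left)

lemma cinner_cscale_right: "cinner f (cscale c g) = cnj c * cinner f g"
  by (simp add: cinner_commute[of f] cinner_cscale_left)

lemma minus_eq_cscale: "- f = cscale (- 1) f"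
  by (rule hardy_eqI) simp

lemma cinner_diff_left: "cinner (f - g) h = cinner f h - cinner g h"
  using cinner_add_left[of "f - g" g h] by simp

lemma cinner_zero_left [simp]: "cinner 0 g = 0"
  by (simp add: cinner_def)

lemma cinner_zero_right [simp]: "cinner g 0 = 0"
  by (simp add: cinner_def)

lemma cinner_sum_right: "cinner g (\<Sum>i\<in>S. f i) = (\<Sum>i\<in>S. cinner g (f i))"
  by (induction S rule: infinite_finite_induct) (auto simp: cinner_add_right)

lemma norm_cscale [simp]: "norm (cscale c f) = cmod c * norm f"
proof -
  have "(\<lambda>k. (cmod c)\<^sup>2 * (cmod (coef f k))\<^sup>2) sums ((cmod c)\<^sup>2 * (norm f)\<^sup>2)"
    by (intro sums_mult norm_hardy_sums)
  moreover have "(\<lambda>k. (cmod c)\<^sup>2 * (cmod (coef f k))\<^sup>2) sums (norm (cscale c f))\<^sup>2"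
    using norm_hardy_sums[of "cscale c f"] by (simp add: norm_mult power_mult_distrib)
  ultimately have "(norm (cscale c f))\<^sup>2 = (cmod c * norm f)\<^sup>2"
    unfolding power_mult_distrib by (rule sums_unique2[symmetric])
  then show ?thesis by simp
qed

lemma Re_cinner: "Re (cinner f g) = inner f g"
  by (simp add: inner_hardy_def)

lemma cinner_self: "cinner f f = of_real ((norm f)\<^sup>2)"
proof -
  have "cinner f f = cnj (cinner f f)" by (rule cinner_commute)
  then have "Im (cinner f f) = 0" by (simp add: complex_eq_iff)
  then show ?thesis by (simp add: complex_eq_iff Re_cinner power2_norm_eq_inner)
qed

lemma cinner_cauchy_schwarz: "cmod (cinner f g) \<le> norm f * norm g"
proof (cases "cinner f g = 0")
  case False
  \<comment> \<open>After rotating \<open>f\<close> by the unimodular \<open>u\<close> the complex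
    inner product is a nonnegative real, so the real Cauchy-Schwarz inequality applies.\<close>
  define u where "u = cnj (cinner f g) / cmod (cinner f g)"
  have u: "cmod u = 1" using False by (simp add: u_def norm_divide)
  have "u * cinner f g = of_real (cmod (cinner f g))"
    using False by (simp add: u_def mult.commute[of "cnj _"] flip: complex_norm_square)
      (simp add: power2_eq_square)
  then have "cmod (cinner f g) = Re (cinner (cscale u f) g)"
    by (simp add: cinner_cscale_left)
  also have "\<dots> \<le> norm (cscale u f) * norm g"
    unfolding Re_cinner by (rule norm_cauchy_schwarz)
  finally show ?thesis using u by simp
qed simp

lemma cscale_cscale: "cscale a (cscale b f) = cscale (a * b) f"
  by (rule hardy_eqI) simp

lemma cscale_one [simp]: "cscale 1 f = f"
  by (rule hardy_eqI) simp

lemma cscale_zero [simp]: "cscale 0 f = 0" "cscale c 0 = 0"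
  by (rule hardy_eqI, simp)+

lemma cscale_add: "cscale c (f + g) = cscale c f + cscale c g"
  by (rule hardy_eqI) (simp add: ring_distribs)

lemma cscale_left_add: "cscale (c + d) f = cscale c f + cscale d f"
  by (rule hardy_eqI) (simp add: ring_distribs)

text \<open>Pythagoras: the subtracted vector is the orthogonal projection of \<open>f\<close> onto
  the complex line through \<open>g\<close>. Compared with \<open>sin_angle\<close> it turns angles
  into distances.\<close>

lemma norm_cinner_diff_sq:
  assumes "g \<noteq> 0"
  shows "(norm (f - cscale (cinner f g / (norm g)\<^sup>2) g))\<^sup>2 = (norm f)\<^sup>2 - (cmod (cinner f g))\<^sup>2 / (norm g)\<^sup>2"
proof -
  define t where "t = cinner f g / (norm g)\<^sup>2"
  have "(norm (f - cscale t g))\<^sup>2 = (norm f)\<^sup>2 - 2 * Re (cinner f (cscale t g)) + (norm (cscale t g))\<^sup>2"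
    unfolding Re_cinner power2_norm_eq_inner by (simp only: inner_diff inner_commute)
  also have "Re (cinner f (cscale t g)) = (cmod (cinner f g))\<^sup>2 / (norm g)\<^sup>2"
    by (simp add: cinner_cscale_right t_def mult.commute[of "cnj _"] flip: complex_norm_square)
  also have "(norm (cscale t g))\<^sup>2 = (cmod (cinner f g))\<^sup>2 / (norm g)\<^sup>2"
  proof -
    have "norm (cscale t g) = cmod (cinner f g) / norm g"
      using assms by (simp add: t_def norm_divide norm_mult power2_eq_square)
    then show ?thesis by (simp add: power_divide)
  qed
  finally show ?thesis by (simp add: t_def)
qed

text \<open>The limit is taken coefficientwise. Finite partial sums of squares pass to the limit,
  and bounds uniform in their length control the whole norm.\<close>

instance hardy :: banach
proof
  fix X :: "nat \<Rightarrow> hardy"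
  assume C: "Cauchy X"
  have "Cauchy (\<lambda>n. coef (X n) k)" for k
  proof (rule metric_CauchyI)
    fix e :: real assume "e > 0"
    then obtain M where M: "\<forall>m\<ge>M. \<forall>n\<ge>M. dist (X m) (X n) < e"
      using metric_CauchyD[OF C] by blast
    have "dist (coef (X m) k) (coef (X n) k) < e" if "m \<ge> M" "n \<ge> M" for m n
    proof -
      have "dist (coef (X m) k) (coef (X n) k) \<le> dist (X m) (X n)"
        using cmod_coef_le[of "X m - X n" k] by (simp add: dist_norm)
      then show ?thesis using M that by fastforce
    qed
    then show "\<exists>M. \<forall>m\<ge>M. \<forall>n\<ge>M. dist (coef (X m) k) (coef (X n) k) < e" by blast
  qed
  then have l: "(\<lambda>n. coef (X n) k) \<longlonglongrightarrow> lim (\<lambda>n. coef (X n) k)" for k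
    by (simp only: Cauchy_convergent_iff convergent_LIMSEQ_iff)
  define l where "l k = lim (\<lambda>n. coef (X n) k)" for k
  note l = l[folded l_def]
  have key: "(\<Sum>k<n. (cmod (coef (X m) k - l k))\<^sup>2) \<le> e\<^sup>2"
    if M: "\<forall>m\<ge>M. \<forall>n\<ge>M. dist (X m) (X n) < e" and m: "m \<ge> M" for e M m n
  proof (rule LIMSEQ_le_const2)
    show "(\<lambda>p. \<Sum>k<n. (cmod (coef (X m) k - coef (X p) k))\<^sup>2) \<longlonglongrightarrow> (\<Sum>k<n. (cmod (coef (X m) k - l k))\<^sup>2)"
      by (intro tendsto_intros l)
    have "(\<Sum>k<n. (cmod (coef (X m) k - coef (X p) k))\<^sup>2) \<le> e\<^sup>2" if "p \<ge> M" for p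
    proof -
      have "(\<Sum>k<n. (cmod (coef (X m) k - coef (X p) k))\<^sup>2) \<le> (norm (X m - X p))\<^sup>2"
        using norm_hardy_partial[of "X m - X p" n] by simp
      also have "\<dots> \<le> e\<^sup>2"
        using M m that by (intro power_mono) (simp_all add: dist_norm less_imp_le)
      finally show ?thesis .
    qed
    then show "\<exists>N. \<forall>p\<ge>N. (\<Sum>k<n. (cmod (coef (X m) k - coef (X p) k))\<^sup>2) \<le> e\<^sup>2" by blast
  qed
  have "\<exists>M. \<forall>m\<ge>M. \<forall>n\<ge>M. dist (X m) (X n) < 1"
    by (rule metric_CauchyD[OF C]) simp
  then obtain M where M: "\<forall>m\<ge>M. \<forall>n\<ge>M. dist (X m) (X n) < 1" ..
  have "summable (\<lambda>k. (cmod (coef (X M) k - l k))\<^sup>2)"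
    by (rule square_summableI[of _ "1\<^sup>2"], rule key[OF M]) auto
  from square_summable_diff[OF summable_taylor[of "X M"] this]
  have "summable (\<lambda>k. (cmod (l k))\<^sup>2)" by simp
  note L = coef_of_coeffs[OF this]
  have "X \<longlonglongrightarrow> of_coeffs l"
  proof (rule metric_LIMSEQ_I)
    fix e :: real assume e: "e > 0"
    have "\<exists>M. \<forall>m\<ge>M. \<forall>n\<ge>M. dist (X m) (X n) < e / 2"
      by (rule metric_CauchyD[OF C]) (use e in simp)
    then obtain M where M: "\<forall>m\<ge>M. \<forall>n\<ge>M. dist (X m) (X n) < e / 2" ..
    have "dist (X m) (of_coeffs l) < e" if "m \<ge> M" for m
    proof -
      have "(norm (X m - of_coeffs l))\<^sup>2 \<le> (e / 2)\<^sup>2"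
        using key[OF M that] by (intro norm_hardy_le) (simp add: L)
      then have "norm (X m - of_coeffs l) \<le> e / 2"
        by (rule power2_le_imp_le) (use e in simp)
      then show ?thesis using e by (simp add: dist_norm)
    qed
    then show "\<exists>no. \<forall>n\<ge>no. dist (X n) (of_coeffs l) < e" by blast
  qed
  then show "convergent X" by (rule convergentI)
qed

section \<open>Backward and forward shifts\<close>

definition bshift :: "hardy \<Rightarrow> hardy" where
  "bshift f = of_coeffs (\<lambda>k. coef f (Suc k))"

lemma coef_bshift [simp]: "coef (bshift f) k = coef f (Suc k)"
  unfolding bshift_def
  by (rule coef_of_coeffs, rule iffD2[OF summable_Suc_iff[of "\<lambda>k. (cmod (coef f k))\<^sup>2"]])
    (rule summable_taylor)

lemma bshift_zero [simp]: "bshift 0 = 0"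
  by (rule hardy_eqI) simp

lemma bshift_add: "bshift (f + g) = bshift f + bshift g"
  by (rule hardy_eqI) simp

lemma bshift_cscale: "bshift (cscale c f) = cscale c (bshift f)"
  by (rule hardy_eqI) simp

text \<open>The extension step of the lifting rests on this splitting: once the backward shift of a
  vector is prescribed, only the constant coefficient is left to choose.\<close>

lemma norm_bshift: "(norm f)\<^sup>2 = (cmod (coef f 0))\<^sup>2 + (norm (bshift f))\<^sup>2"
proof -
  have "(\<lambda>k. (cmod (coef f (Suc k)))\<^sup>2) sums ((norm f)\<^sup>2 - (cmod (coef f 0))\<^sup>2)"
    unfolding sums_Suc_iff[of "\<lambda>k. (cmod (coef f k))\<^sup>2"] by (simp add: norm_hardy_sums)
  moreover have "(\<lambda>k. (cmod (coef f (Suc k)))\<^sup>2) sums (norm (bshift f))\<^sup>2"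
    using norm_hardy_sums[of "bshift f"] by simp
  ultimately have "(norm f)\<^sup>2 - (cmod (coef f 0))\<^sup>2 = (norm (bshift f))\<^sup>2"
    by (rule sums_unique2)
  then show ?thesis by simp
qed

text \<open>For \<open>c = 0\<close> this is multiplication by \<open>z\<close>, the adjoint of
  \<open>bshift\<close>; general \<open>c\<close> runs through all preimages of \<open>f\<close>
  under \<open>bshift\<close>.\<close>

definition fshift :: "complex \<Rightarrow> hardy \<Rightarrow> hardy" where
  "fshift c f = of_coeffs (case_nat c (coef f))"

lemma coef_fshift [simp]: "coef (fshift c f) k = (case k of 0 \<Rightarrow> c | Suc k \<Rightarrow> coef f k)"
proof -
  have "summable (\<lambda>k. (cmod (case k of 0 \<Rightarrow> c | Suc k \<Rightarrow> coef f k))\<^sup>2)"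
    using iffD1[OF summable_Suc_iff, of "\<lambda>k. (cmod (case k of 0 \<Rightarrow> c | Suc k \<Rightarrow> coef f k))\<^sup>2"]
    by (simp add: summable_taylor)
  from coef_of_coeffs[OF this] show ?thesis by (simp add: fshift_def)
qed

lemma bshift_fshift [simp]: "bshift (fshift c f) = f"
  by (rule hardy_eqI) simp

lemma norm_tail_tendsto_zero:
  "(\<lambda>K. norm (f - of_coeffs (\<lambda>k. if k < K then coef f k else 0))) \<longlonglongrightarrow> 0"
proof -
  have eq: "(norm (f - of_coeffs (\<lambda>k. if k < K then coef f k else 0)))\<^sup>2 = (\<Sum>k. (cmod (coef f (k + K)))\<^sup>2)" for K
  proof -
    define g where "g = f - of_coeffs (\<lambda>k. if k < K then coef f k else 0)"
    have g: "coef g k = (if k < K then 0 else coef f k)" for k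
      by (simp add: g_def)
    have "(\<Sum>k<K. (cmod (coef g k))\<^sup>2) = 0" by (simp add: g)
    then have "(\<Sum>k. (cmod (coef g (k + K)))\<^sup>2) = (norm g)\<^sup>2"
      using suminf_split_initial_segment[OF summable_taylor[of g], of K] norm_hardy_sums[of g]
      by (simp only: sums_iff) simp
    then show ?thesis by (simp add: g flip: g_def)
  qed
  have "(\<lambda>K. \<Sum>k. (cmod (coef f (k + K)))\<^sup>2) \<longlonglongrightarrow> 0"
    by (rule suminf_exist_split2[OF summable_taylor])
  then have "(\<lambda>K. (norm (f - of_coeffs (\<lambda>k. if k < K then coef f k else 0)))\<^sup>2) \<longlonglongrightarrow> 0"
    by (simp only: eq)
  from tendsto_real_sqrt[OF this] show ?thesis by simp
qed

text \<open>Coefficients are bounded by the norm, so a geometric series dominates at every radius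
  below 1.\<close>

lemma fps_conv_radius_taylor: "fps_conv_radius (taylor f) \<ge> 1"
  unfolding fps_conv_radius_def
proof (rule conv_radius_geI_ex)
  fix r :: real assume r: "0 < r" "ereal r < 1"
  then have "r < 1" by (simp add: one_ereal_def)
  have "summable (\<lambda>n. norm f * r ^ n)"
    using r \<open>r < 1\<close> by (intro summable_mult summable_geometric) auto
  then have "summable (\<lambda>n. coef f n * of_real r ^ n)"
    by (rule summable_comparison_test'[where N = 0])
      (use r in \<open>auto simp: norm_mult norm_power intro!: mult_right_mono cmod_coef_le\<close>)
  then show "\<exists>z. norm z = r \<and> summable (\<lambda>n. coef f n * z ^ n)"
    using r by (intro exI[of _ "of_real r"]) auto
qed

lemma hardy_fun_sums:
  assumes "cmod z < 1"
  shows "(\<lambda>n. coef f n * z ^ n) sums hardy_fun f z"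
proof -
  have "ereal (norm z) < fps_conv_radius (taylor f)"
    using assms by (intro less_le_trans[OF _ fps_conv_radius_taylor]) (simp add: one_ereal_def)
  from summable_sums[OF summable_fps[OF this]] show ?thesis
    by (simp add: hardy_fun_def eval_fps_def)
qed

section \<open>Lifting contractions that intertwine backward shifts\<close>

text \<open>A Hahn--Banach extension step for a quadratic form \<open>Q\<close>, where \<open>D\<close> is the squared distance belonging
  to \<open>Q\<close>. The constant \<open>c\<close> is the limit of \<open>- l\<close> along a minimizing sequence of \<open>Q\<close>.\<close>

lemma affine_functional_extension:
  fixes Q :: "'a \<Rightarrow> real" and D :: "'a \<Rightarrow> 'a \<Rightarrow> real" and l :: "'a \<Rightarrow> complex"
  assumes ne: "S \<noteq> {}"
    and nonneg: "\<And>u. u \<in> S \<Longrightarrow> 0 \<le> Q u"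
    and convex: "\<And>u v s. u \<in> S \<Longrightarrow> v \<in> S \<Longrightarrow> 0 < s \<Longrightarrow> s < 1 \<Longrightarrow>
      \<exists>w\<in>S. Q w = (1 - s) * Q u + s * Q v - s * (1 - s) * D u v"
    and bound: "\<And>u v. u \<in> S \<Longrightarrow> v \<in> S \<Longrightarrow> (cmod (l u - l v))\<^sup>2 \<le> D u v"
  shows "\<exists>c. \<forall>u\<in>S. (cmod (l u + c))\<^sup>2 \<le> Q u"
proof -
  define m where "m = Inf (Q ` S)"
  have m_le: "m \<le> Q u" if "u \<in> S" for u
    unfolding m_def by (rule cInf_lower) (use that nonneg in \<open>auto intro!: bdd_belowI[of _ 0]\<close>)
  have m0: "0 \<le> m"
    unfolding m_def by (rule cInf_greatest) (use ne nonneg in auto)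
  \<comment> \<open>The value of \<open>Q\<close> at the convex combination is at least the infimum
    \<open>m\<close>, so \<open>l\<close> varies only as much as \<open>Q\<close> exceeds
    \<open>m\<close>.\<close>
  have ineq: "s * (1 - s) * (cmod (l u - l v))\<^sup>2 \<le> (1 - s) * (Q u - m) + s * (Q v - m)"
    if uv: "u \<in> S" "v \<in> S" and s: "0 < s" "s < 1" for u v s
  proof -
    obtain w where w: "w \<in> S" "Q w = (1 - s) * Q u + s * Q v - s * (1 - s) * D u v"
      using convex[OF uv s] by blast
    have "s * (1 - s) * (cmod (l u - l v))\<^sup>2 \<le> s * (1 - s) * D u v"
      using bound[OF uv] s by (intro mult_left_mono) auto
    then show ?thesis using m_le[OF w(1)] w(2) by (simp add: algebra_simps)
  qed
  have "\<exists>u\<in>S. Q u < m + 1 / real (Suc n)" for n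
  proof -
    have "\<exists>q\<in>Q ` S. q < m + 1 / real (Suc n)"
      unfolding m_def by (rule cInf_lessD) (use ne in auto)
    then show ?thesis by blast
  qed
  then obtain f where f: "\<And>n. f n \<in> S" "\<And>n. Q (f n) < m + 1 / real (Suc n)" by metis
  have "Cauchy (\<lambda>n. l (f n))"
  proof (rule metric_CauchyI)
    fix e :: real assume e: "e > 0"
    then obtain N where N: "4 / e\<^sup>2 < real N" using reals_Archimedean2 by blast
    have "dist (l (f i)) (l (f j)) < e" if ij: "i \<ge> N" "j \<ge> N" for i j
    proof -
      have "1 / real (Suc n) < e\<^sup>2 / 4" if "n \<ge> N" for n
      proof -
        have "4 / e\<^sup>2 < real (Suc n)" using N that by linarith
        then show ?thesis using e by (simp add: field_simps)
      qed
      then have *: "Q (f i) - m < e\<^sup>2 / 4" "Q (f j) - m < e\<^sup>2 / 4"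
        using f(2)[of i] f(2)[of j] ij by (smt (verit))+
      \<comment> \<open>The choice \<open>s = 1/2\<close> shows that \<open>l\<close> is Cauchy
        along the minimizing sequence.\<close>
      have "(cmod (l (f i) - l (f j)))\<^sup>2 \<le> 2 * (Q (f i) - m) + 2 * (Q (f j) - m)"
        using ineq[OF f(1)[of i] f(1)[of j], of "1/2"] by (simp add: field_simps)
      also have "\<dots> < e\<^sup>2" using * by simp
      finally show ?thesis using e power_less_imp_less_base[of _ 2 e] by (auto simp: dist_norm)
    qed
    then show "\<exists>M. \<forall>i\<ge>M. \<forall>j\<ge>M. dist (l (f i)) (l (f j)) < e" by blast
  qed
  then have "convergent (\<lambda>n. l (f n))" by (simp only: Cauchy_convergent_iff)
  then obtain L where L: "(\<lambda>n. l (f n)) \<longlonglongrightarrow> L" unfolding convergent_def ..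
  have "(cmod (l u + (- L)))\<^sup>2 \<le> Q u" if u: "u \<in> S" for u
  proof (rule field_le_mult_one_interval)
    fix z :: real assume z: "0 < z" "z < 1"
    define s where "s = 1 - z"
    have s: "0 < s" "s < 1" using z by (auto simp: s_def)
    \<comment> \<open>Along the minimizing sequence the excess of \<open>Q (f n)\<close> over
      \<open>m\<close> tends to 0. Cancelling \<open>s\<close> leaves the factor
      \<open>1 - s = z\<close>, which may be arbitrarily close to 1.\<close>
    have "s * (1 - s) * (cmod (L - l u))\<^sup>2 \<le> (1 - s) * 0 + s * Q u"
    proof (rule LIMSEQ_le)
      show "(\<lambda>n. s * (1 - s) * (cmod (l (f n) - l u))\<^sup>2) \<longlonglongrightarrow> s * (1 - s) * (cmod (L - l u))\<^sup>2"
        by (intro tendsto_intros L)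
      show "(\<lambda>n. (1 - s) * (1 / real (Suc n)) + s * Q u) \<longlonglongrightarrow> (1 - s) * 0 + s * Q u"
        by (intro tendsto_intros) (use LIMSEQ_inverse_real_of_nat in \<open>simp add: inverse_eq_divide\<close>)
      have "s * (1 - s) * (cmod (l (f n) - l u))\<^sup>2 \<le> (1 - s) * (1 / real (Suc n)) + s * Q u" for n
      proof -
        have "(1 - s) * (Q (f n) - m) \<le> (1 - s) * (1 / real (Suc n))"
          using f(2)[of n] s by (intro mult_left_mono) auto
        moreover have "s * (Q u - m) \<le> s * Q u"
          using m0 s by (intro mult_left_mono) auto
        ultimately show ?thesis using ineq[OF f(1)[of n] u s] by linarith
      qed
      then show "\<exists>N. \<forall>n\<ge>N. s * (1 - s) * (cmod (l (f n) - l u))\<^sup>2 \<le> (1 - s) * (1 / real (Suc n)) + s * Q u"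
        by blast
    qed
    then have "(1 - s) * (cmod (L - l u))\<^sup>2 \<le> Q u"
      using s by (simp add: mult.assoc)
    then show "z * (cmod (l u + (- L)))\<^sup>2 \<le> Q u"
      by (simp add: s_def norm_minus_commute)
  qed
  then show ?thesis by blast
qed

text \<open>The graph of a linear contraction from a subspace of the \<open>N\<close>-fold sum of the Hardy space to the
  Hardy space that intertwines the backward shifts. Components \<open>r j\<close> with \<open>j \<ge> N\<close> do not contribute
  to the norm.\<close>

definition lift_graph :: "nat \<Rightarrow> ((nat \<Rightarrow> hardy) \<times> hardy) set \<Rightarrow> bool" where
  "lift_graph N G \<longleftrightarrow>
     (\<lambda>j. 0, 0) \<in> G \<and>
     (\<forall>r x s y. (r, x) \<in> G \<longrightarrow> (s, y) \<in> G \<longrightarrow> (\<lambda>j. r j + s j, x + y) \<in> G) \<and>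
     (\<forall>r x c. (r, x) \<in> G \<longrightarrow> (\<lambda>j. cscale c (r j), cscale c x) \<in> G) \<and>
     (\<forall>r x. (r, x) \<in> G \<longrightarrow> (\<lambda>j. bshift (r j), bshift x) \<in> G) \<and>
     (\<forall>r x. (r, x) \<in> G \<longrightarrow> (norm x)\<^sup>2 \<le> (\<Sum>j<N. (norm (r j))\<^sup>2))"

lemma lift_graphD:
  assumes "lift_graph N G"
  shows "(\<lambda>j. 0, 0) \<in> G"
    and "(r, x) \<in> G \<Longrightarrow> (s, y) \<in> G \<Longrightarrow> (\<lambda>j. r j + s j, x + y) \<in> G"
    and "(r, x) \<in> G \<Longrightarrow> (\<lambda>j. cscale c (r j), cscale c x) \<in> G"
    and "(r, x) \<in> G \<Longrightarrow> (\<lambda>j. bshift (r j), bshift x) \<in> G"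
    and "(r, x) \<in> G \<Longrightarrow> (norm x)\<^sup>2 \<le> (\<Sum>j<N. (norm (r j))\<^sup>2)"
  using assms unfolding lift_graph_def by blast+

lemma lift_graph_diff:
  assumes "lift_graph N G" "(r, x) \<in> G" "(s, y) \<in> G"
  shows "(\<lambda>j. r j - s j, x - y) \<in> G"
  using lift_graphD(2)[OF assms(1,2) lift_graphD(3)[OF assms(1,3), of "- 1"]]
  by (simp flip: minus_eq_cscale)

lemma lift_graph_sum:
  assumes "lift_graph N G" "\<And>i. i \<in> S \<Longrightarrow> (r i, x i) \<in> G"
  shows "(\<lambda>j. \<Sum>i\<in>S. r i j, \<Sum>i\<in>S. x i) \<in> G"
  using assms(2)
proof (induction S rule: infinite_finite_induct)
  case (insert a F)
  then have "(\<lambda>j. r a j + (\<Sum>i\<in>F. r i j), x a + (\<Sum>i\<in>F. x i)) \<in> G"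
    by (intro lift_graphD(2)[OF assms(1)]) auto
  with insert show ?case by simp
qed (use lift_graphD(1)[OF assms(1)] in auto)

text \<open>Weighted parallelogram law. It makes the quadratic form in
  \<open>lift_graph_extend\<close> meet the \<open>convex\<close> hypothesis of
  \<open>affine_functional_extension\<close>.\<close>

lemma norm_sq_convex_combination:
  fixes a b :: "'a::real_inner"
  shows "(norm ((1 - t) *\<^sub>R a + t *\<^sub>R b))\<^sup>2
    = (1 - t) * (norm a)\<^sup>2 + t * (norm b)\<^sup>2 - t * (1 - t) * (norm (a - b))\<^sup>2"
  unfolding power2_norm_eq_inner
  by (simp add: inner_add inner_diff inner_commute algebra_simps)

lemma lift_graph_extend:
  assumes G: "lift_graph N G" and g: "(\<lambda>j. bshift (g j), y0) \<in> G"
  shows "\<exists>y. lift_graph N {(\<lambda>j. r j + cscale t (g j), x + cscale t y) |r x t. (r, x) \<in> G}"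
proof -
  \<comment> \<open>The backward shift of \<open>y\<close> has to be \<open>y0\<close>, so only the constant coefficient of \<open>y\<close> is free, and
    contractivity confines it to one disc for each element of \<open>G\<close>.\<close>
  define Q :: "(nat \<Rightarrow> hardy) \<times> hardy \<Rightarrow> real" where
    "Q = (\<lambda>(r, x). (\<Sum>j<N. (norm (r j + g j))\<^sup>2) - (norm (bshift x + y0))\<^sup>2)"
  \<comment> \<open>\<open>Q\<close> is the room that contractivity at \<open>r + g\<close> leaves
    for the squared modulus of the constant coefficient once \<open>norm_bshift\<close> has split
    off the shifted part; \<open>D\<close> is its analogue for differences of elements of
    \<open>G\<close>.\<close>
  define D :: "(nat \<Rightarrow> hardy) \<times> hardy \<Rightarrow> (nat \<Rightarrow> hardy) \<times> hardy \<Rightarrow> real" where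
    "D = (\<lambda>(r, x) (s, y). (\<Sum>j<N. (norm (r j - s j))\<^sup>2) - (norm (bshift x - bshift y))\<^sup>2)"
  note G' = lift_graphD[OF G]
  have "\<exists>c. \<forall>u\<in>G. (cmod (coef (snd u) 0 + c))\<^sup>2 \<le> Q u"
  proof (rule affine_functional_extension[where D = D])
    show "G \<noteq> {}" using G'(1) by auto
    show "0 \<le> Q u" if "u \<in> G" for u
    proof -
      obtain r x where u: "u = (r, x)" by force
      \<comment> \<open>The shifted element belongs to \<open>G\<close>, where contractivity is
        known, and \<open>bshift\<close> does not increase norms.\<close>
      have "(\<lambda>j. bshift (r j) + bshift (g j), bshift x + y0) \<in> G"
        using that unfolding u by (intro G'(2,4) g)
      from G'(5)[OF this] have "(norm (bshift x + y0))\<^sup>2 \<le> (\<Sum>j<N. (norm (bshift (r j + g j)))\<^sup>2)"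
        by (simp add: bshift_add)
      also have "\<dots> \<le> (\<Sum>j<N. (norm (r j + g j))\<^sup>2)"
        by (rule sum_mono) (simp add: norm_bshift[of "_ + _"])
      finally show ?thesis by (simp add: Q_def u)
    qed
    show "(cmod (coef (snd u) 0 - coef (snd v) 0))\<^sup>2 \<le> D u v" if "u \<in> G" "v \<in> G" for u v
    proof -
      obtain r x s y where u: "u = (r, x)" and v: "v = (s, y)" by force
      have "(norm (x - y))\<^sup>2 \<le> (\<Sum>j<N. (norm (r j - s j))\<^sup>2)"
        by (rule G'(5), rule lift_graph_diff[OF G]) (use that u v in auto)
      moreover have "bshift (x - y) = bshift x - bshift y" by (rule hardy_eqI) simp
      ultimately show ?thesis
        unfolding norm_bshift[of "x - y"] by (simp add: D_def u v)
    qed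
    show "\<exists>w\<in>G. Q w = (1 - t) * Q u + t * Q v - t * (1 - t) * D u v"
      if "u \<in> G" "v \<in> G" for u v and t :: real
    proof -
      obtain r x s y where u: "u = (r, x)" and v: "v = (s, y)" by force
      let ?w = "(\<lambda>j. (1 - t) *\<^sub>R r j + t *\<^sub>R s j, (1 - t) *\<^sub>R x + t *\<^sub>R y)"
      have "?w \<in> G"
        unfolding scaleR_hardy_def using that by (intro G'(2,3)) (auto simp: u v)
      have c: "(1 - t) *\<^sub>R a + t *\<^sub>R b + e = (1 - t) *\<^sub>R (a + e) + t *\<^sub>R (b + e)" for a b e :: hardy
        by (simp add: algebra_simps)
      have b: "bshift ((1 - t) *\<^sub>R x + t *\<^sub>R y) = (1 - t) *\<^sub>R bshift x + t *\<^sub>R bshift y"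
        by (rule hardy_eqI) simp
      have "Q ?w = (1 - t) * Q u + t * Q v - t * (1 - t) * D u v"
        by (simp add: Q_def D_def u v b c norm_sq_convex_combination sum.distrib sum_subtractf
            flip: sum_distrib_left) (simp add: algebra_simps)
      with \<open>?w \<in> G\<close> show ?thesis by blast
    qed
  qed
  then obtain c where c: "\<And>r x. (r, x) \<in> G \<Longrightarrow> (cmod (coef x 0 + c))\<^sup>2 \<le> Q (r, x)"
    by (metis snd_conv)
  define y where "y = fshift c y0"
  have contr1: "(norm (x + y))\<^sup>2 \<le> (\<Sum>j<N. (norm (r j + g j))\<^sup>2)" if "(r, x) \<in> G" for r x
    using c[OF that] unfolding norm_bshift[of "x + y"] by (simp add: y_def Q_def bshift_add)
  \<comment> \<open>Coefficient 1 gives every nonzero \<open>t\<close> by homogeneity;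
    \<open>t = 0\<close> is contractivity of \<open>G\<close> itself.\<close>
  have contr: "(norm (x + cscale t y))\<^sup>2 \<le> (\<Sum>j<N. (norm (r j + cscale t (g j)))\<^sup>2)"
    if rx: "(r, x) \<in> G" for r x t
  proof (cases "t = 0")
    case False
    have eq: "f + cscale t h = cscale t (cscale (inverse t) f + h)" for f h
      using False by (simp add: cscale_add cscale_cscale)
    have "(norm (cscale (inverse t) x + y))\<^sup>2 \<le> (\<Sum>j<N. (norm (cscale (inverse t) (r j) + g j))\<^sup>2)"
      by (rule contr1, rule G'(3)[OF rx])
    then have "(cmod t)\<^sup>2 * (norm (cscale (inverse t) x + y))\<^sup>2
        \<le> (cmod t)\<^sup>2 * (\<Sum>j<N. (norm (cscale (inverse t) (r j) + g j))\<^sup>2)"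
      by (rule mult_left_mono) simp
    then show ?thesis by (simp add: eq power_mult_distrib sum_distrib_left)
  qed (use G'(5)[OF rx] in simp)
  let ?G = "{(\<lambda>j. r j + cscale t (g j), x + cscale t y) |r x t. (r, x) \<in> G}"
  have memI: "(s, z) \<in> ?G" if "(r, x) \<in> G" "s = (\<lambda>j. r j + cscale t (g j))" "z = x + cscale t y" for r x s z t
    using that by blast
  have "lift_graph N ?G"
    unfolding lift_graph_def
  proof (intro conjI allI impI)
    show "(\<lambda>j. 0, 0) \<in> ?G"
      by (rule memI[OF G'(1), of _ 0]) auto
  next
    fix r x s z assume "(r, x) \<in> ?G" "(s, z) \<in> ?G"
    then obtain r' x' t s' z' t' where
      "(r', x') \<in> G" "r = (\<lambda>j. r' j + cscale t (g j))" "x = x' + cscale t y"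
      "(s', z') \<in> G" "s = (\<lambda>j. s' j + cscale t' (g j))" "z = z' + cscale t' y" by blast
    then show "(\<lambda>j. r j + s j, x + z) \<in> ?G"
      by (intro memI[OF G'(2)[of r' x' s' z'], of _ "t + t'"]) (auto simp: cscale_left_add)
  next
    fix r x a assume "(r, x) \<in> ?G"
    then obtain r' x' t where
      "(r', x') \<in> G" "r = (\<lambda>j. r' j + cscale t (g j))" "x = x' + cscale t y" by blast
    then show "(\<lambda>j. cscale a (r j), cscale a x) \<in> ?G"
      by (intro memI[OF G'(3)[of r' x' a], of _ "a * t"]) (auto simp: cscale_add cscale_cscale)
  next
    fix r x assume "(r, x) \<in> ?G"
    then obtain r' x' t where rx:
      "(r', x') \<in> G" "r = (\<lambda>j. r' j + cscale t (g j))" "x = x' + cscale t y" by blast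
    \<comment> \<open>The shift of a new element already lies in \<open>G\<close>, so it belongs to
      the new graph with \<open>t = 0\<close>.\<close>
    have "(\<lambda>j. bshift (r' j) + cscale t (bshift (g j)), bshift x' + cscale t y0) \<in> G"
      by (intro G'(2,3,4) rx g)
    then show "(\<lambda>j. bshift (r j), bshift x) \<in> ?G"
      by (rule memI[of _ _ _ 0]) (auto simp: rx y_def bshift_add bshift_cscale)
  next
    fix r x assume "(r, x) \<in> ?G"
    then show "(norm x)\<^sup>2 \<le> (\<Sum>j<N. (norm (r j))\<^sup>2)"
      using contr by blast
  qed
  then show ?thesis by blast
qed

text \<open>Zorn's lemma. A maximal graph has no proper extension by
  \<open>lift_graph_extend\<close>, so its domain contains every \<open>g\<close> whose backward
  shift it contains.\<close>

lemma lift_graph_maximal: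
  assumes "lift_graph N G0"
  obtains G where "G0 \<subseteq> G" "lift_graph N G"
    "\<And>g y0. (\<lambda>j. bshift (g j), y0) \<in> G \<Longrightarrow> \<exists>y. (g, y) \<in> G"
proof -
  define A where "A = {G. G0 \<subseteq> G \<and> lift_graph N G}"
  have "\<exists>M\<in>A. \<forall>X\<in>A. M \<subseteq> X \<longrightarrow> X = M"
  proof (rule subset_Zorn_nonempty)
    show "A \<noteq> {}" using assms by (auto simp: A_def)
    fix C assume ne: "C \<noteq> {}" and ch: "subset.chain A C"
    have sub: "\<And>X. X \<in> C \<Longrightarrow> G0 \<subseteq> X" "\<And>X. X \<in> C \<Longrightarrow> lift_graph N X"
      and lin: "\<And>X Y. X \<in> C \<Longrightarrow> Y \<in> C \<Longrightarrow> X \<subseteq> Y \<or> Y \<subseteq> X"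
      using ch unfolding A_def subset.chain_def by blast+
    note D = lift_graphD[OF sub(2)]
    have "lift_graph N (\<Union>C)"
      unfolding lift_graph_def
    proof (intro conjI allI impI)
      show "(\<lambda>j. 0, 0) \<in> \<Union>C" using ne D(1) by blast
    next
      fix r x s y assume "(r, x) \<in> \<Union>C" "(s, y) \<in> \<Union>C"
      then obtain X Y where "X \<in> C" "Y \<in> C" "(r, x) \<in> X" "(s, y) \<in> Y" by blast
      then show "(\<lambda>j. r j + s j, x + y) \<in> \<Union>C"
        using lin[of X Y] D(2)[of X r x s y] D(2)[of Y r x s y] by blast
    qed (use D(3-5) in blast)+
    then show "\<Union>C \<in> A" using sub(1) ne by (auto simp: A_def)
  qed
  then obtain G where G: "G0 \<subseteq> G" "lift_graph N G"
    and max: "\<And>X. G0 \<subseteq> X \<Longrightarrow> lift_graph N X \<Longrightarrow> G \<subseteq> X \<Longrightarrow> X = G"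
    by (auto simp: A_def)
  show ?thesis
  proof (rule that[OF G])
    fix g y0 assume "(\<lambda>j. bshift (g j), y0) \<in> G"
    from lift_graph_extend[OF G(2) this] obtain y where
      y: "lift_graph N {(\<lambda>j. r j + cscale t (g j), x + cscale t y) |r x t. (r, x) \<in> G}" (is "lift_graph N ?G") ..
    have "G \<subseteq> ?G"
    proof
      fix u assume "u \<in> G"
      moreover obtain r x where "u = (r, x)" by force
      moreover have "u = (\<lambda>j. r j + cscale 0 (g j), x + cscale 0 y)" using calculation by simp
      ultimately show "u \<in> ?G" by blast
    qed
    then have "?G = G" using max[OF _ y] G(1) by blast
    moreover have "(\<lambda>j. 0 + cscale 1 (g j), 0 + cscale 1 y) \<in> ?G"
      using lift_graphD(1)[OF G(2)] by (intro CollectI exI[of _ "\<lambda>j. 0"] exI[of _ 0] exI[of _ 1]) simp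
    ultimately show "\<exists>y. (g, y) \<in> G" by auto
  qed
qed

definition monomial :: "nat \<Rightarrow> hardy" where
  "monomial k = of_coeffs (\<lambda>n. if n < Suc k then (if n = k then 1 else 0) else 0)"

lemma coef_monomial [simp]: "coef (monomial k) n = (if n = k then 1 else 0)"
  by (simp add: monomial_def)

lemma bshift_monomial [simp]: "bshift (monomial 0) = 0" "bshift (monomial (Suc k)) = monomial k"
  by (rule hardy_eqI, simp)+

text \<open>A case of commutant lifting: the contraction with graph \<open>G0\<close> extends to the adjoint of the
  multiplication by \<open>(p 0, \<dots>, p (N - 1))\<close>. Since \<open>G0\<close> is shift invariant, constant coefficients
  determine everything.\<close>

theorem contractive_lifting:
  assumes "lift_graph N G0"
  obtains p :: "nat \<Rightarrow> hardy" where
    "\<And>z. cmod z < 1 \<Longrightarrow> (\<Sum>j<N. (cmod (hardy_fun (p j) z))\<^sup>2) \<le> 1"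
    "\<And>r x. (r, x) \<in> G0 \<Longrightarrow> coef x 0 = (\<Sum>j<N. cinner (r j) (p j))"
proof -
  obtain G where G0: "G0 \<subseteq> G" and G: "lift_graph N G"
    and ext: "\<And>g y0. (\<lambda>j. bshift (g j), y0) \<in> G \<Longrightarrow> \<exists>y. (g, y) \<in> G"
    by (rule lift_graph_maximal[OF assms]) blast
  note G' = lift_graphD[OF G]
  have unique: "x = x'" if "(r, x) \<in> G" "(r, x') \<in> G" for r x x'
    using G'(5)[OF lift_graph_diff[OF G that]] by simp
  define e :: "nat \<Rightarrow> nat \<Rightarrow> nat \<Rightarrow> hardy" where "e k j = (\<lambda>i. if i = j then monomial k else 0)" for k j
  have e0: "(\<lambda>i. bshift (e 0 j i)) = (\<lambda>i. 0)" and eS: "(\<lambda>i. bshift (e (Suc k) j i)) = e k j" for j k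
    by (auto simp: e_def fun_eq_iff)
  \<comment> \<open>The backward shift of \<open>e (Suc k) j\<close> is \<open>e k j\<close> and
    that of \<open>e 0 j\<close> is 0, so closure under shift preimages puts all of them into the
    domain.\<close>
  have "\<exists>y. (e k j, y) \<in> G" for k j
  proof (induction k)
    case 0
    show ?case by (rule ext[of _ 0]) (simp add: e0 G'(1))
  next
    case (Suc k)
    then obtain y where "(e k j, y) \<in> G" ..
    then show ?case by (intro ext[of _ y]) (simp add: eS)
  qed
  then obtain y where y: "\<And>k j. (e k j, y k j) \<in> G" by metis
  have y0: "bshift (y 0 j) = 0" and yS: "bshift (y (Suc k) j) = y k j" for k j
    using unique[OF G'(4)[OF y[of 0 j]]] unique[OF G'(4)[OF y[of "Suc k" j]]]
    unfolding e0 eS using G'(1) y by blast+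
  define c where "c k j = coef (y k j) 0" for k j
  \<comment> \<open>Toeplitz structure: lowering \<open>k\<close> and \<open>i\<close> together by
    one changes nothing, so only \<open>k - i\<close> matters.\<close>
  have coef_y: "coef (y k j) i = (if i \<le> k then c (k - i) j else 0)" for k j i
  proof (induction i arbitrary: k)
    case (Suc i)
    have "coef (y k j) (Suc i) = coef (bshift (y k j)) i" by simp
    then show ?case by (cases k) (auto simp: y0 yS Suc.IH simp del: coef_bshift)
  qed (simp add: c_def)
  \<comment> \<open>\<open>R K a\<close> is a tuple of polynomials of degree below \<open>K\<close>,
    and \<open>X K a\<close> is its image by linearity.\<close>
  define R where "R K a = (\<lambda>i. if i < N then of_coeffs (\<lambda>n. if n < K then a n i else 0) else 0)"
    for K and a :: "nat \<Rightarrow> nat \<Rightarrow> complex"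
  define X where "X K a = (\<Sum>j<N. \<Sum>k<K. cscale (a k j) (y k j))" for K and a :: "nat \<Rightarrow> nat \<Rightarrow> complex"
  have RX: "(R K a, X K a) \<in> G" for K a
  proof -
    have "(\<lambda>i. \<Sum>j<N. \<Sum>k<K. cscale (a k j) (e k j i), X K a) \<in> G"
      unfolding X_def by (intro lift_graph_sum[OF G] G'(3) y)
    also have "(\<lambda>i. \<Sum>j<N. \<Sum>k<K. cscale (a k j) (e k j i)) = R K a"
    proof
      fix i
      have "(\<Sum>k<K. cscale (a k j) (e k j i))
          = (if i = j then of_coeffs (\<lambda>n. if n < K then a n i else 0) else 0)" for j
        by (rule hardy_eqI) (auto simp: e_def if_distrib cong: if_cong)
      then show "(\<Sum>j<N. \<Sum>k<K. cscale (a k j) (e k j i)) = R K a i"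
        by (simp add: R_def)
    qed
    finally show ?thesis .
  qed
  have X_le: "(norm (X K a))\<^sup>2 \<le> (\<Sum>j<N. \<Sum>k<K. (cmod (a k j))\<^sup>2)" for K a
    using G'(5)[OF RX[of K a]] by (simp add: R_def norm_hardy_finite)
  have coef_X: "coef (X K a) 0 = (\<Sum>j<N. \<Sum>k<K. a k j * c k j)" for K a
    by (simp add: X_def coef_y)
  have c_le: "(\<Sum>k<K. (cmod (c k j))\<^sup>2) \<le> 1" if j: "j < N" for K j
  proof -
    \<comment> \<open>The conjugate coefficients form a tuple of squared norm \<open>s\<close> whose
      image has constant coefficient \<open>s\<close>; contractivity gives
      \<open>s\<^sup>2 \<le> s\<close>.\<close>
    define a where "a k i = (if i = j then cnj (c k j) else 0)" for k i
    define s where "s = (\<Sum>k<K. (cmod (c k j))\<^sup>2)"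
    have s0: "s \<ge> 0" by (simp add: s_def sum_nonneg)
    have "(\<Sum>k<K. a k i * c k i) = (if i = j then of_real s else 0)" for i
      by (simp add: a_def s_def mult.commute[of "cnj _"] flip: complex_norm_square)
    then have "coef (X K a) 0 = of_real s" using j by (simp add: coef_X)
    then have "s\<^sup>2 \<le> (norm (X K a))\<^sup>2"
      using cmod_coef_le[of "X K a" 0] s0 by (intro power_mono) auto
    also have "\<dots> \<le> (\<Sum>i<N. \<Sum>k<K. (cmod (a k i))\<^sup>2)" by (rule X_le)
    also have "\<dots> = (\<Sum>i<N. if i = j then s else 0)"
      by (intro sum.cong) (auto simp: a_def s_def)
    also have "\<dots> = s" using j by simp
    finally have "s * s \<le> 1 * s" by (simp add: power2_eq_square)
    then show ?thesis unfolding s_def[symmetric] using s0 by (cases "s = 0") auto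
  qed
  \<comment> \<open>The conjugate compensates for the one in the second argument of
    \<open>cinner\<close>.\<close>
  define p where "p j = of_coeffs (\<lambda>k. cnj (c k j))" for j
  have coef_p: "coef (p j) k = cnj (c k j)" if "j < N" for j k
    unfolding p_def using c_le[OF that] by (intro coef_of_coeffs square_summableI[of _ 1]) simp
  show ?thesis
  proof (rule that[of p])
    fix r x assume "(r, x) \<in> G0"
    then have rx: "(r, x) \<in> G" using G0 by blast
    define a where "a k j = coef (r j) k" for k j
    \<comment> \<open>Truncation approximates \<open>r\<close> by polynomial tuples, and
      contractivity bounds the error in \<open>x\<close> by the tails of \<open>r\<close>.\<close>
    have "(\<lambda>K. coef x 0 - coef (X K a) 0) \<longlonglongrightarrow> 0"
    proof (rule Lim_null_comparison)
      have "(cmod (coef x 0 - coef (X K a) 0))\<^sup>2 \<le> (\<Sum>j<N. (norm (r j - R K a j))\<^sup>2)" for K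
      proof -
        have "(cmod (coef (x - X K a) 0))\<^sup>2 \<le> (norm (x - X K a))\<^sup>2"
          by (intro power_mono cmod_coef_le) simp
        also have "\<dots> \<le> (\<Sum>j<N. (norm (r j - R K a j))\<^sup>2)"
          by (rule G'(5)[OF lift_graph_diff[OF G rx RX]])
        finally show ?thesis by simp
      qed
      then show "\<forall>\<^sub>F K in sequentially. norm (coef x 0 - coef (X K a) 0) \<le> sqrt (\<Sum>j<N. (norm (r j - R K a j))\<^sup>2)"
        by (intro always_eventually allI real_le_rsqrt)
      have "(\<lambda>K. norm (r j - R K a j)) \<longlonglongrightarrow> 0" if "j < N" for j
        using that norm_tail_tendsto_zero[of "r j"] by (simp add: R_def a_def cong: if_cong)
      then have "(\<lambda>K. sqrt (\<Sum>j<N. (norm (r j - R K a j))\<^sup>2)) \<longlonglongrightarrow> sqrt (\<Sum>j<N. 0\<^sup>2)"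
        by (intro tendsto_intros) auto
      then show "(\<lambda>K. sqrt (\<Sum>j<N. (norm (r j - R K a j))\<^sup>2)) \<longlonglongrightarrow> 0" by simp
    qed
    then have lim1: "(\<lambda>K. coef (X K a) 0) \<longlonglongrightarrow> coef x 0"
      using tendsto_diff[OF tendsto_const[of "coef x 0"]] by fastforce
    have "(\<lambda>K. \<Sum>k<K. a k j * c k j) \<longlonglongrightarrow> cinner (r j) (p j)" if "j < N" for j
      using summable_sums[OF summable_cinner[of "r j" "p j"]] that
      by (simp add: coef_p a_def sums_def cinner_def)
    then have "(\<lambda>K. coef (X K a) 0) \<longlonglongrightarrow> (\<Sum>j<N. cinner (r j) (p j))"
      unfolding coef_X by (intro tendsto_sum) simp
    with lim1 show "coef x 0 = (\<Sum>j<N. cinner (r j) (p j))" by (rule LIMSEQ_unique)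
  next
    fix w :: complex assume w: "cmod w < 1"
    \<comment> \<open>The adjoint of a multiplier scales the reproducing kernel at \<open>w\<close>.
      The tuple \<open>u\<close> times the truncated kernel with coefficients
      \<open>cnj w ^ k\<close> has squared norm at most \<open>S / (1 - q)\<close> and an image
      close to \<open>S\<close> times the kernel, so contractivity amounts to
      \<open>S\<^sup>2 \<le> S\<close>.\<close>
    define u where "u j = hardy_fun (p j) w" for j
    define S where "S = (\<Sum>j<N. (cmod (u j))\<^sup>2)"
    define q where "q = (cmod w)\<^sup>2"
    define s where "s n = (\<Sum>j<N. u j * (\<Sum>m<n. cnj w ^ m * c m j))" for n
    have q: "0 \<le> q" "q < 1" using w abs_square_less_1[of "cmod w"] by (auto simp: q_def)
    have S0: "S \<ge> 0" by (simp add: S_def sum_nonneg)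
    have "(\<lambda>n. \<Sum>m<n. cnj w ^ m * c m j) \<longlonglongrightarrow> cnj (u j)" if "j < N" for j
    proof -
      have "(\<lambda>n. cnj (\<Sum>m<n. coef (p j) m * w ^ m)) \<longlonglongrightarrow> cnj (u j)"
        using hardy_fun_sums[OF w, of "p j"] unfolding sums_def u_def by (intro tendsto_cnj)
      then show ?thesis using that by (simp add: coef_p mult.commute)
    qed
    then have "s \<longlonglongrightarrow> (\<Sum>j<N. u j * cnj (u j))"
      unfolding s_def[abs_def] by (intro tendsto_intros) auto
    also have "(\<Sum>j<N. u j * cnj (u j)) = of_real S"
      by (simp add: S_def flip: complex_norm_square)
    finally have s: "s \<longlonglongrightarrow> of_real S" .
    \<comment> \<open>Only the first \<open>I\<close> coefficients of the image are kept, while the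
      degree \<open>K + I\<close> leaves more than \<open>K\<close> terms in each
      \<open>s (K + I - i)\<close>. Thus \<open>K\<close> tends to infinity first, then
      \<open>I\<close>.\<close>
    have bound: "(\<Sum>i<I. q ^ i * (cmod (s (K + I - i)))\<^sup>2) \<le> S / (1 - q)" for I K
    proof -
      define a where "a k j = u j * cnj w ^ k" for k j
      have "(\<Sum>i<I. q ^ i * (cmod (s (K + I - i)))\<^sup>2) = (\<Sum>i<I. (cmod (coef (X (K + I) a) i))\<^sup>2)"
      proof (intro sum.cong refl)
        fix i assume "i \<in> {..<I}"
        then have i: "i < I" by simp
        have "(\<Sum>k<K + I. a k j * coef (y k j) i) = cnj w ^ i * (u j * (\<Sum>m<K + I - i. cnj w ^ m * c m j))" for j
        proof -
          have "(\<Sum>k<K + I. a k j * coef (y k j) i) = (\<Sum>k\<in>{i..<K + I}. a k j * c (k - i) j)"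
            by (intro sum.mono_neutral_cong_right) (auto simp: coef_y)
          also have "\<dots> = (\<Sum>m<K + I - i. a (m + i) j * c m j)"
            using i by (intro sum.reindex_bij_witness[of _ "\<lambda>m. m + i" "\<lambda>k. k - i"]) auto
          also have "\<dots> = cnj w ^ i * (u j * (\<Sum>m<K + I - i. cnj w ^ m * c m j))"
            by (simp add: a_def sum_distrib_left power_add mult_ac)
          finally show ?thesis .
        qed
        then have "coef (X (K + I) a) i = cnj w ^ i * s (K + I - i)"
          by (simp add: X_def s_def sum_distrib_left)
        then show "q ^ i * (cmod (s (K + I - i)))\<^sup>2 = (cmod (coef (X (K + I) a) i))\<^sup>2"
          by (simp add: norm_mult norm_power power_mult_distrib q_def power_mult[symmetric] mult.commute)
      qed
      also have "\<dots> \<le> (norm (X (K + I) a))\<^sup>2" by (rule norm_hardy_partial)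
      also have "\<dots> \<le> (\<Sum>j<N. \<Sum>k<K + I. (cmod (a k j))\<^sup>2)" by (rule X_le)
      also have "\<dots> = S * (\<Sum>k<K + I. q ^ k)"
      proof -
        have "(cmod (a k j))\<^sup>2 = (cmod (u j))\<^sup>2 * q ^ k" for k j
          by (simp add: a_def q_def norm_mult norm_power power_mult_distrib power_mult[symmetric] mult.commute)
        then show ?thesis by (simp only: S_def sum_product)
      qed
      also have "\<dots> \<le> S * (1 / (1 - q))"
      proof (rule mult_left_mono[OF _ S0])
        have "(\<Sum>k<K + I. q ^ k) \<le> (\<Sum>k. q ^ k)"
          using q by (intro sum_le_suminf summable_geometric) auto
        then show "(\<Sum>k<K + I. q ^ k) \<le> 1 / (1 - q)" using q by (simp add: suminf_geometric)
      qed
      finally show ?thesis by simp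
    qed
    have "(\<Sum>i<I. q ^ i * S\<^sup>2) \<le> S / (1 - q)" for I
    proof (rule LIMSEQ_le_const2)
      have "(\<lambda>K. s (K + I - i)) \<longlonglongrightarrow> of_real S" if "i < I" for i
        using LIMSEQ_ignore_initial_segment[OF s, of "I - i"] that by simp
      then have "(\<lambda>K. \<Sum>i<I. q ^ i * (cmod (s (K + I - i)))\<^sup>2) \<longlonglongrightarrow> (\<Sum>i<I. q ^ i * (cmod (of_real S))\<^sup>2)"
        by (intro tendsto_intros) auto
      then show "(\<lambda>K. \<Sum>i<I. q ^ i * (cmod (s (K + I - i)))\<^sup>2) \<longlonglongrightarrow> (\<Sum>i<I. q ^ i * S\<^sup>2)"
        by simp
    qed (use bound in blast)
    moreover have "(\<lambda>I. \<Sum>i<I. q ^ i * S\<^sup>2) \<longlonglongrightarrow> 1 / (1 - q) * S\<^sup>2"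
      using sums_mult2[OF geometric_sums[of q], of "S\<^sup>2"] q by (simp add: sums_def)
    ultimately have "1 / (1 - q) * S\<^sup>2 \<le> S / (1 - q)"
      by (intro LIMSEQ_le_const2) auto
    then have "S * S \<le> 1 * S" using q by (simp add: divide_simps power2_eq_square)
    then show "(\<Sum>j<N. (cmod (hardy_fun (p j) w))\<^sup>2) \<le> 1"
      unfolding u_def[symmetric] S_def[symmetric] using S0 by (cases "S = 0") auto
  qed
qed

section \<open>Bounded holomorphic functions as multipliers\<close>

definition tcoef :: "(complex \<Rightarrow> complex) \<Rightarrow> nat \<Rightarrow> complex" where
  "tcoef f k = (deriv ^^ k) f 0 / fact k"

lemma tcoef_sums:
  assumes "f holomorphic_on ball 0 1" "cmod z < 1"
  shows "(\<lambda>k. tcoef f k * z ^ k) sums f z"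
  using holomorphic_power_series[OF assms(1), of z] assms(2) by (simp add: tcoef_def)

lemma hardy_fun_holomorphic: "hardy_fun f holomorphic_on ball 0 1"
  unfolding hardy_fun_def
proof (rule holomorphic_on_eval_fps)
  show "ball (0::complex) 1 \<subseteq> eball 0 (fps_conv_radius (taylor f))"
  proof
    fix z :: complex assume "z \<in> ball 0 1"
    then have "ereal (dist 0 z) < 1" by (simp add: one_ereal_def)
    then show "z \<in> eball 0 (fps_conv_radius (taylor f))"
      using fps_conv_radius_taylor[of f] by (simp only: in_eball_iff)
  qed
qed

lemma tcoef_hardy_fun [simp]: "tcoef (hardy_fun f) k = coef f k"
proof -
  have "fps_conv_radius (taylor f) > 0"
    by (rule less_le_trans[OF _ fps_conv_radius_taylor]) simp
  from fps_nth_fps_expansion[OF eval_fps_has_fps_expansion[OF this]]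
  show ?thesis by (simp add: tcoef_def hardy_fun_def)
qed

lemma tcoef_cong:
  assumes "\<And>z. cmod z < 1 \<Longrightarrow> f z = g z"
  shows "tcoef f k = tcoef g k"
proof -
  have "eventually (\<lambda>z. z \<in> ball 0 1) (nhds (0::complex))"
    by (intro eventually_nhds_in_open) auto
  then have "eventually (\<lambda>z. f z = g z) (nhds 0)"
    by eventually_elim (use assms in auto)
  from higher_deriv_cong_ev[OF this refl] show ?thesis by (simp add: tcoef_def)
qed

lemma tcoef_mult:
  assumes "f holomorphic_on ball 0 1" "g holomorphic_on ball 0 1"
  shows "tcoef (\<lambda>z. f z * g z) k = (\<Sum>i\<le>k. tcoef f i * tcoef g (k - i))"
proof -
  have "(deriv ^^ k) (\<lambda>z. f z * g z) 0
      = (\<Sum>i=0..k. of_nat (k choose i) * (deriv ^^ i) f 0 * (deriv ^^ (k - i)) g 0)"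
    by (rule higher_deriv_mult[OF assms]) auto
  also have "\<dots> = (\<Sum>i\<le>k. fact k * (tcoef f i * tcoef g (k - i)))"
    by (intro sum.cong) (auto simp: tcoef_def binomial_fact)
  finally show ?thesis by (simp add: tcoef_def[of "\<lambda>z. f z * g z"] flip: sum_distrib_left)
qed

lemma hardy_fun_finite:
  assumes "cmod z < 1"
  shows "hardy_fun (of_coeffs (\<lambda>n. if n < N then a n else 0)) z = (\<Sum>i<N. a i * z ^ i)"
proof -
  let ?f = "of_coeffs (\<lambda>n. if n < N then a n else 0)"
  have "(\<lambda>n. coef ?f n * z ^ n) sums (\<Sum>i<N. coef ?f i * z ^ i)"
    by (rule sums_finite) auto
  from sums_unique2[OF hardy_fun_sums[OF assms] this] show ?thesis by simp
qed

text \<open>On the circle \<open>cnj u = r\<^sup>2 / u\<close>, which turns Cauchy's formula for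
  higher derivatives into an integral against a conjugate power and produces the factor
  \<open>r ^ (2 * k)\<close>.\<close>

lemma has_integral_circle_coefficient:
  assumes f: "f holomorphic_on ball 0 1" and r: "0 < r" "r < 1"
  shows "((\<lambda>t. f (circlepath 0 r t) * cnj (circlepath 0 r t) ^ k) has_integral (of_real r ^ (2 * k) * tcoef f k)) {0..1}"
proof -
  let ?\<gamma> = "circlepath 0 r"
  have "((\<lambda>u. f u / (u - 0) ^ Suc k) has_contour_integral (2 * pi * \<i>) / fact k * (deriv ^^ k) f 0) ?\<gamma>"
  proof (rule Cauchy_has_contour_integral_higher_derivative_circlepath)
    show "continuous_on (cball 0 r) f"
      by (rule holomorphic_on_imp_continuous_on, rule holomorphic_on_subset[OF f]) (use r in auto)
    show "f holomorphic_on ball 0 r"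
      by (rule holomorphic_on_subset[OF f]) (use r in auto)
  qed (use r in auto)
  then have "((\<lambda>t. of_real r ^ (2 * k) / (2 * pi * \<i>) * (f (?\<gamma> t) / (?\<gamma> t - 0) ^ Suc k * vector_derivative ?\<gamma> (at t within {0..1})))
      has_integral of_real r ^ (2 * k) / (2 * pi * \<i>) * ((2 * pi * \<i>) / fact k * (deriv ^^ k) f 0)) {0..1}"
    unfolding has_contour_integral_def by (rule has_integral_mult_right)
  moreover have "of_real r ^ (2 * k) / (2 * pi * \<i>) * ((2 * pi * \<i>) / fact k * (deriv ^^ k) f 0)
      = of_real r ^ (2 * k) * tcoef f k"
  proof -
    have *: "a / c * (c / d * e) = a * (e / d)" if "c \<noteq> 0" for a c d e :: complex
      using that by simp
    show ?thesis unfolding tcoef_def by (rule *) simp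
  qed
  moreover have "of_real r ^ (2 * k) / (2 * pi * \<i>) * (f (?\<gamma> t) / (?\<gamma> t - 0) ^ Suc k * vector_derivative ?\<gamma> (at t within {0..1}))
      = f (?\<gamma> t) * cnj (?\<gamma> t) ^ k" if "t \<in> {0..1}" for t
  proof -
    define u where "u = ?\<gamma> t"
    have nz: "u \<noteq> 0" using r by (simp add: u_def circlepath)
    have vd: "vector_derivative ?\<gamma> (at t within {0..1}) = 2 * pi * \<i> * u"
      using that by (simp add: vector_derivative_circlepath01 u_def) (simp add: circlepath)
    have "cmod u = r" using r by (simp add: u_def circlepath norm_mult)
    then have "u * cnj u = (of_real r)\<^sup>2"
      by (simp only: complex_norm_square[symmetric] of_real_power)
    then have "of_real r ^ (2 * k) = u ^ k * cnj u ^ k"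
      by (simp add: power_mult flip: power_mult_distrib)
    then show ?thesis using nz unfolding u_def[symmetric] vd by (simp add: field_simps)
  qed
  ultimately show ?thesis by (metis (no_types, lifting) has_integral_eq)
qed

lemma has_integral_circle_polynomial:
  assumes f: "f holomorphic_on ball 0 1" and r: "0 < r" "r < 1"
  shows "((\<lambda>t. f (circlepath 0 r t) * cnj (\<Sum>i<n. b i * circlepath 0 r t ^ i)) has_integral
    (\<Sum>i<n. of_real (r ^ (2 * i)) * (tcoef f i * cnj (b i)))) {0..1}"
proof -
  have "((\<lambda>t. \<Sum>i<n. cnj (b i) * (f (circlepath 0 r t) * cnj (circlepath 0 r t) ^ i)) has_integral
    (\<Sum>i<n. cnj (b i) * (of_real r ^ (2 * i) * tcoef f i))) {0..1}"
    by (intro has_integral_sum has_integral_mult_right has_integral_circle_coefficient assms) auto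
  then show ?thesis by (simp add: sum_distrib_left mult_ac)
qed

text \<open>The proof integrates \<open>|g - q|\<^sup>2 \<ge> 0\<close> over circles of radius \<open>r < 1\<close>, where \<open>q\<close> is a Taylor
  polynomial of \<open>g\<close>.\<close>

lemma multiplier_polynomial_bound:
  fixes a :: "nat \<Rightarrow> complex" and n :: nat
  assumes f: "f holomorphic_on ball 0 1" and M: "\<And>z. cmod z < 1 \<Longrightarrow> cmod (f z) \<le> M"
  defines "p \<equiv> of_coeffs (\<lambda>k. if k < n then a k else 0)"
  shows "(\<Sum>i<n. (cmod (tcoef (\<lambda>z. f z * hardy_fun p z) i))\<^sup>2) \<le> M\<^sup>2 * (\<Sum>i<n. (cmod (a i))\<^sup>2)"
proof -
  define g where "g = (\<lambda>z. f z * hardy_fun p z)"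
  define q where "q = of_coeffs (\<lambda>k. if k < n then tcoef g k else 0)"
  have g: "g holomorphic_on ball 0 1"
    unfolding g_def by (intro holomorphic_intros f hardy_fun_holomorphic)
  have M0: "M \<ge> 0" using order_trans[OF norm_ge_zero M[of 0]] by simp
  \<comment> \<open>Since \<open>f\<close> is given on the open disc only, the estimate is made at
    radii below 1, with a right-hand side independent of \<open>r\<close>; then \<open>r\<close>
    tends to 1.\<close>
  have main: "(\<Sum>i<n. r ^ (2 * i) * (cmod (tcoef g i))\<^sup>2) \<le> M\<^sup>2 * (\<Sum>i<n. (cmod (a i))\<^sup>2)"
    if r: "0 < r" "r < 1" for r
  proof -
    let ?\<gamma> = "circlepath 0 r"
    define S where "S = (\<Sum>i<n. r ^ (2 * i) * (cmod (tcoef g i))\<^sup>2)"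
    define P where "P = (\<Sum>i<n. r ^ (2 * i) * (cmod (a i))\<^sup>2)"
    have c1: "cmod (?\<gamma> t) < 1" for t using r by (simp add: circlepath norm_mult)
    have hq: "hardy_fun q (?\<gamma> t) = (\<Sum>i<n. tcoef g i * ?\<gamma> t ^ i)" for t
      unfolding q_def by (rule hardy_fun_finite[OF c1])
    have hp: "hardy_fun p (?\<gamma> t) = (\<Sum>i<n. a i * ?\<gamma> t ^ i)" for t
      unfolding p_def by (rule hardy_fun_finite[OF c1])
    have sq: "(\<Sum>i<n. of_real (r ^ (2 * i)) * (b i * cnj (b i))) = complex_of_real (\<Sum>i<n. r ^ (2 * i) * (cmod (b i))\<^sup>2)" for b
      by (simp only: of_real_sum of_real_mult complex_norm_square)
    have "((\<lambda>t. g (?\<gamma> t) * cnj (hardy_fun q (?\<gamma> t))) has_integral of_real S) {0..1}"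
      using has_integral_circle_polynomial[OF g r, where n = n and b = "tcoef g"] unfolding hq sq S_def .
    from has_integral_Re[OF this] have 1: "((\<lambda>t. Re (g (?\<gamma> t) * cnj (hardy_fun q (?\<gamma> t)))) has_integral S) {0..1}" by simp
    have "((\<lambda>t. hardy_fun q (?\<gamma> t) * cnj (hardy_fun q (?\<gamma> t))) has_integral of_real S) {0..1}"
    proof -
      have "(\<Sum>i<n. of_real (r ^ (2 * i)) * (tcoef (hardy_fun q) i * cnj (tcoef g i))) = of_real S"
        unfolding S_def sq[symmetric] by (intro sum.cong) (auto simp: q_def)
      then show ?thesis
        using has_integral_circle_polynomial[OF hardy_fun_holomorphic[of q] r, where n = n and b = "tcoef g"]
        unfolding hq[symmetric] by simp
    qed
    from has_integral_Re[OF this] have 2: "((\<lambda>t. (cmod (hardy_fun q (?\<gamma> t)))\<^sup>2) has_integral S) {0..1}"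
      by (simp flip: complex_norm_square)
    have "((\<lambda>t. hardy_fun p (?\<gamma> t) * cnj (hardy_fun p (?\<gamma> t))) has_integral of_real P) {0..1}"
    proof -
      have "(\<Sum>i<n. of_real (r ^ (2 * i)) * (tcoef (hardy_fun p) i * cnj (a i))) = of_real P"
        unfolding P_def sq[symmetric] by (intro sum.cong) (auto simp: p_def)
      then show ?thesis
        using has_integral_circle_polynomial[OF hardy_fun_holomorphic[of p] r, where n = n and b = a]
        unfolding hp[symmetric] by simp
    qed
    from has_integral_Re[OF this] have 3: "((\<lambda>t. (cmod (hardy_fun p (?\<gamma> t)))\<^sup>2) has_integral P) {0..1}"
      by (simp flip: complex_norm_square)
    \<comment> \<open>The integrand dominates \<open>|g - q|\<^sup>2\<close> because
      \<open>|g| \<le> M * |p|\<close>. The mixed term without its factor 2 and the square of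
      \<open>q\<close> both integrate to \<open>S\<close>, which leaves
      \<open>S \<le> M\<^sup>2 * P\<close>.\<close>
    have "((\<lambda>t. M\<^sup>2 * (cmod (hardy_fun p (?\<gamma> t)))\<^sup>2 - 2 * Re (g (?\<gamma> t) * cnj (hardy_fun q (?\<gamma> t)))
        + (cmod (hardy_fun q (?\<gamma> t)))\<^sup>2) has_integral M\<^sup>2 * P - 2 * S + S) {0..1}"
      by (intro has_integral_add has_integral_diff has_integral_mult_right 1 2 3)
    then have "0 \<le> M\<^sup>2 * P - 2 * S + S"
    proof (rule has_integral_nonneg)
      fix t
      let ?x = "g (?\<gamma> t)" and ?y = "hardy_fun q (?\<gamma> t)"
      have "(cmod (?x - ?y))\<^sup>2 = (cmod ?x)\<^sup>2 - 2 * Re (?x * cnj ?y) + (cmod ?y)\<^sup>2"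
        unfolding cmod_power2 by (simp add: power2_eq_square algebra_simps)
      moreover have "(cmod ?x)\<^sup>2 \<le> M\<^sup>2 * (cmod (hardy_fun p (?\<gamma> t)))\<^sup>2"
        using M[OF c1] M0 by (auto simp: g_def norm_mult power_mult_distrib intro!: mult_right_mono power_mono)
      ultimately show "0 \<le> M\<^sup>2 * (cmod (hardy_fun p (?\<gamma> t)))\<^sup>2 - 2 * Re (?x * cnj ?y) + (cmod ?y)\<^sup>2"
        using zero_le_power2[of "cmod (?x - ?y)"] by linarith
    qed
    moreover have "P \<le> (\<Sum>i<n. (cmod (a i))\<^sup>2)"
      unfolding P_def using r by (intro sum_mono mult_left_le_one_le) (auto simp: power_le_one)
    then have "M\<^sup>2 * P \<le> M\<^sup>2 * (\<Sum>i<n. (cmod (a i))\<^sup>2)" by (rule mult_left_mono) simp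
    ultimately show ?thesis unfolding S_def by linarith
  qed
  have "(\<Sum>i<n. 1 ^ (2 * i) * (cmod (tcoef g i))\<^sup>2) \<le> M\<^sup>2 * (\<Sum>i<n. (cmod (a i))\<^sup>2)"
  proof (rule tendsto_upperbound)
    show "((\<lambda>r. \<Sum>i<n. r ^ (2 * i) * (cmod (tcoef g i))\<^sup>2) \<longlongrightarrow> (\<Sum>i<n. 1 ^ (2 * i) * (cmod (tcoef g i))\<^sup>2)) (at_left 1)"
      by (intro tendsto_intros)
    have "eventually (\<lambda>r. r \<in> {0<..<1::real}) (at_left 1)"
      by (rule eventually_at_leftI[of 0]) auto
    then show "eventually (\<lambda>r. (\<Sum>i<n. r ^ (2 * i) * (cmod (tcoef g i))\<^sup>2) \<le> M\<^sup>2 * (\<Sum>i<n. (cmod (a i))\<^sup>2)) (at_left (1::real))"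
      by eventually_elim (use main in auto)
  qed simp
  then show ?thesis by (simp add: g_def)
qed

lemma multiplier_bound:
  assumes f: "f holomorphic_on ball 0 1" and M: "\<And>z. cmod z < 1 \<Longrightarrow> cmod (f z) \<le> M"
  obtains g where "\<And>z. cmod z < 1 \<Longrightarrow> hardy_fun g z = f z * hardy_fun h z" "norm g \<le> M * norm h"
proof -
  have M0: "M \<ge> 0" using order_trans[OF norm_ge_zero M[of 0]] by simp
  define c where "c = tcoef (\<lambda>z. f z * hardy_fun h z)"
  have le: "(\<Sum>i<n. (cmod (c i))\<^sup>2) \<le> (M * norm h)\<^sup>2" for n
  proof -
    \<comment> \<open>The first \<open>n\<close> coefficients of the product only see the first \<open>n\<close> coefficients of \<open>h\<close>.\<close>
    define p where "p = of_coeffs (\<lambda>k. if k < n then coef h k else 0)"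
    have "c i = tcoef (\<lambda>z. f z * hardy_fun p z) i" if "i < n" for i
      unfolding c_def tcoef_mult[OF f hardy_fun_holomorphic] tcoef_hardy_fun
      by (intro sum.cong refl) (use that in \<open>simp add: p_def\<close>)
    then have "(\<Sum>i<n. (cmod (c i))\<^sup>2) = (\<Sum>i<n. (cmod (tcoef (\<lambda>z. f z * hardy_fun p z) i))\<^sup>2)"
      by simp
    also have "\<dots> \<le> M\<^sup>2 * (\<Sum>i<n. (cmod (coef h i))\<^sup>2)"
      unfolding p_def by (rule multiplier_polynomial_bound[OF f M])
    also have "\<dots> \<le> M\<^sup>2 * (norm h)\<^sup>2"
      by (intro mult_left_mono norm_hardy_partial) simp
    finally show ?thesis by (simp add: power_mult_distrib)
  qed
  have coef: "coef (of_coeffs c) k = c k" for k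
    by (rule coef_of_coeffs[OF square_summableI[OF le]])
  show ?thesis
  proof (rule that[of "of_coeffs c"])
    fix z :: complex assume z: "cmod z < 1"
    have "(\<lambda>k. c k * z ^ k) sums (f z * hardy_fun h z)"
      unfolding c_def by (intro tcoef_sums z holomorphic_intros f hardy_fun_holomorphic)
    then show "hardy_fun (of_coeffs c) z = f z * hardy_fun h z"
      using hardy_fun_sums[OF z, of "of_coeffs c"] sums_unique2 by (simp add: coef)
  next
    have "(norm (of_coeffs c))\<^sup>2 \<le> (M * norm h)\<^sup>2"
      by (rule norm_hardy_le) (simp add: coef le)
    then show "norm (of_coeffs c) \<le> M * norm h"
      by (rule power2_le_imp_le) (simp add: M0)
  qed
qed

section \<open>The functional calculus as a power series\<close>

lemma tcoef_diff:
  assumes "f holomorphic_on ball 0 1" "g holomorphic_on ball 0 1"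
  shows "tcoef (\<lambda>z. f z - g z) k = tcoef f k - tcoef g k"
  using higher_deriv_diff[OF assms, of 0 k] by (simp add: tcoef_def diff_divide_distrib)

lemma tcoef_add:
  assumes "f holomorphic_on ball 0 1" "g holomorphic_on ball 0 1"
  shows "tcoef (\<lambda>z. f z + g z) k = tcoef f k + tcoef g k"
  using higher_deriv_add[OF assms, of 0 k] by (simp add: tcoef_def add_divide_distrib)

lemma tcoef_const: "tcoef (\<lambda>z. c) k = (if k = 0 then c else 0)"
  by (cases k) (auto simp: tcoef_def)

section \<open>Matrix powers, the Neumann series and the calculus\<close>

lemma index_mult_mat_sum:
  assumes "A \<in> carrier_mat n n" "B \<in> carrier_mat n n" "i < n" "j < n"
  shows "(A * B) $$ (i, j) = (\<Sum>l<n. A $$ (i, l) * B $$ (l, j))"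
  using assms by (simp add: scalar_prod_def atLeast0LessThan)

lemma pow_mat_add:
  assumes "A \<in> carrier_mat n n"
  shows "A ^\<^sub>m (a + b) = A ^\<^sub>m a * A ^\<^sub>m b"
proof (induction b)
  case 0
  then show ?case using assms by simp
next
  case (Suc b)
  then show ?case using assms by (simp add: assoc_mult_mat[of _ n n _ n _ n])
qed

lemma pow_smult_mat:
  fixes A :: "complex mat"
  assumes "A \<in> carrier_mat n n"
  shows "(c \<cdot>\<^sub>m A) ^\<^sub>m k = c ^ k \<cdot>\<^sub>m (A ^\<^sub>m k)"
proof (induction k)
  case 0
  then show ?case using assms by (intro eq_matI) auto
next
  case (Suc k)
  have "A ^\<^sub>m k \<in> carrier_mat n n" using assms by simp
  then have "c ^ k \<cdot>\<^sub>m (A ^\<^sub>m k) * (c \<cdot>\<^sub>m A) = (c ^ k * c) \<cdot>\<^sub>m (A ^\<^sub>m k * A)"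
    using assms by (intro eq_matI) (auto simp: mult_smult_distrib[of _ n n _ n] mult_smult_assoc_mat[of _ n n _ n])
  with Suc show ?case by (simp add: mult.commute)
qed

text \<open>Positive dimension makes the spectrum nonempty, so that \<open>spectral_radius\<close>
  is attained.\<close>

locale disc_matrix =
  fixes A :: "complex mat" and n :: nat
  assumes carrier: "A \<in> carrier_mat n n" and dim_pos: "n > 0"
    and spectrum: "spectrum A \<subseteq> ball 0 1"
begin

lemma spectral_radius_bounds: "0 \<le> spectral_radius A" "spectral_radius A < 1"
  using spectral_radius_mem_max(1)[OF carrier dim_pos] spectrum by auto

text \<open>Division by \<open>r\<close> makes the spectral radius less than 1, and then the Jordan
  normal form bounds the entries of all powers.\<close>

lemma power_bound:
  assumes r: "spectral_radius A < r"
  shows "\<exists>C\<ge>0. \<forall>k. \<forall>i<n. \<forall>j<n. cmod ((A ^\<^sub>m k) $$ (i, j)) \<le> C * r ^ k"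
proof -
  have r0: "r > 0" using r spectral_radius_bounds(1) by linarith
  define B where "B = complex_of_real (1 / r) \<cdot>\<^sub>m A"
  have B: "B \<in> carrier_mat n n" using carrier by (simp add: B_def)
  have AB: "A = complex_of_real r \<cdot>\<^sub>m B"
    using r0 by (intro eq_matI) (auto simp: B_def)
  have "spectral_radius B \<in> norm ` spectrum B"
    by (rule spectral_radius_mem_max(1)[OF B dim_pos])
  then obtain \<mu> where \<mu>: "\<mu> \<in> spectrum B" "spectral_radius B = cmod \<mu>" by auto
  obtain v where v: "v \<in> carrier_vec n" "v \<noteq> 0\<^sub>v n" "B *\<^sub>v v = \<mu> \<cdot>\<^sub>v v"
    using \<mu>(1) B by (auto simp: spectrum_def eigenvalue_def eigenvector_def)
  have "A *\<^sub>v v = of_real r \<cdot>\<^sub>v (B *\<^sub>v v)"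
    unfolding AB using B v(1) by (intro eq_vecI) (auto simp: scalar_prod_def sum_distrib_left mult.assoc)
  then have "A *\<^sub>v v = (of_real r * \<mu>) \<cdot>\<^sub>v v"
    unfolding v(3) by (simp add: smult_smult_assoc)
  then have "of_real r * \<mu> \<in> spectrum A"
    using v carrier by (auto simp: spectrum_def eigenvalue_def eigenvector_def)
  then have "cmod (of_real r * \<mu>) \<le> spectral_radius A"
    by (intro spectral_radius_mem_max(2)[OF carrier dim_pos]) blast
  then have "cmod \<mu> \<le> spectral_radius A / r" using r0 by (simp add: norm_mult field_simps)
  also have "\<dots> < 1" using r r0 by simp
  finally have "spectral_radius B < 1" unfolding \<mu>(2) .
  from spectral_radius_jnf_norm_bound_less_1_upper_triangular[OF B this]
  obtain c where c: "\<And>k. norm_bound (B ^\<^sub>m k) c" by blast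
  have bound: "cmod ((A ^\<^sub>m k) $$ (i, j)) \<le> \<bar>c\<bar> * r ^ k" if "i < n" "j < n" for k i j
  proof -
    have "cmod ((B ^\<^sub>m k) $$ (i, j)) \<le> c"
      using c[of k] that B unfolding norm_bound_def by simp
    then have "cmod ((B ^\<^sub>m k) $$ (i, j)) \<le> \<bar>c\<bar>" by linarith
    then have "r ^ k * cmod ((B ^\<^sub>m k) $$ (i, j)) \<le> r ^ k * \<bar>c\<bar>"
      using r0 by (intro mult_left_mono) auto
    moreover have "(A ^\<^sub>m k) $$ (i, j) = of_real r ^ k * (B ^\<^sub>m k) $$ (i, j)"
      unfolding AB pow_smult_mat[OF B] using that B by simp
    ultimately show ?thesis using r0 by (simp add: norm_mult norm_power mult.commute)
  qed
  then show ?thesis by (intro exI[of _ "\<bar>c\<bar>"]) auto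
qed

text \<open>Neumann series, dominated by a geometric one because the powers grow at most like
  \<open>r ^ m\<close> for some \<open>r < cmod z\<close>.\<close>

lemma resolvent_sums:
  assumes z: "spectral_radius A < cmod z" and ij: "i < n" "j < n"
  shows "(\<lambda>m. (A ^\<^sub>m m) $$ (i, j) / z ^ Suc m) sums (resolvent A z $$ (i, j))"
proof -
  obtain r where r: "spectral_radius A < r" "r < cmod z" using dense[OF z] by blast
  have r0: "r > 0" using r spectral_radius_bounds(1) by linarith
  have z0: "z \<noteq> 0" using r r0 by auto
  have q: "r / cmod z < 1" using r z0 by (simp add: divide_less_eq_1)
  obtain C where C: "\<And>k i j. i < n \<Longrightarrow> j < n \<Longrightarrow> cmod ((A ^\<^sub>m k) $$ (i, j)) \<le> C * r ^ k" "C \<ge> 0"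
    using power_bound[OF r(1)] by auto
  have summ: "summable (\<lambda>m. (A ^\<^sub>m m) $$ (i, j) / z ^ Suc m)" if "i < n" "j < n" for i j
  proof (rule summable_comparison_test'[where N = 0])
    show "summable (\<lambda>m. C / cmod z * (r / cmod z) ^ m)"
      using q r0 by (intro summable_mult summable_geometric) auto
    show "norm ((A ^\<^sub>m m) $$ (i, j) / z ^ Suc m) \<le> C / cmod z * (r / cmod z) ^ m" for m
      using C(1)[OF that, of m] z0
      by (auto simp: norm_divide norm_mult norm_power power_divide divide_simps mult_ac)
  qed
  define R where "R = mat n n (\<lambda>(i, j). \<Sum>m. (A ^\<^sub>m m) $$ (i, j) / z ^ Suc m)"
  define T where "T = z \<cdot>\<^sub>m 1\<^sub>m n - A"
  have R: "R \<in> carrier_mat n n" and T: "T \<in> carrier_mat n n"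
    using carrier by (auto simp: R_def T_def)
  have Rs: "(\<lambda>m. (A ^\<^sub>m m) $$ (i, j) / z ^ Suc m) sums (R $$ (i, j))" if "i < n" "j < n" for i j
    using summable_sums[OF summ[OF that]] that by (simp add: R_def)
  \<comment> \<open>Multiplication by \<open>A\<close> shifts the series by one index, so only the
    term \<open>m = 0\<close> of \<open>z\<close> times the series survives.\<close>
  have "T * R = 1\<^sub>m n"
  proof (rule eq_matI)
    fix i j assume ij: "i < dim_row (1\<^sub>m n :: complex mat)" "j < dim_col (1\<^sub>m n :: complex mat)"
    then have ij: "i < n" "j < n" by auto
    have "(T * R) $$ (i, j) = (\<Sum>l<n. ((if i = l then z else 0) - A $$ (i, l)) * R $$ (l, j))"
      unfolding index_mult_mat_sum[OF T R ij] using ij carrier by (intro sum.cong) (auto simp: T_def)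
    also have "\<dots> = z * R $$ (i, j) - (\<Sum>l<n. A $$ (i, l) * R $$ (l, j))"
      using ij by (simp add: left_diff_distrib sum_subtractf if_distrib[of "\<lambda>x. x * _"] cong: if_cong)
    finally have 1: "(T * R) $$ (i, j) = z * R $$ (i, j) - (\<Sum>l<n. A $$ (i, l) * R $$ (l, j))" .
    have "(\<lambda>m. \<Sum>l<n. A $$ (i, l) * ((A ^\<^sub>m m) $$ (l, j) / z ^ Suc m)) sums (\<Sum>l<n. A $$ (i, l) * R $$ (l, j))"
      using ij by (intro sums_sum sums_mult) (rule Rs, auto)
    moreover have "(\<Sum>l<n. A $$ (i, l) * ((A ^\<^sub>m m) $$ (l, j) / z ^ Suc m)) = (A ^\<^sub>m Suc m) $$ (i, j) / z ^ Suc m" for m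
    proof -
      have "A ^\<^sub>m Suc m = A * A ^\<^sub>m m" using pow_mat_add[OF carrier, of 1 m] carrier by simp
      then have "(A ^\<^sub>m Suc m) $$ (i, j) = (\<Sum>l<n. A $$ (i, l) * (A ^\<^sub>m m) $$ (l, j))"
        using index_mult_mat_sum[OF carrier _ ij, of "A ^\<^sub>m m"] carrier by simp
      then show ?thesis by (simp only: sum_divide_distrib times_divide_eq_right)
    qed
    ultimately have 2: "(\<lambda>m. (A ^\<^sub>m Suc m) $$ (i, j) / z ^ Suc m) sums (\<Sum>l<n. A $$ (i, l) * R $$ (l, j))"
      by simp
    have "(\<lambda>m. z * ((A ^\<^sub>m m) $$ (i, j) / z ^ Suc m)) sums (z * R $$ (i, j))"
      using ij by (intro sums_mult) (rule Rs, auto)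
    then have 3: "(\<lambda>m. (A ^\<^sub>m m) $$ (i, j) / z ^ m) sums (z * R $$ (i, j))"
      using z0 by simp
    have "(\<lambda>m. (A ^\<^sub>m m) $$ (i, j) / z ^ m) sums ((\<Sum>l<n. A $$ (i, l) * R $$ (l, j)) + (A ^\<^sub>m 0) $$ (i, j) / z ^ 0)"
      using 2 by (rule iffD1[OF sums_Suc_iff[of "\<lambda>m. (A ^\<^sub>m m) $$ (i, j) / z ^ m"]])
    from sums_unique2[OF 3 this] show "(T * R) $$ (i, j) = 1\<^sub>m n $$ (i, j)"
      unfolding 1 using carrier ij by simp
  qed (use R T in auto)
  then have RT: "R * T = 1\<^sub>m n" by (rule mat_mult_left_right_inverse[OF T R])
  \<comment> \<open>\<open>resolvent\<close> is defined through \<open>mat_inverse\<close>, which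
    succeeds because \<open>T\<close> is a unit; uniqueness of inverses identifies its result with
    \<open>R\<close>.\<close>
  obtain S where S: "mat_inverse T = Some S"
  proof (cases "mat_inverse T")
    case None
    have "T \<in> Units (ring_mat TYPE(complex) n ())"
      unfolding Units_def using R T RT \<open>T * R = 1\<^sub>m n\<close> by (auto simp: ring_mat_simps)
    then show ?thesis using mat_inverse(1)[OF T None, of "()"] by blast
  qed
  from mat_inverse(2)[OF T S] have "S * T = 1\<^sub>m n" "S \<in> carrier_mat n n" by auto
  then have "S = S * (T * R)" using \<open>T * R = 1\<^sub>m n\<close> by simp
  also have "\<dots> = R"
    using assoc_mult_mat[OF \<open>S \<in> carrier_mat n n\<close> T R] \<open>S * T = 1\<^sub>m n\<close> R by simp
  finally have "resolvent A z = R"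
    using S carrier by (simp add: resolvent_def T_def)
  then show ?thesis using Rs[OF ij] by simp
qed

text \<open>Convergence of the Taylor series at \<open>s > r\<close> forces absolute convergence at
  \<open>r\<close>, the growth rate of the powers. The Cauchy product in
  \<open>riesz_dunford_mult\<close> relies on absolute convergence.\<close>

lemma summable_calculus:
  assumes f: "f holomorphic_on ball 0 1" and ij: "i < n" "j < n"
  shows "summable (\<lambda>k. norm (tcoef f k * (A ^\<^sub>m k) $$ (i, j)))"
proof -
  obtain r where r: "spectral_radius A < r" "r < 1" using dense[OF spectral_radius_bounds(2)] by blast
  obtain s where s: "r < s" "s < 1" using dense[OF r(2)] by blast
  have r0: "r > 0" using r spectral_radius_bounds(1) by linarith
  obtain C where C: "\<And>k i j. i < n \<Longrightarrow> j < n \<Longrightarrow> cmod ((A ^\<^sub>m k) $$ (i, j)) \<le> C * r ^ k" "C \<ge> 0"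
    using power_bound[OF r(1)] by auto
  have "summable (\<lambda>k. norm (tcoef f k * of_real r ^ k))"
  proof (rule powser_insidea)
    show "summable (\<lambda>k. tcoef f k * of_real s ^ k)"
      using tcoef_sums[OF f, of "of_real s"] s r0 by (auto intro: sums_summable)
  qed (use s r0 in auto)
  from summable_mult[OF this, of C] show ?thesis
  proof (rule summable_comparison_test'[where N = 0])
    show "norm (norm (tcoef f k * (A ^\<^sub>m k) $$ (i, j))) \<le> C * norm (tcoef f k * of_real r ^ k)" for k
      using mult_left_mono[OF C(1)[OF ij, of k], of "cmod (tcoef f k)"] r0
      by (simp add: norm_mult norm_power mult_ac)
  qed
qed

text \<open>The Neumann series converges uniformly on the circle and is integrated term by term;
  Cauchy's formula turns each term into a Taylor coefficient.\<close>

lemma riesz_dunford_sums: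
  assumes f: "f holomorphic_on ball 0 1" and ij: "i < n" "j < n"
  shows "(\<lambda>k. tcoef f k * (A ^\<^sub>m k) $$ (i, j)) sums (riesz_dunford f A $$ (i, j))"
proof -
  define R where "R = (1 + spectral_radius A) / 2"
  have R: "spectral_radius A < R" "R < 1" "0 < R"
    using spectral_radius_bounds by (auto simp: R_def field_simps)
  obtain r where r: "spectral_radius A < r" "r < R" using dense[OF R(1)] by blast
  have r0: "r > 0" using r spectral_radius_bounds(1) by linarith
  obtain C where C: "\<And>k i j. i < n \<Longrightarrow> j < n \<Longrightarrow> cmod ((A ^\<^sub>m k) $$ (i, j)) \<le> C * r ^ k" "C \<ge> 0"
    using power_bound[OF r(1)] by auto
  have cont: "continuous_on (cball 0 R) f"
    by (rule holomorphic_on_imp_continuous_on, rule holomorphic_on_subset[OF f]) (use R in auto)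
  have "bounded (f ` sphere 0 R)"
    by (intro compact_imp_bounded compact_continuous_image continuous_on_subset[OF cont]) auto
  then obtain B where B: "\<And>z. cmod z = R \<Longrightarrow> cmod (f z) \<le> B"
    unfolding bounded_iff by fastforce
  define a where "a m = (A ^\<^sub>m m) $$ (i, j)" for m
  define F where "F K z = (\<Sum>m<K. f z * (a m / z ^ Suc m))" for K z
  have unif: "uniform_limit (sphere 0 R) F (\<lambda>z. \<Sum>m. f z * (a m / z ^ Suc m)) sequentially"
    unfolding F_def[abs_def]
  proof (rule Weierstrass_m_test)
    show "summable (\<lambda>m. B * (C / R) * (r / R) ^ m)"
      using r r0 by (intro summable_mult summable_geometric) auto
    show "norm (f z * (a m / z ^ Suc m)) \<le> B * (C / R) * (r / R) ^ m" if "z \<in> sphere 0 R" for m and z :: complex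
    proof -
      have z: "cmod z = R" using that by simp
      have "norm (f z * (a m / z ^ Suc m)) = cmod (f z) * (cmod (a m) / R ^ Suc m)"
        by (simp add: norm_mult norm_divide norm_power z)
      also have "\<dots> \<le> B * (C * r ^ m / R ^ Suc m)"
        unfolding a_def using B[OF z] C ij R order_trans[OF norm_ge_zero B[OF z]]
        by (intro mult_mono divide_right_mono) auto
      finally show ?thesis by (simp add: power_divide mult_ac)
    qed
  qed
  have lim: "uniform_limit (sphere 0 R) F (\<lambda>z. f z * resolvent A z $$ (i, j)) sequentially"
  proof (rule uniform_limit_cong'[THEN iffD1, OF _ _ unif])
    fix z :: complex assume "z \<in> sphere 0 R"
    then have "(\<lambda>m. a m / z ^ Suc m) sums (resolvent A z $$ (i, j))"
      unfolding a_def by (intro resolvent_sums ij) (use R in auto)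
    from sums_unique[OF sums_mult[OF this, of "f z"]]
    show "(\<Sum>m. f z * (a m / z ^ Suc m)) = f z * resolvent A z $$ (i, j)" ..
  qed simp
  have F_int: "(F K has_contour_integral (\<Sum>m<K. a m * (2 * pi * \<i> * tcoef f m))) (circlepath 0 R)" for K
  proof -
    have "((\<lambda>z. f z / (z - 0) ^ Suc m) has_contour_integral ((2 * pi * \<i>) / fact m * (deriv ^^ m) f 0)) (circlepath 0 R)" for m
      by (rule Cauchy_has_contour_integral_higher_derivative_circlepath[OF cont])
        (use R in \<open>auto intro: holomorphic_on_subset[OF f]\<close>)
    then have "((\<lambda>z. \<Sum>m<K. a m * (f z / (z - 0) ^ Suc m)) has_contour_integral
        (\<Sum>m<K. a m * ((2 * pi * \<i>) / fact m * (deriv ^^ m) f 0))) (circlepath 0 R)"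
      by (intro has_contour_integral_sum has_contour_integral_lmul) auto
    then show ?thesis by (simp add: F_def[abs_def] tcoef_def mult_ac)
  qed
  have "(\<lambda>K. contour_integral (circlepath 0 R) (F K)) \<longlonglongrightarrow>
      contour_integral (circlepath 0 R) (\<lambda>z. f z * resolvent A z $$ (i, j))"
    by (rule contour_integral_uniform_limit_circlepath(2)[OF _ lim])
      (use F_int R in \<open>auto simp: contour_integrable_on_def intro!: always_eventually\<close>)
  then have "(\<lambda>K. 1 / (2 * of_real pi * \<i>) * (\<Sum>m<K. a m * (2 * pi * \<i> * tcoef f m))) \<longlonglongrightarrow>
      1 / (2 * of_real pi * \<i>) * contour_integral (circlepath 0 R) (\<lambda>z. f z * resolvent A z $$ (i, j))"
    unfolding contour_integral_unique[OF F_int] by (rule tendsto_mult_left)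
  moreover have "1 / (2 * of_real pi * \<i>) * (\<Sum>m<K. a m * (2 * pi * \<i> * tcoef f m)) = (\<Sum>m<K. tcoef f m * a m)" for K
    by (simp add: sum_distrib_left mult_ac)
  ultimately show ?thesis
    using ij carrier by (simp add: sums_def a_def riesz_dunford_def R_def)
qed

lemma riesz_dunford_carrier: "riesz_dunford f A \<in> carrier_mat n n"
  using carrier by (simp add: riesz_dunford_def)

lemma riesz_dunford_eqI:
  assumes "f holomorphic_on ball 0 1" "B \<in> carrier_mat n n"
    "\<And>i j. i < n \<Longrightarrow> j < n \<Longrightarrow> (\<lambda>k. tcoef f k * (A ^\<^sub>m k) $$ (i, j)) sums (B $$ (i, j))"
  shows "riesz_dunford f A = B"
  by (rule eq_matI) (use riesz_dunford_carrier[of f] assms sums_unique2[OF riesz_dunford_sums] in auto)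

text \<open>Entrywise Cauchy product: at total degree \<open>k\<close> the two powers of
  \<open>A\<close> always multiply to \<open>A ^\<^sub>m k\<close>.\<close>

lemma riesz_dunford_mult:
  assumes f: "f holomorphic_on ball 0 1" and g: "g holomorphic_on ball 0 1"
  shows "riesz_dunford (\<lambda>z. f z * g z) A = riesz_dunford f A * riesz_dunford g A"
proof (rule riesz_dunford_eqI)
  fix i j assume ij: "i < n" "j < n"
  have "(\<lambda>k. \<Sum>l<n. \<Sum>m\<le>k. (tcoef f m * (A ^\<^sub>m m) $$ (i, l)) * (tcoef g (k - m) * (A ^\<^sub>m (k - m)) $$ (l, j)))
      sums (\<Sum>l<n. riesz_dunford f A $$ (i, l) * riesz_dunford g A $$ (l, j))"
  proof (intro sums_sum)
    fix l assume "l \<in> {..<n}"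
    then have l: "l < n" by simp
    show "(\<lambda>k. \<Sum>m\<le>k. (tcoef f m * (A ^\<^sub>m m) $$ (i, l)) * (tcoef g (k - m) * (A ^\<^sub>m (k - m)) $$ (l, j)))
      sums (riesz_dunford f A $$ (i, l) * riesz_dunford g A $$ (l, j))"
      unfolding sums_unique[OF riesz_dunford_sums[OF f ij(1) l]] sums_unique[OF riesz_dunford_sums[OF g l ij(2)]]
      by (intro Cauchy_product_sums summable_calculus f g ij l)
  qed
  moreover have "(\<Sum>l<n. \<Sum>m\<le>k. (tcoef f m * (A ^\<^sub>m m) $$ (i, l)) * (tcoef g (k - m) * (A ^\<^sub>m (k - m)) $$ (l, j)))
      = tcoef (\<lambda>z. f z * g z) k * (A ^\<^sub>m k) $$ (i, j)" for k
  proof -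
    have "(\<Sum>l<n. (A ^\<^sub>m m) $$ (i, l) * (A ^\<^sub>m (k - m)) $$ (l, j)) = (A ^\<^sub>m k) $$ (i, j)" if "m \<le> k" for m
      using that pow_mat_add[OF carrier, of m "k - m"] index_mult_mat_sum[OF _ _ ij, of "A ^\<^sub>m m" "A ^\<^sub>m (k - m)"] carrier
      by simp
    then have "(\<Sum>m\<le>k. tcoef f m * tcoef g (k - m) * (\<Sum>l<n. (A ^\<^sub>m m) $$ (i, l) * (A ^\<^sub>m (k - m)) $$ (l, j)))
        = tcoef (\<lambda>z. f z * g z) k * (A ^\<^sub>m k) $$ (i, j)"
      by (simp add: tcoef_mult[OF f g] sum_distrib_right)
    then show ?thesis
      by (subst sum.swap) (simp add: sum_distrib_left mult_ac)
  qed
  ultimately show "(\<lambda>k. tcoef (\<lambda>z. f z * g z) k * (A ^\<^sub>m k) $$ (i, j)) sums ((riesz_dunford f A * riesz_dunford g A) $$ (i, j))"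
    unfolding index_mult_mat_sum[OF riesz_dunford_carrier riesz_dunford_carrier ij] by simp
qed (use f g riesz_dunford_carrier[of f] riesz_dunford_carrier[of g] in \<open>auto intro!: holomorphic_intros\<close>)

lemma riesz_dunford_diff:
  assumes f: "f holomorphic_on ball 0 1" and g: "g holomorphic_on ball 0 1"
  shows "riesz_dunford (\<lambda>z. f z - g z) A = riesz_dunford f A - riesz_dunford g A"
proof (rule riesz_dunford_eqI)
  fix i j assume ij: "i < n" "j < n"
  from sums_diff[OF riesz_dunford_sums[OF f ij] riesz_dunford_sums[OF g ij]]
  show "(\<lambda>k. tcoef (\<lambda>z. f z - g z) k * (A ^\<^sub>m k) $$ (i, j)) sums ((riesz_dunford f A - riesz_dunford g A) $$ (i, j))"
    using ij riesz_dunford_carrier[of g] by (simp add: tcoef_diff[OF f g] left_diff_distrib)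
qed (use f g riesz_dunford_carrier[of f] riesz_dunford_carrier[of g] in \<open>auto intro!: holomorphic_intros\<close>)

lemma riesz_dunford_add:
  assumes f: "f holomorphic_on ball 0 1" and g: "g holomorphic_on ball 0 1"
  shows "riesz_dunford (\<lambda>z. f z + g z) A = riesz_dunford f A + riesz_dunford g A"
proof (rule riesz_dunford_eqI)
  fix i j assume ij: "i < n" "j < n"
  from sums_add[OF riesz_dunford_sums[OF f ij] riesz_dunford_sums[OF g ij]]
  show "(\<lambda>k. tcoef (\<lambda>z. f z + g z) k * (A ^\<^sub>m k) $$ (i, j)) sums ((riesz_dunford f A + riesz_dunford g A) $$ (i, j))"
    using ij riesz_dunford_carrier[of g] by (simp add: tcoef_add[OF f g] distrib_right)
qed (use f g riesz_dunford_carrier[of f] riesz_dunford_carrier[of g] in \<open>auto intro!: holomorphic_intros\<close>)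

lemma riesz_dunford_const: "riesz_dunford (\<lambda>z. c) A = c \<cdot>\<^sub>m 1\<^sub>m n"
proof (rule riesz_dunford_eqI)
  fix i j assume ij: "i < n" "j < n"
  have "(\<lambda>k. tcoef (\<lambda>z. c) k * (A ^\<^sub>m k) $$ (i, j)) sums (\<Sum>k\<in>{0}. tcoef (\<lambda>z. c) k * (A ^\<^sub>m k) $$ (i, j))"
    by (rule sums_finite) (auto simp: tcoef_const)
  then show "(\<lambda>k. tcoef (\<lambda>z. c) k * (A ^\<^sub>m k) $$ (i, j)) sums ((c \<cdot>\<^sub>m 1\<^sub>m n) $$ (i, j))"
    using ij carrier by (simp add: tcoef_const)
qed auto

lemma riesz_dunford_cong:
  assumes f: "f holomorphic_on ball 0 1" and eq: "\<And>z. cmod z < 1 \<Longrightarrow> f z = g z"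
  shows "riesz_dunford f A = riesz_dunford g A"
proof (rule riesz_dunford_eqI[OF f riesz_dunford_carrier])
  fix i j assume ij: "i < n" "j < n"
  have "g holomorphic_on ball 0 1" using f eq by (subst holomorphic_cong[of _ _ _ f]) auto
  from riesz_dunford_sums[OF this ij] tcoef_cong[of f g] eq
  show "(\<lambda>k. tcoef f k * (A ^\<^sub>m k) $$ (i, j)) sums (riesz_dunford g A $$ (i, j))" by simp
qed

text \<open>Cauchy's estimates at a radius between the growth rate of the powers and 1 give a
  geometric series. The constants do not depend on \<open>f\<close>, so the calculus is continuous
  under locally uniform convergence.\<close>

lemma riesz_dunford_bound:
  "\<exists>C r. 0 < r \<and> r < 1 \<and> (\<forall>f B i j. f holomorphic_on ball 0 1 \<longrightarrow> (\<forall>z. cmod z \<le> r \<longrightarrow> cmod (f z) \<le> B) \<longrightarrow>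
    i < n \<longrightarrow> j < n \<longrightarrow> cmod (riesz_dunford f A $$ (i, j)) \<le> B * C)"
proof -
  obtain r where r: "spectral_radius A < r" "r < 1" using dense[OF spectral_radius_bounds(2)] by blast
  obtain s where s: "r < s" "s < 1" using dense[OF r(2)] by blast
  have r0: "r > 0" using r spectral_radius_bounds(1) by linarith
  obtain C where C: "\<And>k i j. i < n \<Longrightarrow> j < n \<Longrightarrow> cmod ((A ^\<^sub>m k) $$ (i, j)) \<le> C * r ^ k" "C \<ge> 0"
    using power_bound[OF r(1)] by auto
  show ?thesis
  proof (rule exI[of _ "C / (1 - r / s)"], rule exI[of _ s], intro conjI allI impI)
    fix f B i j
    assume f: "f holomorphic_on ball 0 1" and B': "\<forall>z. cmod z \<le> s \<longrightarrow> cmod (f z) \<le> B" and ij: "i < n" "j < n"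
    note B = B'[rule_format]
    have B0: "B \<ge> 0" using order_trans[OF norm_ge_zero B[of 0]] s r0 by simp
    have geo: "(\<lambda>k. B * C * (r / s) ^ k) sums (B * C * (1 / (1 - r / s)))"
      using s r0 by (intro sums_mult geometric_sums) auto
    have le: "norm (tcoef f k * (A ^\<^sub>m k) $$ (i, j)) \<le> B * C * (r / s) ^ k" for k
    proof -
      have "norm ((deriv ^^ k) f 0) \<le> fact k * B / s ^ k"
      proof (rule Cauchy_inequality)
        show "f holomorphic_on ball 0 s"
          by (rule holomorphic_on_subset[OF f]) (use s in auto)
        show "continuous_on (cball 0 s) f"
          by (rule holomorphic_on_imp_continuous_on, rule holomorphic_on_subset[OF f]) (use s in auto)
      qed (use s r0 B in auto)
      then have "cmod (tcoef f k) \<le> B / s ^ k"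
        by (simp add: tcoef_def norm_divide pos_divide_le_eq mult.commute)
      then have "cmod (tcoef f k) * cmod ((A ^\<^sub>m k) $$ (i, j)) \<le> B / s ^ k * (C * r ^ k)"
        using C(1)[OF ij, of k] B0 s r0 by (intro mult_mono) auto
      then show ?thesis by (simp add: norm_mult power_divide mult_ac)
    qed
    from sums_unique[OF riesz_dunford_sums[OF f ij]]
    have "cmod (riesz_dunford f A $$ (i, j)) = norm (\<Sum>k. tcoef f k * (A ^\<^sub>m k) $$ (i, j))" by simp
    also have "\<dots> \<le> (\<Sum>k. B * C * (r / s) ^ k)"
      by (rule norm_suminf_le[OF le sums_summable[OF geo]])
    also have "\<dots> = B * (C / (1 - r / s))" using sums_unique[OF geo] by simp
    finally show "cmod (riesz_dunford f A $$ (i, j)) \<le> B * (C / (1 - r / s))" .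
  qed (use r0 s in auto)
qed

end

section \<open>Scalar values of the functional calculus and model spaces\<close>

text \<open>Holomorphy is part of the predicate, so closure under sums and products carries no side
  conditions.\<close>

definition scalar_at :: "complex mat \<Rightarrow> (complex \<Rightarrow> complex) \<Rightarrow> complex \<Rightarrow> bool" where
  "scalar_at A f c \<longleftrightarrow> f holomorphic_on ball 0 1 \<and> riesz_dunford f A = c \<cdot>\<^sub>m 1\<^sub>m (dim_row A)"

lemma hardy_fun_monomial_0:
  assumes "cmod z < 1"
  shows "hardy_fun (monomial 0) z = 1"
proof -
  have "(\<lambda>n. coef (monomial 0) n * z ^ n) sums (\<Sum>n\<in>{0}. coef (monomial 0) n * z ^ n)"
    by (rule sums_finite) auto
  from sums_unique2[OF hardy_fun_sums[OF assms] this] show ?thesis by simp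
qed

lemma hardy_fun_diff:
  assumes "cmod z < 1"
  shows "hardy_fun (f - g) z = hardy_fun f z - hardy_fun g z"
proof (rule sums_unique2[OF hardy_fun_sums[OF assms, of "f - g"]])
  show "(\<lambda>n. coef (f - g) n * z ^ n) sums (hardy_fun f z - hardy_fun g z)"
    using sums_diff[OF hardy_fun_sums[OF assms, of f] hardy_fun_sums[OF assms, of g]]
    by (simp add: left_diff_distrib)
qed

lemma hardy_fun_cscale:
  assumes "cmod z < 1"
  shows "hardy_fun (cscale c f) z = c * hardy_fun f z"
proof (rule sums_unique2[OF hardy_fun_sums[OF assms, of "cscale c f"]])
  show "(\<lambda>n. coef (cscale c f) n * z ^ n) sums (c * hardy_fun f z)"
    using sums_mult[OF hardy_fun_sums[OF assms, of f], of c] by (simp add: mult.assoc)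
qed

lemma hardy_fun_fshift:
  assumes "cmod z < 1"
  shows "hardy_fun (fshift 0 f) z = z * hardy_fun f z"
proof -
  have "(\<lambda>n. coef (fshift 0 f) (Suc n) * z ^ Suc n) sums (z * hardy_fun f z)"
    using sums_mult[OF hardy_fun_sums[OF assms, of f], of z] by (simp add: mult_ac)
  then have "(\<lambda>n. coef (fshift 0 f) n * z ^ n) sums (z * hardy_fun f z + coef (fshift 0 f) 0 * z ^ 0)"
    by (rule iffD1[OF sums_Suc_iff[of "\<lambda>n. coef (fshift 0 f) n * z ^ n"]])
  from sums_unique2[OF hardy_fun_sums[OF assms] this] show ?thesis by simp
qed

lemma cinner_monomial_0: "cinner h (monomial 0) = coef h 0"
proof -
  have "(\<lambda>n. coef h n * cnj (coef (monomial 0) n)) sums (\<Sum>n\<in>{0}. coef h n * cnj (coef (monomial 0) n))"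
    by (rule sums_finite) auto
  then show ?thesis by (simp add: cinner_def sums_iff)
qed

lemma cinner_diff_right: "cinner h (f - g) = cinner h f - cinner h g"
  using cinner_add_right[of h "f - g" g] by simp

lemma cinner_fshift: "cinner (fshift 0 f) h = cinner f (bshift h)"
proof -
  have "(\<lambda>n. coef (fshift 0 f) (Suc n) * cnj (coef h (Suc n))) sums cinner f (bshift h)"
    using summable_sums[OF summable_cinner[of f "bshift h"]] by (simp add: cinner_def)
  then have "(\<lambda>n. coef (fshift 0 f) n * cnj (coef h n)) sums (cinner f (bshift h) + coef (fshift 0 f) 0 * cnj (coef h 0))"
    by (rule iffD1[OF sums_Suc_iff[of "\<lambda>n. coef (fshift 0 f) n * cnj (coef h n)"]])
  then show ?thesis by (simp add: cinner_def[of "fshift 0 f"] sums_iff)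
qed

lemma le_zero_if_le_small_multiples:
  fixes x C :: real
  assumes "\<And>e. e > 0 \<Longrightarrow> x \<le> e * C"
  shows "x \<le> 0"
proof (rule tendsto_lowerbound)
  show "((\<lambda>e. e * C) \<longlongrightarrow> 0) (at_right 0)"
    by (intro tendsto_eq_intros) auto
  show "\<forall>\<^sub>F e in at_right 0. x \<le> e * C"
    using eventually_at_right_less[of 0] by eventually_elim (rule assms)
qed simp

section \<open>Algebra of scalar values, and model spaces\<close>

context disc_matrix
begin

lemma dim_row [simp]: "dim_row A = n"
  using carrier by simp

lemma scalar_at_holomorphic: "scalar_at A f c \<Longrightarrow> f holomorphic_on ball 0 1"
  by (simp add: scalar_at_def)

lemma scalar_at_const: "scalar_at A (\<lambda>z. c) c"
  by (simp add: scalar_at_def riesz_dunford_const)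

lemma scalar_at_add: "scalar_at A f c \<Longrightarrow> scalar_at A g d \<Longrightarrow> scalar_at A (\<lambda>z. f z + g z) (c + d)"
  by (auto simp: scalar_at_def riesz_dunford_add add_smult_distrib_right_mat intro!: holomorphic_intros)

lemma scalar_at_diff: "scalar_at A f c \<Longrightarrow> scalar_at A g d \<Longrightarrow> scalar_at A (\<lambda>z. f z - g z) (c - d)"
  by (auto simp: scalar_at_def riesz_dunford_diff intro!: holomorphic_intros)

lemma scalar_at_mult: "scalar_at A f c \<Longrightarrow> scalar_at A g d \<Longrightarrow> scalar_at A (\<lambda>z. f z * g z) (c * d)"
  by (auto simp: scalar_at_def riesz_dunford_mult mult_smult_distrib[of _ n n _ n]
      mult_smult_assoc_mat[of _ n n _ n] intro!: holomorphic_intros)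

lemma scalar_at_zero_iff: "scalar_at A f 0 \<longleftrightarrow> f holomorphic_on ball 0 1 \<and> riesz_dunford f A = 0\<^sub>m n n"
proof -
  have "0 \<cdot>\<^sub>m 1\<^sub>m n = (0\<^sub>m n n :: complex mat)" by (rule eq_matI) auto
  then show ?thesis by (simp add: scalar_at_def)
qed

text \<open>The value of \<open>f\<close> at \<open>A\<close> may be any matrix, since the zero
  matrix absorbs it. The interpolation formulas contain such factors.\<close>

lemma scalar_at_ideal:
  assumes "f holomorphic_on ball 0 1" "scalar_at A g 0"
  shows "scalar_at A (\<lambda>z. f z * g z) 0" "scalar_at A (\<lambda>z. g z * f z) 0"
proof -
  show "scalar_at A (\<lambda>z. f z * g z) 0"
    using assms riesz_dunford_carrier[of f]
    by (auto simp: scalar_at_zero_iff riesz_dunford_mult intro!: holomorphic_intros)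
  then show "scalar_at A (\<lambda>z. g z * f z) 0" by (simp add: mult.commute)
qed

lemma scalar_at_cong:
  assumes "scalar_at A f c" "\<And>z. cmod z < 1 \<Longrightarrow> f z = g z"
  shows "scalar_at A g c"
proof -
  have "g holomorphic_on ball 0 1"
    using assms by (subst holomorphic_cong[of _ _ _ f]) (auto simp: scalar_at_def)
  then show ?thesis
    using assms riesz_dunford_cong[of f g] by (simp add: scalar_at_def)
qed

lemma scalar_at_sum:
  assumes "\<And>i. i \<in> S \<Longrightarrow> scalar_at A (f i) (c i)"
  shows "scalar_at A (\<lambda>z. \<Sum>i\<in>S. f i z) (\<Sum>i\<in>S. c i)"
  using assms
  by (induction S rule: infinite_finite_induct) (auto intro: scalar_at_const scalar_at_add)

lemma scalar_at_prod:
  assumes "\<And>i. i \<in> S \<Longrightarrow> scalar_at A (f i) (c i)"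
  shows "scalar_at A (\<lambda>z. \<Prod>i\<in>S. f i z) (\<Prod>i\<in>S. c i)"
  using assms
  by (induction S rule: infinite_finite_induct) (auto intro: scalar_at_const scalar_at_mult)

lemma mem_model_space:
  "h \<in> model_space A \<longleftrightarrow> (\<forall>f. scalar_at A (hardy_fun f) 0 \<longrightarrow> cinner f h = 0)"
proof -
  have "cinner h f = 0 \<longleftrightarrow> cinner f h = 0" for f
    using cinner_commute[of h f] by simp
  then show ?thesis
    by (simp add: model_space_def orthogonal_complement_def scalar_at_zero_iff hardy_fun_holomorphic)
qed

lemma model_space_subspace:
  "0 \<in> model_space A"
  "g \<in> model_space A \<Longrightarrow> h \<in> model_space A \<Longrightarrow> g + h \<in> model_space A"
  "h \<in> model_space A \<Longrightarrow> cscale c h \<in> model_space A"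
  by (auto simp: mem_model_space cinner_add_right cinner_cscale_right)

text \<open>The adjoint of \<open>bshift\<close> is multiplication by \<open>z\<close>, which
  preserves vanishing at \<open>A\<close>.\<close>

lemma bshift_model_space:
  assumes "h \<in> model_space A"
  shows "bshift h \<in> model_space A"
  unfolding mem_model_space
proof (intro allI impI)
  fix f assume f: "scalar_at A (hardy_fun f) 0"
  have "scalar_at A (hardy_fun (fshift 0 f)) 0"
    by (rule scalar_at_cong[OF scalar_at_ideal(1)[OF _ f, of "\<lambda>z. z"]])
      (auto simp: hardy_fun_fshift intro!: holomorphic_intros)
  then show "cinner f (bshift h) = 0"
    using assms by (simp add: mem_model_space flip: cinner_fshift)
qed

text \<open>The coefficients of the representer are the conjugated entries of the powers of
  \<open>A\<close>, which decay geometrically.\<close>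

lemma riesz_dunford_representer:
  assumes ij: "i < n" "j < n"
  obtains r where "\<And>f. riesz_dunford (hardy_fun f) A $$ (i, j) = cinner f r"
proof -
  obtain r where r: "spectral_radius A < r" "r < 1" using dense[OF spectral_radius_bounds(2)] by blast
  have r0: "r > 0" using r spectral_radius_bounds(1) by linarith
  obtain C where C: "\<And>k i j. i < n \<Longrightarrow> j < n \<Longrightarrow> cmod ((A ^\<^sub>m k) $$ (i, j)) \<le> C * r ^ k" "C \<ge> 0"
    using power_bound[OF r(1)] by auto
  define a where "a k = cnj ((A ^\<^sub>m k) $$ (i, j))" for k
  have "summable (\<lambda>k. (cmod (a k))\<^sup>2)"
  proof (rule summable_comparison_test'[where N = 0])
    show "summable (\<lambda>k. C\<^sup>2 * (r\<^sup>2) ^ k)"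
      using r r0 by (intro summable_mult summable_geometric) (auto simp: abs_square_less_1)
    show "norm ((cmod (a k))\<^sup>2) \<le> C\<^sup>2 * (r\<^sup>2) ^ k" for k
      using power_mono[OF C(1)[OF ij, of k] norm_ge_zero, of 2]
      by (simp add: a_def power_mult_distrib mult.commute flip: power_mult)
  qed
  note coef = coef_of_coeffs[OF this]
  show ?thesis
  proof (rule that[of "of_coeffs a"])
    fix f
    show "riesz_dunford (hardy_fun f) A $$ (i, j) = cinner f (of_coeffs a)"
      using riesz_dunford_sums[OF hardy_fun_holomorphic ij, of f]
      by (simp add: cinner_def coef a_def sums_iff)
  qed
qed

lemma vanishing_if_orthogonal:
  assumes "\<And>h. h \<in> model_space A \<Longrightarrow> cinner f h = 0"
  shows "scalar_at A (hardy_fun f) 0"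
  unfolding scalar_at_zero_iff
proof (intro conjI hardy_fun_holomorphic eq_matI)
  fix i j assume "i < dim_row (0\<^sub>m n n :: complex mat)" "j < dim_col (0\<^sub>m n n :: complex mat)"
  then have ij: "i < n" "j < n" by auto
  obtain r where r: "\<And>f. riesz_dunford (hardy_fun f) A $$ (i, j) = cinner f r"
    using riesz_dunford_representer[OF ij] by blast
  \<comment> \<open>If \<open>f\<close> vanishes at \<open>A\<close>, so does this entry, hence the
    representer is orthogonal to \<open>f\<close>.\<close>
  have "r \<in> model_space A"
    unfolding mem_model_space using ij by (auto simp: scalar_at_zero_iff simp flip: r)
  then show "riesz_dunford (hardy_fun f) A $$ (i, j) = 0\<^sub>m n n $$ (i, j)"
    using assms ij by (simp add: r)
qed (use riesz_dunford_carrier[of "hardy_fun f"] in auto)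

text \<open>This links the lifting to the calculus: \<open>monomial 0\<close> is the constant 1 and
  represents the constant coefficient, so the hypothesis says that \<open>p - c\<close> is
  orthogonal to the model space.\<close>

lemma scalar_at_if_reproducing:
  assumes "\<And>h. h \<in> model_space A \<Longrightarrow> cinner h p = cnj c * coef h 0"
  shows "scalar_at A (hardy_fun p) c"
proof -
  have "scalar_at A (hardy_fun (p - cscale c (monomial 0))) 0"
  proof (rule vanishing_if_orthogonal)
    fix h assume h: "h \<in> model_space A"
    have "cinner h (p - cscale c (monomial 0)) = 0"
      using assms[OF h] by (simp add: cinner_diff_right cinner_cscale_right cinner_monomial_0)
    then show "cinner (p - cscale c (monomial 0)) h = 0"
      by (subst cinner_commute) simp
  qed
  from scalar_at_add[OF this scalar_at_const[of c]]
  have "scalar_at A (\<lambda>z. hardy_fun (p - cscale c (monomial 0)) z + c) c" by simp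
  then show ?thesis
    by (rule scalar_at_cong) (simp add: hardy_fun_diff hardy_fun_cscale hardy_fun_monomial_0)
qed

text \<open>If the model space were trivial, the constant 1 would vanish at
  \<open>A\<close>.\<close>

lemma model_space_unit_vector: obtains h where "h \<in> model_space A" "norm h = 1"
proof -
  have "\<exists>h\<in>model_space A. h \<noteq> 0"
  proof (rule ccontr)
    assume "\<not> ?thesis"
    then have "scalar_at A (hardy_fun (monomial 0)) 0"
      by (intro vanishing_if_orthogonal) auto
    then have "scalar_at A (\<lambda>z. 1) 0"
      by (rule scalar_at_cong) (simp add: hardy_fun_monomial_0)
    then have "1 \<cdot>\<^sub>m 1\<^sub>m n = (0\<^sub>m n n :: complex mat)"
      by (simp add: scalar_at_zero_iff riesz_dunford_const)
    then have "(1 \<cdot>\<^sub>m 1\<^sub>m n) $$ (0, 0) = (0\<^sub>m n n :: complex mat) $$ (0, 0)" by simp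
    then show False using dim_pos by simp
  qed
  then obtain h where h: "h \<in> model_space A" "h \<noteq> 0" by blast
  show ?thesis
    by (rule that[of "cscale (of_real (inverse (norm h))) h"])
      (use h in \<open>auto intro: model_space_subspace simp: norm_inverse\<close>)
qed

text \<open>In \<open>g - c = (g - f k) + (f k - c)\<close> the second summand vanishes at
  \<open>A\<close>, and the first is small on the compact disc that controls the calculus.\<close>

lemma scalar_at_limit:
  assumes f: "\<forall>\<^sub>F k in sequentially. scalar_at A (f k) c" and g: "g holomorphic_on ball 0 1"
    and lim: "\<And>K. compact K \<Longrightarrow> K \<subseteq> ball 0 1 \<Longrightarrow> uniform_limit K f g sequentially"
  shows "scalar_at A g c"
proof -
  obtain C r where r: "0 < r" "r < 1" and
    C: "\<forall>f B i j. f holomorphic_on ball 0 1 \<longrightarrow> (\<forall>z. cmod z \<le> r \<longrightarrow> cmod (f z) \<le> B) \<longrightarrow>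
      i < n \<longrightarrow> j < n \<longrightarrow> cmod (riesz_dunford f A $$ (i, j)) \<le> B * C"
    using riesz_dunford_bound by (elim exE conjE)
  define d where "d = (\<lambda>z. g z - c)"
  have d: "d holomorphic_on ball 0 1" unfolding d_def by (intro holomorphic_intros g)
  have le: "cmod (riesz_dunford d A $$ (i, j)) \<le> e * C" if e: "e > 0" and ij: "i < n" "j < n" for e i j
  proof -
    have "uniform_limit (cball 0 r) f g sequentially"
      by (rule lim) (use r in auto)
    from uniform_limitD[OF this e] f
    have "\<forall>\<^sub>F k in sequentially. (\<forall>z\<in>cball 0 r. dist (f k z) (g z) < e) \<and> scalar_at A (f k) c"
      by (rule eventually_conj)
    then obtain k where k: "\<forall>z\<in>cball 0 r. dist (f k z) (g z) < e" "scalar_at A (f k) c"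
      using eventually_happens'[OF sequentially_bot] by blast
    have fk: "f k holomorphic_on ball 0 1" using k(2) by (rule scalar_at_holomorphic)
    have "scalar_at A (\<lambda>z. f k z - c) 0"
      using scalar_at_diff[OF k(2) scalar_at_const[of c]] by simp
    then have z: "riesz_dunford (\<lambda>z. f k z - c) A = 0\<^sub>m n n" by (simp add: scalar_at_zero_iff)
    have "riesz_dunford d A = riesz_dunford (\<lambda>z. (g z - f k z) + (f k z - c)) A"
      by (simp add: d_def)
    also have "\<dots> = riesz_dunford (\<lambda>z. g z - f k z) A + riesz_dunford (\<lambda>z. f k z - c) A"
      by (rule riesz_dunford_add) (intro holomorphic_intros g fk)+
    finally have "riesz_dunford d A = riesz_dunford (\<lambda>z. g z - f k z) A + 0\<^sub>m n n"
      unfolding z .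
    then have "riesz_dunford d A $$ (i, j) = riesz_dunford (\<lambda>z. g z - f k z) A $$ (i, j)"
      using ij by simp
    also have "cmod \<dots> \<le> e * C"
    proof (rule C[rule_format, OF _ _ ij])
      show "cmod (g z - f k z) \<le> e" if "cmod z \<le> r" for z
        using bspec[OF k(1), of z] that by (simp add: dist_norm norm_minus_commute[of "g z"])
    qed (intro holomorphic_intros g fk)
    finally show ?thesis .
  qed
  have zero: "cmod (riesz_dunford d A $$ (i, j)) \<le> 0" if ij: "i < n" "j < n" for i j
  proof (rule le_zero_if_le_small_multiples)
    fix e :: real assume "e > 0"
    then show "cmod (riesz_dunford d A $$ (i, j)) \<le> e * C" by (rule le[OF _ ij])
  qed
  have "riesz_dunford d A = 0\<^sub>m n n"
  proof (rule eq_matI)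
    fix i j assume "i < dim_row (0\<^sub>m n n :: complex mat)" "j < dim_col (0\<^sub>m n n :: complex mat)"
    then show "riesz_dunford d A $$ (i, j) = 0\<^sub>m n n $$ (i, j)"
      using zero[of i j] by simp
  qed (simp_all add: carrier_matD[OF riesz_dunford_carrier])
  then have "scalar_at A d 0" using d by (simp add: scalar_at_zero_iff)
  from scalar_at_add[OF this scalar_at_const[of c]] show ?thesis by (simp add: d_def)
qed

text \<open>Since \<open>f - c\<close> vanishes at \<open>A\<close>, so does its product with
  \<open>y\<close>. In other words, the adjoint of multiplication by \<open>f\<close> acts on the
  model space as the scalar \<open>cnj c\<close>.\<close>

lemma cinner_multiplier_model_space:
  assumes f: "scalar_at A f c" and g: "\<And>z. cmod z < 1 \<Longrightarrow> hardy_fun g z = f z * hardy_fun y z"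
    and h: "h \<in> model_space A"
  shows "cinner g h = c * cinner y h"
proof -
  have "scalar_at A (\<lambda>z. f z - c) 0"
    using scalar_at_diff[OF f scalar_at_const[of c]] by simp
  then have "scalar_at A (\<lambda>z. (f z - c) * hardy_fun y z) 0"
    by (rule scalar_at_ideal(2)[OF hardy_fun_holomorphic])
  then have "scalar_at A (hardy_fun (g - cscale c y)) 0"
    by (rule scalar_at_cong) (simp add: hardy_fun_diff hardy_fun_cscale g left_diff_distrib)
  then have "cinner (g - cscale c y) h = 0" using h by (simp add: mem_model_space)
  then show ?thesis by (simp add: cinner_diff_left cinner_cscale_left)
qed

end

section \<open>Interpolation\<close>

text \<open>Montel's theorem yields a locally uniform limit of a subsequence. Values are prescribed
  only eventually in \<open>k\<close>, so each \<open>f k\<close> may handle finitely many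
  matrices.\<close>

lemma bounded_scalar_interpolation_limit:
  fixes A :: "nat \<Rightarrow> complex mat" and f :: "nat \<Rightarrow> complex \<Rightarrow> complex"
  assumes D: "\<And>n. disc_matrix (A n) (dim_row (A n))"
    and f: "\<And>k. f k holomorphic_on ball 0 1" and B: "\<And>k z. cmod z < 1 \<Longrightarrow> cmod (f k z) \<le> B"
    and ev: "\<And>n. n \<in> S \<Longrightarrow> \<forall>\<^sub>F k in sequentially. scalar_at (A n) (f k) (w n)"
  obtains g where "g holomorphic_on ball 0 1" "\<And>z. cmod z < 1 \<Longrightarrow> cmod (g z) \<le> B"
    "\<And>n. n \<in> S \<Longrightarrow> scalar_at (A n) g (w n)"
proof -
  obtain g r where g: "g holomorphic_on ball 0 1" and r: "strict_mono (r :: nat \<Rightarrow> nat)"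
    and lim: "\<And>x. x \<in> ball 0 1 \<Longrightarrow> ((\<lambda>n. f (r n) x) \<longlongrightarrow> g x) sequentially"
    and unif: "\<And>K. \<lbrakk>compact K; K \<subseteq> ball 0 1\<rbrakk> \<Longrightarrow> uniform_limit K (f \<circ> r) g sequentially"
  proof (rule Montel[of "ball 0 1" "range f" f])
    show "\<exists>B. \<forall>h\<in>range f. \<forall>z\<in>K. norm (h z) \<le> B" if "compact K" "K \<subseteq> ball 0 1" for K
    proof (intro exI ballI)
      fix h z assume "h \<in> range f" "z \<in> K"
      then show "norm (h z) \<le> B" using that B by auto
    qed
  qed (use f in auto)
  show ?thesis
  proof (rule that[OF g])
    fix z :: complex assume z: "cmod z < 1"
    have "(\<lambda>n. cmod (f (r n) z)) \<longlonglongrightarrow> cmod (g z)"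
      by (intro tendsto_norm lim) (use z in simp)
    then show "cmod (g z) \<le> B"
      by (rule LIMSEQ_le_const2) (use B[OF z] in blast)
  next
    fix n assume n: "n \<in> S"
    interpret disc_matrix "A n" "dim_row (A n)" by (rule D)
    show "scalar_at (A n) g (w n)"
    proof (rule scalar_at_limit[OF _ g unif])
      show "\<forall>\<^sub>F k in sequentially. scalar_at (A n) ((f \<circ> r) k) (w n)"
        using eventually_subseq[OF r ev[OF n]] by simp
    qed
  qed
qed

text \<open>Index set and bound are parameters: the gliding hump works on finite blocks, and passing
  to limits requires a common bound.\<close>

definition interpolates :: "(nat \<Rightarrow> complex mat) \<Rightarrow> nat set \<Rightarrow> (nat \<Rightarrow> complex) \<Rightarrow> real \<Rightarrow> bool" where
  "interpolates A S w M \<longleftrightarrow> (\<exists>f. f holomorphic_on ball 0 1 \<and> (\<forall>z. cmod z < 1 \<longrightarrow> cmod (f z) \<le> M) \<and>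
     (\<forall>n\<in>S. scalar_at (A n) f (w n)))"

lemma interpolating_iff_interpolates:
  "interpolating A \<longleftrightarrow> (\<forall>w. bounded (range w) \<longrightarrow> (\<exists>M. interpolates A UNIV w M))"
proof -
  have "(\<exists>\<phi>\<in>H_infinity. \<forall>n. riesz_dunford \<phi> (A n) = w n \<cdot>\<^sub>m 1\<^sub>m (dim_row (A n))) \<longleftrightarrow> (\<exists>M. interpolates A UNIV w M)" for w
  proof
    assume "\<exists>\<phi>\<in>H_infinity. \<forall>n. riesz_dunford \<phi> (A n) = w n \<cdot>\<^sub>m 1\<^sub>m (dim_row (A n))"
    then obtain \<phi> where \<phi>: "\<phi> holomorphic_on ball 0 1" "bounded (\<phi> ` ball 0 1)"
      "\<And>n. riesz_dunford \<phi> (A n) = w n \<cdot>\<^sub>m 1\<^sub>m (dim_row (A n))" by (auto simp: H_infinity_def)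
    obtain M where "\<And>z. z \<in> ball 0 1 \<Longrightarrow> cmod (\<phi> z) \<le> M"
      using \<phi>(2) unfolding bounded_iff by blast
    then have "interpolates A UNIV w M"
      unfolding interpolates_def scalar_at_def using \<phi> by (intro exI[of _ \<phi>]) auto
    then show "\<exists>M. interpolates A UNIV w M" ..
  next
    assume "\<exists>M. interpolates A UNIV w M"
    then obtain M f where f: "f holomorphic_on ball 0 1" "\<And>z. cmod z < 1 \<Longrightarrow> cmod (f z) \<le> M"
      "\<And>n. riesz_dunford f (A n) = w n \<cdot>\<^sub>m 1\<^sub>m (dim_row (A n))"
      by (auto simp: interpolates_def scalar_at_def)
    have "bounded (f ` ball 0 1)"
      unfolding bounded_iff using f(2) by (intro exI[of _ M]) auto
    then show "\<exists>\<phi>\<in>H_infinity. \<forall>n. riesz_dunford \<phi> (A n) = w n \<cdot>\<^sub>m 1\<^sub>m (dim_row (A n))"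
      using f by (intro bexI[of _ f]) (auto simp: H_infinity_def)
  qed
  then show ?thesis unfolding interpolating_def by blast
qed

lemma interpolates_of_finite:
  fixes A :: "nat \<Rightarrow> complex mat"
  assumes D: "\<And>n. disc_matrix (A n) (dim_row (A n))"
    and fin: "\<And>m. interpolates A (S \<inter> {..<m}) w M"
  shows "interpolates A S w M"
proof -
  obtain f where f: "\<And>m. f m holomorphic_on ball 0 1" "\<And>m z. cmod z < 1 \<Longrightarrow> cmod (f m z) \<le> M"
    "\<And>m n. n \<in> S \<inter> {..<m} \<Longrightarrow> scalar_at (A n) (f m) (w n)"
    using fin unfolding interpolates_def by metis
  have ev: "\<forall>\<^sub>F m in sequentially. scalar_at (A n) (f m) (w n)" if "n \<in> S" for n
    using eventually_gt_at_top[of n] by eventually_elim (use f(3) that in auto)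
  show ?thesis
  proof (rule bounded_scalar_interpolation_limit[where A = A and f = f and B = M and S = S and w = w])
    fix g assume "g holomorphic_on ball 0 1" "\<And>z. cmod z < 1 \<Longrightarrow> cmod (g z) \<le> M"
      "\<And>n. n \<in> S \<Longrightarrow> scalar_at (A n) g (w n)"
    then show "interpolates A S w M" unfolding interpolates_def by blast
  qed (use D f(1,2) ev in auto)
qed

lemma interpolates_mono: "interpolates A T w M \<Longrightarrow> S \<subseteq> T \<Longrightarrow> M \<le> M' \<Longrightarrow> interpolates A S w M'"
  unfolding interpolates_def by (meson order_trans subsetD)

lemma interpolates_cong: "interpolates A S w M \<Longrightarrow> (\<And>n. n \<in> S \<Longrightarrow> w n = v n) \<Longrightarrow> interpolates A S v M"
  unfolding interpolates_def by metis

text \<open>A gliding hump: otherwise data that are worse and worse on successive finite blocks could be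
  concatenated to a bounded sequence without interpolant.\<close>

lemma interpolating_tail_constant:
  fixes A :: "nat \<Rightarrow> complex mat"
  assumes D: "\<And>n. disc_matrix (A n) (dim_row (A n))" and int: "interpolating A"
  shows "\<exists>k M. \<forall>w. (\<forall>n. cmod (w n) \<le> 1) \<longrightarrow> interpolates A {k..} w M"
proof (rule ccontr)
  assume "\<not> ?thesis"
  then have no: "\<exists>w. (\<forall>n. cmod (w n) \<le> 1) \<and> \<not> interpolates A {k..} w (real j)" for k j
    by blast
  \<comment> \<open>By compactness, failure on a tail with bound \<open>j\<close> already shows on a
    finite block.\<close>
  have "\<exists>w m. (\<forall>n. cmod (w n) \<le> 1) \<and> k < m \<and> \<not> interpolates A {k..<m} w (real j)" for k j
  proof -
    obtain w where w: "\<forall>n. cmod (w n) \<le> 1" "\<not> interpolates A {k..} w (real j)" using no by blast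
    then obtain m where "\<not> interpolates A ({k..} \<inter> {..<m}) w (real j)"
      using interpolates_of_finite[where A = A, OF D] by blast
    moreover have "{k..} \<inter> {..<m} = {k..<m}" by auto
    ultimately have m: "\<not> interpolates A {k..<m} w (real j)" by simp
    have "k < m"
    proof (rule ccontr)
      assume "\<not> k < m"
      then have "{k..<m} = {}" by simp
      then have "interpolates A {k..<m} w (real j)"
        unfolding interpolates_def by (intro exI[of _ "\<lambda>z. 0"]) auto
      then show False using m by blast
    qed
    with w m show ?thesis by blast
  qed
  then obtain W m where W: "\<And>k j n. cmod (W k j n) \<le> 1" and m: "\<And>k j. k < m k j"
    and bad: "\<And>k j. \<not> interpolates A {k..<m k j} (W k j) (real j)" by metis
  \<comment> \<open>The numbers \<open>K j\<close> delimit consecutive blocks; on block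
    \<open>j\<close> the data fail with bound \<open>j\<close>, and \<open>J n\<close> is the block
    containing \<open>n\<close>.\<close>
  define K where "K = rec_nat 0 (\<lambda>j k. m k j)"
  have K: "K 0 = 0" "K (Suc j) = m (K j) j" for j by (simp_all add: K_def)
  have mono: "strict_mono K" by (rule strict_mono_Suc_iff[THEN iffD2]) (simp add: K m)
  define J where "J n = (LEAST j. n < K (Suc j))" for n
  define w where "w n = W (K (J n)) (J n) n" for n
  have J: "J n = j" if "n \<in> {K j..<K (Suc j)}" for n j
    unfolding J_def
  proof (rule Least_equality)
    fix i assume "n < K (Suc i)"
    then have "K j < K (Suc i)" using that by auto
    then show "j \<le> i" using strict_mono_less[OF mono] by auto
  qed (use that in auto)
  have "bounded (range w)" unfolding bounded_iff using W by (intro exI[of _ 1]) (auto simp: w_def)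
  then obtain M where M: "interpolates A UNIV w M"
    using int unfolding interpolating_iff_interpolates by blast
  obtain j :: nat where j: "M \<le> real j" using real_arch_simple by blast
  have "interpolates A {K j..<K (Suc j)} w (real j)"
    by (rule interpolates_mono[OF M _ j]) simp
  then have "interpolates A {K j..<K (Suc j)} (W (K j) j) (real j)"
    by (rule interpolates_cong) (simp add: w_def J)
  then show False using bad unfolding K by blast
qed

text \<open>Only finitely many matrices precede a tail with a common bound; they are adjoined one at
  a time, from the last to the first.\<close>

lemma interpolating_uniform_constant:
  fixes A :: "nat \<Rightarrow> complex mat"
  assumes D: "\<And>n. disc_matrix (A n) (dim_row (A n))" and int: "interpolating A"
  obtains M where "\<And>w. (\<And>n. cmod (w n) \<le> 1) \<Longrightarrow> interpolates A UNIV w M"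
proof -
  have step: "\<exists>M. \<forall>w. (\<forall>n. cmod (w n) \<le> 1) \<longrightarrow> interpolates A {k..} w M"
    if "\<exists>M. \<forall>w. (\<forall>n. cmod (w n) \<le> 1) \<longrightarrow> interpolates A {Suc k..} w M" for k
  proof -
    from that obtain M where M: "\<forall>w. (\<forall>n. cmod (w n) \<le> 1) \<longrightarrow> interpolates A {Suc k..} w M" ..
    have "bounded (range (\<lambda>n. if n = k then 1 else 0 :: complex))"
      unfolding bounded_iff by (intro exI[of _ 1]) auto
    then obtain E where "interpolates A UNIV (\<lambda>n. if n = k then 1 else 0) E"
      using int unfolding interpolating_iff_interpolates by blast
    then obtain e where e: "e holomorphic_on ball 0 1" "\<And>z. cmod z < 1 \<Longrightarrow> cmod (e z) \<le> E"
      "\<And>n. scalar_at (A n) e (if n = k then 1 else 0)" by (auto simp: interpolates_def)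
    have "interpolates A {k..} w (M * (1 + E) + E)" if w: "\<forall>n. cmod (w n) \<le> 1" for w
    proof -
      have "interpolates A {Suc k..} w M" using M w by blast
      then obtain f where f: "f holomorphic_on ball 0 1" "\<And>z. cmod z < 1 \<Longrightarrow> cmod (f z) \<le> M"
        "\<And>n. n \<ge> Suc k \<Longrightarrow> scalar_at (A n) f (w n)"
        by (auto simp: interpolates_def)
      \<comment> \<open>At \<open>A k\<close> the factor \<open>1 - e\<close> vanishes and the value
        is \<open>w k\<close>; at later matrices \<open>e\<close> vanishes and \<open>f\<close>
        decides. The bound uses \<open>|1 - e| \<le> 1 + E\<close> and
        \<open>cmod (w k) \<le> 1\<close>.\<close>
      define g where "g z = f z * (1 - e z) + w k * e z" for z
      have "scalar_at (A n) g (w n)" if n: "n \<ge> k" for n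
      proof -
        interpret disc_matrix "A n" "dim_row (A n)" by (rule D)
        show ?thesis
        proof (cases "n = k")
          case True
          have "scalar_at (A n) (\<lambda>z. 1 - e z) (1 - 1)"
            using e(3)[of n] True by (intro scalar_at_diff scalar_at_const) auto
          then have "scalar_at (A n) (\<lambda>z. f z * (1 - e z)) 0"
            by (intro scalar_at_ideal f(1)) simp
          then have "scalar_at (A n) g (0 + w k * 1)"
            unfolding g_def using e(3)[of n] True by (intro scalar_at_add scalar_at_mult scalar_at_const) auto
          then show ?thesis using True by simp
        next
          case False
          then have "scalar_at (A n) g (w n * (1 - 0) + w k * 0)"
            unfolding g_def using e(3)[of n] n
            by (intro scalar_at_add scalar_at_mult scalar_at_diff scalar_at_const f(3)) auto
          then show ?thesis by simp
        qed
      qed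
      moreover have "cmod (g z) \<le> M * (1 + E) + E" if z: "cmod z < 1" for z
      proof -
        have "cmod (g z) \<le> cmod (f z) * cmod (1 - e z) + cmod (w k) * cmod (e z)"
          unfolding g_def by (rule order_trans[OF norm_triangle_ineq]) (simp add: norm_mult)
        also have "cmod (1 - e z) \<le> 1 + E"
          using norm_triangle_ineq4[of 1 "e z"] e(2)[OF z] by simp
        finally have "cmod (g z) \<le> cmod (f z) * (1 + E) + cmod (w k) * cmod (e z)"
          by (simp add: mult_left_mono)
        also have "\<dots> \<le> M * (1 + E) + 1 * E"
          using f(2)[OF z] e(2)[OF z] w order_trans[OF norm_ge_zero e(2)[OF z]]
            order_trans[OF norm_ge_zero f(2)[OF z]]
          by (intro add_mono mult_mono) auto
        finally show ?thesis by simp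
      qed
      moreover have "g holomorphic_on ball 0 1"
        unfolding g_def by (intro holomorphic_intros f(1) e(1))
      ultimately show ?thesis unfolding interpolates_def by auto
    qed
    then show ?thesis by blast
  qed
  obtain k where "\<exists>M. \<forall>w. (\<forall>n. cmod (w n) \<le> 1) \<longrightarrow> interpolates A {k..} w M"
    using interpolating_tail_constant[where A = A, OF D int] by blast
  then have "\<exists>M. \<forall>w. (\<forall>n. cmod (w n) \<le> 1) \<longrightarrow> interpolates A {0..} w M"
    by (induction k) (use step in blast)+
  then obtain M where "\<And>w. \<forall>n. cmod (w n) \<le> 1 \<Longrightarrow> interpolates A {0..} w M" by blast
  then show ?thesis using that[of M] by (simp add: atLeast_0)
qed

section \<open>From interpolation to weak separation and the Bessel property\<close>

text \<open>The weights are conjugated because multiplication by the interpolant acts on the model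
  spaces through its adjoint.\<close>

lemma model_space_multiplier_estimate:
  fixes A :: "nat \<Rightarrow> complex mat"
  assumes D: "\<And>n. disc_matrix (A n) (dim_row (A n))" and int: "interpolates A F w M"
    and h: "\<And>n. n \<in> F \<Longrightarrow> h n \<in> model_space (A n)"
  shows "norm (\<Sum>n\<in>F. cscale (cnj (w n)) (h n)) \<le> M * norm (\<Sum>n\<in>F. h n)"
proof -
  obtain f where f: "f holomorphic_on ball 0 1" "\<And>z. cmod z < 1 \<Longrightarrow> cmod (f z) \<le> M"
    "\<And>n. n \<in> F \<Longrightarrow> scalar_at (A n) f (w n)"
    using int by (auto simp: interpolates_def)
  have M0: "M \<ge> 0" using order_trans[OF norm_ge_zero f(2)[of 0]] by simp
  define x where "x = (\<Sum>n\<in>F. h n)"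
  define y where "y = (\<Sum>n\<in>F. cscale (cnj (w n)) (h n))"
  obtain g where g: "\<And>z. cmod z < 1 \<Longrightarrow> hardy_fun g z = f z * hardy_fun y z" "norm g \<le> M * norm y"
    using multiplier_bound[OF f(1,2)] by blast
  have "cinner g (h n) = w n * cinner y (h n)" if "n \<in> F" for n
    by (rule disc_matrix.cinner_multiplier_model_space[OF D f(3)[OF that] g(1) h[OF that]])
  then have "cinner g x = (\<Sum>n\<in>F. w n * cinner y (h n))"
    by (simp add: x_def cinner_sum_right)
  also have "\<dots> = cinner y y"
    by (subst (2) y_def) (simp add: cinner_sum_right cinner_cscale_right)
  finally have "(norm y)\<^sup>2 = cmod (cinner g x)"
    by (simp add: cinner_self norm_power)
  also have "\<dots> \<le> norm g * norm x" by (rule cinner_cauchy_schwarz)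
  also have "\<dots> \<le> M * norm y * norm x" using g(2) by (rule mult_right_mono) simp
  finally have "norm y * norm y \<le> norm y * (M * norm x)"
    by (simp add: power2_eq_square mult_ac)
  then show ?thesis
    unfolding x_def[symmetric] y_def[symmetric] using M0
    by (cases "norm y = 0") auto
qed

text \<open>Greedy choice: by the parallelogram law the two signs of a new vector average to the sum
  of the squares, so one of them does not exceed it.\<close>

lemma exists_signs:
  fixes h :: "nat \<Rightarrow> hardy"
  assumes "finite F"
  shows "\<exists>w. (\<forall>n. w n = 1 \<or> w n = - 1) \<and> (norm (\<Sum>n\<in>F. cscale (w n) (h n)))\<^sup>2 \<le> (\<Sum>n\<in>F. (norm (h n))\<^sup>2)"
  using assms
proof (induction F rule: finite_induct)
  case empty
  show ?case by (intro exI[of _ "\<lambda>_. 1"]) auto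
next
  case (insert a F)
  then obtain w where w: "\<forall>n. w n = 1 \<or> w n = - 1"
    "(norm (\<Sum>n\<in>F. cscale (w n) (h n)))\<^sup>2 \<le> (\<Sum>n\<in>F. (norm (h n))\<^sup>2)" by blast
  define x where "x = (\<Sum>n\<in>F. cscale (w n) (h n))"
  have par: "(norm (h a + x))\<^sup>2 + (norm (- h a + x))\<^sup>2 = 2 * (norm (h a))\<^sup>2 + 2 * (norm x)\<^sup>2"
    unfolding power2_norm_eq_inner by (simp add: inner_add inner_diff inner_commute)
  have "\<exists>s. (s = 1 \<or> s = - 1) \<and> (norm (cscale s (h a) + x))\<^sup>2 \<le> (norm (h a))\<^sup>2 + (norm x)\<^sup>2"
  proof (cases "(norm (h a + x))\<^sup>2 \<le> (norm (h a))\<^sup>2 + (norm x)\<^sup>2")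
    case True
    then show ?thesis by (intro exI[of _ 1]) simp
  next
    case False
    then have "(norm (- h a + x))\<^sup>2 \<le> (norm (h a))\<^sup>2 + (norm x)\<^sup>2" using par by linarith
    then show ?thesis by (intro exI[of _ "- 1"]) (simp flip: minus_eq_cscale)
  qed
  then obtain s where s: "s = 1 \<or> s = - 1" "(norm (cscale s (h a) + x))\<^sup>2 \<le> (norm (h a))\<^sup>2 + (norm x)\<^sup>2" by blast
  have "(\<Sum>n\<in>F. cscale ((w(a := s)) n) (h n)) = x"
    unfolding x_def using insert.hyps by (intro sum.cong) auto
  then have "(norm (\<Sum>n\<in>insert a F. cscale ((w(a := s)) n) (h n)))\<^sup>2 \<le> (\<Sum>n\<in>insert a F. (norm (h n))\<^sup>2)"
    using insert.hyps s(2) w(2) by (simp add: x_def[symmetric])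
  then show ?case using w(1) s(1) by (intro exI[of _ "w(a := s)"]) auto
qed

text \<open>Applied to the signed vectors with the same signs as weights, the multiplier estimate
  removes the signs at the cost of a factor \<open>M\<close>.\<close>

lemma interpolating_imp_finite_bessel:
  fixes A :: "nat \<Rightarrow> complex mat"
  assumes D: "\<And>n. disc_matrix (A n) (dim_row (A n))"
    and M: "\<And>w. (\<And>n. cmod (w n) \<le> 1) \<Longrightarrow> interpolates A UNIV w M"
    and "finite F" and h: "\<And>n. n \<in> F \<Longrightarrow> h n \<in> model_space (A n)"
  shows "(norm (\<Sum>n\<in>F. h n))\<^sup>2 \<le> M\<^sup>2 * (\<Sum>n\<in>F. (norm (h n))\<^sup>2)"
proof -
  obtain w where w: "\<forall>n. w n = 1 \<or> w n = - (1::complex)"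
    and le: "(norm (\<Sum>n\<in>F. cscale (w n) (h n)))\<^sup>2 \<le> (\<Sum>n\<in>F. (norm (h n))\<^sup>2)"
    using exists_signs[OF \<open>finite F\<close>] by blast
  have ww: "cnj (w n) * w n = 1" for n using w by (metis complex_cnj_minus complex_cnj_one mult_1 mult_minus_left mult_minus_right minus_minus)
  have "cmod (w n) \<le> 1" for n using w[rule_format, of n] by auto
  then have "interpolates A F w M" using M interpolates_mono by blast
  then have "norm (\<Sum>n\<in>F. cscale (cnj (w n)) (cscale (w n) (h n))) \<le> M * norm (\<Sum>n\<in>F. cscale (w n) (h n))"
    by (rule model_space_multiplier_estimate[where A = A, OF D])
      (intro disc_matrix.model_space_subspace(3)[OF D] h)
  then have "norm (\<Sum>n\<in>F. h n) \<le> M * norm (\<Sum>n\<in>F. cscale (w n) (h n))"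
    by (simp add: cscale_cscale ww)
  then have "(norm (\<Sum>n\<in>F. h n))\<^sup>2 \<le> M\<^sup>2 * (norm (\<Sum>n\<in>F. cscale (w n) (h n)))\<^sup>2"
    unfolding power_mult_distrib[symmetric] by (rule power_mono) simp
  also have "\<dots> \<le> M\<^sup>2 * (\<Sum>n\<in>F. (norm (h n))\<^sup>2)"
    using le by (rule mult_left_mono) simp
  finally show ?thesis .
qed

lemma bessel_systemI:
  assumes C: "C \<ge> 1"
    and scale: "\<And>n c h. h \<in> H n \<Longrightarrow> cscale c h \<in> H n"
    and fin: "\<And>F h. finite F \<Longrightarrow> (\<And>n. n \<in> F \<Longrightarrow> h n \<in> H n) \<Longrightarrow>
      (norm (\<Sum>n\<in>F. h n))\<^sup>2 \<le> C\<^sup>2 * (\<Sum>n\<in>F. (norm (h n))\<^sup>2)"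
  shows "bessel_system H"
  unfolding bessel_system_def
proof (intro exI[of _ C] conjI C allI impI)
  fix h :: "nat \<Rightarrow> hardy" and a :: "nat \<Rightarrow> complex"
  assume h: "\<forall>n. h n \<in> H n \<and> norm (h n) = 1" and a: "summable (\<lambda>n. (cmod (a n))\<^sup>2)"
  have le: "(norm (\<Sum>n\<in>F. cscale (a n) (h n)))\<^sup>2 \<le> C\<^sup>2 * (\<Sum>n\<in>F. (cmod (a n))\<^sup>2)" if "finite F" for F
    using fin[OF that, of "\<lambda>n. cscale (a n) (h n)"] h scale by simp
  show summ: "summable (\<lambda>n. cscale (a n) (h n))"
    unfolding summable_Cauchy
  proof (intro allI impI)
    fix e :: real assume e: "e > 0"
    then have "(e / C)\<^sup>2 > 0" using C by simp
    then obtain N where N: "\<And>m n. m \<ge> N \<Longrightarrow> norm (\<Sum>k\<in>{m..<n}. (cmod (a k))\<^sup>2) < (e / C)\<^sup>2"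
      using a unfolding summable_Cauchy by blast
    have "norm (\<Sum>k\<in>{m..<n}. cscale (a k) (h k)) < e" if "m \<ge> N" for m n
    proof -
      have "(norm (\<Sum>k\<in>{m..<n}. cscale (a k) (h k)))\<^sup>2 \<le> C\<^sup>2 * (\<Sum>k\<in>{m..<n}. (cmod (a k))\<^sup>2)"
        by (rule le) simp
      also have "\<dots> < C\<^sup>2 * (e / C)\<^sup>2"
        using N[OF that, of n] C by (intro mult_strict_left_mono) (auto simp: abs_of_nonneg sum_nonneg)
      also have "\<dots> = e\<^sup>2" using C by (simp add: power_divide)
      finally show ?thesis by (rule power2_less_imp_less) (use e in simp)
    qed
    then show "\<exists>N. \<forall>m\<ge>N. \<forall>n. norm (\<Sum>k\<in>{m..<n}. cscale (a k) (h k)) < e" by blast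
  qed
  show "(norm (\<Sum>n. cscale (a n) (h n)))\<^sup>2 \<le> C\<^sup>2 * (\<Sum>n. (cmod (a n))\<^sup>2)"
  proof (rule LIMSEQ_le_const2)
    show "(\<lambda>N. (norm (\<Sum>n<N. cscale (a n) (h n)))\<^sup>2) \<longlonglongrightarrow> (norm (\<Sum>n. cscale (a n) (h n)))\<^sup>2"
      by (intro tendsto_power tendsto_norm summable_LIMSEQ summ)
    have "(norm (\<Sum>n<N. cscale (a n) (h n)))\<^sup>2 \<le> C\<^sup>2 * (\<Sum>n. (cmod (a n))\<^sup>2)" for N
      by (rule order_trans[OF le]) (auto intro!: mult_left_mono sum_le_suminf a)
    then show "\<exists>N. \<forall>n\<ge>N. (norm (\<Sum>n<n. cscale (a n) (h n)))\<^sup>2 \<le> C\<^sup>2 * (\<Sum>n. (cmod (a n))\<^sup>2)" by blast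
  qed
qed

text \<open>\<open>norm h * sin (angle h g)\<close> is the distance from \<open>h\<close> to the
  complex line through \<open>g\<close>.\<close>

lemma sin_angle:
  assumes "g \<noteq> 0" "h \<noteq> 0"
  shows "(norm h * sin (angle h g))\<^sup>2 = (norm h)\<^sup>2 - (cmod (cinner h g))\<^sup>2 / (norm g)\<^sup>2" "0 \<le> sin (angle h g)" "sin (angle h g) \<le> 1"
proof -
  define x where "x = cmod (cinner h g) / (norm h * norm g)"
  have x: "0 \<le> x" "x \<le> 1"
    using cinner_cauchy_schwarz[of h g] assms by (auto simp: x_def divide_le_eq_1)
  then have "sin (angle h g) = sqrt (1 - x\<^sup>2)"
    unfolding angle_def x_def[symmetric] by (intro sin_arccos) auto
  moreover have "0 \<le> 1 - x\<^sup>2" using x by (simp add: power_le_one)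
  ultimately have "(norm h * sin (angle h g))\<^sup>2 = (norm h)\<^sup>2 * (1 - x\<^sup>2)" and "0 \<le> sin (angle h g)"
    by (simp_all add: power_mult_distrib)
  then show "(norm h * sin (angle h g))\<^sup>2 = (norm h)\<^sup>2 - (cmod (cinner h g))\<^sup>2 / (norm g)\<^sup>2" "0 \<le> sin (angle h g)"
    using assms by (simp_all add: x_def power_divide power_mult_distrib right_diff_distrib)
qed simp

theorem interpolating_imp_separated_bessel:
  fixes A :: "nat \<Rightarrow> complex mat"
  assumes D: "\<And>n. disc_matrix (A n) (dim_row (A n))" and int: "interpolating A"
  shows "weakly_separated (\<lambda>n. model_space (A n))" "bessel_system (\<lambda>n. model_space (A n))"
proof -
  obtain M0 where M0: "\<And>w. (\<And>n. cmod (w n) \<le> 1) \<Longrightarrow> interpolates A UNIV w M0"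
    using interpolating_uniform_constant[where A = A, OF D int] by blast
  define M where "M = max 1 M0"
  have M1: "M \<ge> 1" by (simp add: M_def)
  have M: "interpolates A UNIV w M" if "\<And>n. cmod (w n) \<le> 1" for w
    using M0[OF that] interpolates_mono[of A UNIV w M0 UNIV M] by (simp add: M_def)
  note sub = disc_matrix.model_space_subspace[OF D]
  show "bessel_system (\<lambda>n. model_space (A n))"
    by (rule bessel_systemI[OF M1])
      (use sub(3) interpolating_imp_finite_bessel[where A = A, OF D M] in blast)+
  have sin_ge: "1 / M \<le> sin (angle h g)"
    if nj: "n \<noteq> j" and h: "h \<in> model_space (A n)" "h \<noteq> 0" and g: "g \<in> model_space (A j)" "g \<noteq> 0" for n j h g
  proof -
    \<comment> \<open>The vectors are \<open>h\<close> and minus its projection onto the line of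
      \<open>g\<close>. The weights 1 and 0 retain \<open>h\<close>, so \<open>norm h\<close> is at
      most \<open>M\<close> times its distance to that line.\<close>
    define t where "t = cinner h g / (norm g)\<^sup>2"
    define k where "k i = (if i = n then h else cscale (- t) g)" for i
    have "interpolates A {n, j} (\<lambda>i. if i = n then 1 else 0) M"
      by (rule interpolates_mono[OF M]) auto
    then have "norm (\<Sum>i\<in>{n, j}. cscale (cnj (if i = n then 1 else 0)) (k i)) \<le> M * norm (\<Sum>i\<in>{n, j}. k i)"
      by (rule model_space_multiplier_estimate[where A = A, OF D]) (use h g nj sub(3) in \<open>auto simp: k_def\<close>)
    moreover have "h + cscale (- t) g = h - cscale t g" by (rule hardy_eqI) simp
    ultimately have "norm h \<le> M * norm (h - cscale t g)"
      using nj by (simp add: k_def)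
    then have "(norm h)\<^sup>2 \<le> M\<^sup>2 * (norm (h - cscale t g))\<^sup>2"
      unfolding power_mult_distrib[symmetric] by (rule power_mono) simp
    also have "\<dots> = (norm h * (M * sin (angle h g)))\<^sup>2"
      unfolding t_def norm_cinner_diff_sq[OF g(2)] sin_angle(1)[OF g(2) h(2), symmetric]
      by (simp add: power_mult_distrib mult_ac)
    finally have "norm h \<le> norm h * (M * sin (angle h g))"
      by (rule power2_le_imp_le) (use M1 sin_angle(2)[OF g(2) h(2)] in simp)
    then have "1 \<le> M * sin (angle h g)" using h(2) by simp
    then show ?thesis using M1 by (simp add: divide_le_eq mult.commute)
  qed
  have "1 / M \<le> sine (model_space (A n)) (model_space (A j))" if "n \<noteq> j" for n j
    unfolding sine_def
  proof (rule cInf_greatest)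
    obtain h g where "h \<in> model_space (A n)" "norm h = 1" "g \<in> model_space (A j)" "norm g = 1"
      using disc_matrix.model_space_unit_vector[OF D] by metis
    then have "sin (angle h g) \<in> {sin (angle x y) |x y. x \<in> model_space (A n) - {0} \<and> y \<in> model_space (A j) - {0}}"
      by force
    then show "{sin (angle x y) |x y. x \<in> model_space (A n) - {0} \<and> y \<in> model_space (A j) - {0}} \<noteq> {}" by blast
  qed (use sin_ge[OF that] in auto)
  moreover have "{sine (model_space (A n)) (model_space (A j)) |n j. n \<noteq> j} \<noteq> {}"
    using zero_neq_one[where 'a = nat] by blast
  ultimately have "1 / M \<le> Inf {sine (model_space (A n)) (model_space (A j)) |n j. n \<noteq> j}"
    by (intro cInf_greatest) auto
  moreover have "1 / M > 0" using M1 by simp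
  ultimately show "weakly_separated (\<lambda>n. model_space (A n))"
    unfolding weakly_separated_def by linarith
qed

section \<open>From weak separation and the Bessel property to interpolation\<close>

lemma bessel_system_finite:
  assumes bessel: "bessel_system H" and unit: "\<And>n. \<exists>u\<in>H n. norm u = 1"
    and scale: "\<And>n c h. h \<in> H n \<Longrightarrow> cscale c h \<in> H n"
  obtains C where "C \<ge> 1" "\<And>N h. (\<And>j. j < N \<Longrightarrow> h j \<in> H j) \<Longrightarrow>
    (norm (\<Sum>j<N. h j))\<^sup>2 \<le> C\<^sup>2 * (\<Sum>j<N. (norm (h j))\<^sup>2)"
proof -
  obtain C where C: "C \<ge> 1" and bound: "\<forall>(h :: nat \<Rightarrow> hardy) (a :: nat \<Rightarrow> complex).
      (\<forall>n. h n \<in> H n \<and> norm (h n) = 1) \<longrightarrow> summable (\<lambda>n. (cmod (a n))\<^sup>2) \<longrightarrow>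
      summable (\<lambda>n. cscale (a n) (h n)) \<and>
      (norm (\<Sum>n. cscale (a n) (h n)))\<^sup>2 \<le> C\<^sup>2 * (\<Sum>n. (cmod (a n))\<^sup>2)"
    using bessel unfolding bessel_system_def by (elim exE conjE)
  obtain u where u: "\<And>n. u n \<in> H n" "\<And>n. norm (u n) = 1" using unit by metis
  show ?thesis
  proof (rule that[OF C])
    fix N and h :: "nat \<Rightarrow> hardy" assume h: "\<And>j. j < N \<Longrightarrow> h j \<in> H j"
    \<comment> \<open>Nonzero vectors are normalized, with their norms as coefficients. Zero vectors
      and indices from \<open>N\<close> on receive the unit vector \<open>u j\<close> with
      coefficient 0.\<close>
    define a :: "nat \<Rightarrow> complex" where "a j = (if j < N then of_real (norm (h j)) else 0)" for j
    define k where "k j = (if j < N \<and> h j \<noteq> 0 then cscale (inverse (of_real (norm (h j)))) (h j) else u j)" for j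
    have k: "k j \<in> H j \<and> norm (k j) = 1" for j
      using u[of j] h[of j] scale[of "h j" j] by (auto simp: k_def norm_inverse)
    have fin: "(\<lambda>n. (cmod (a n))\<^sup>2) sums (\<Sum>n<N. (cmod (a n))\<^sup>2)"
      by (rule sums_finite) (auto simp: a_def)
    have "(norm (\<Sum>n. cscale (a n) (k n)))\<^sup>2 \<le> C\<^sup>2 * (\<Sum>n. (cmod (a n))\<^sup>2)"
      using bound[rule_format, of k a, OF k sums_summable[OF fin]] by (rule conjunct2)
    moreover have "(\<Sum>n. cscale (a n) (k n)) = (\<Sum>n<N. cscale (a n) (k n))"
      by (rule suminf_finite) (auto simp: a_def)
    moreover have "(\<Sum>n<N. cscale (a n) (k n)) = (\<Sum>n<N. h n)"
      by (intro sum.cong) (auto simp: a_def k_def cscale_cscale)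
    moreover have "(\<Sum>n. (cmod (a n))\<^sup>2) = (\<Sum>n<N. (norm (h n))\<^sup>2)"
      using sums_unique[OF fin] by (simp add: a_def)
    ultimately show "(norm (\<Sum>j<N. h j))\<^sup>2 \<le> C\<^sup>2 * (\<Sum>j<N. (norm (h j))\<^sup>2)" by simp
  qed
qed

lemma weakly_separated_bound:
  assumes ws: "weakly_separated H" and unit: "\<And>n. \<exists>u\<in>H n. norm u = 1"
  obtains s where "0 < s" "\<And>n j h g. n \<noteq> j \<Longrightarrow> h \<in> H n \<Longrightarrow> g \<in> H j \<Longrightarrow> s * norm h \<le> norm (h + g)"
proof -
  define s where "s = Inf {sine (H n) (H j) |n j. n \<noteq> j}"
  have s0: "s > 0" using ws by (simp add: weakly_separated_def s_def)
  have sine0: "0 \<le> sine (H n) (H j)" and sine_le: "h \<in> H n \<Longrightarrow> h \<noteq> 0 \<Longrightarrow> g \<in> H j \<Longrightarrow> g \<noteq> 0 \<Longrightarrow> sine (H n) (H j) \<le> sin (angle h g)"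
    for n j h g
  proof -
    obtain x y where "x \<in> H n" "norm x = 1" "y \<in> H j" "norm y = 1" using unit by metis
    then have "sin (angle x y) \<in> {sin (angle x y) |x y. x \<in> H n - {0} \<and> y \<in> H j - {0}}" by force
    then show "0 \<le> sine (H n) (H j)"
      unfolding sine_def by (intro cInf_greatest) (auto intro: sin_angle)
    show "sine (H n) (H j) \<le> sin (angle h g)" if "h \<in> H n" "h \<noteq> 0" "g \<in> H j" "g \<noteq> 0"
      unfolding sine_def
    proof (rule cInf_lower)
      show "bdd_below {sin (angle x y) |x y. x \<in> H n - {0} \<and> y \<in> H j - {0}}"
        by (rule bdd_belowI[of _ 0]) (auto intro: sin_angle)
    qed (use that in blast)
  qed
  have s_le: "s \<le> sine (H n) (H j)" if "n \<noteq> j" for n j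
    unfolding s_def
  proof (rule cInf_lower)
    show "bdd_below {sine (H n) (H j) |n j. n \<noteq> j}"
      by (rule bdd_belowI[of _ 0]) (auto intro: sine0)
  qed (use that in blast)
  show ?thesis
  proof (rule that[OF s0])
    fix n j h g assume nj: "(n::nat) \<noteq> j" and h: "h \<in> H n" and g: "g \<in> H j"
    consider "h = 0" | "h \<noteq> 0" "g = 0" | "h \<noteq> 0" "g \<noteq> 0" by blast
    then show "s * norm h \<le> norm (h + g)"
    proof cases
      case 2
      \<comment> \<open>For \<open>g = 0\<close> the claim reduces to \<open>s \<le> 1\<close>,
        which the angle with a unit vector of \<open>H j\<close> shows.\<close>
      obtain y where y: "y \<in> H j" "norm y = 1" using unit by blast
      then have "y \<noteq> 0" by auto
      then have "s \<le> 1"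
        using s_le[OF nj] sine_le[OF h 2(1) y(1)] sin_angle(3)[of y h] 2 by linarith
      then show ?thesis using 2 by (simp add: mult_left_le_one_le s0 less_imp_le)
    next
      case 3
      let ?c = "cmod (cinner h g)"
      have "s \<le> sin (angle h g)" using s_le[OF nj] sine_le[OF h 3(1) g 3(2)] by linarith
      then have "(s * norm h)\<^sup>2 \<le> (norm h * sin (angle h g))\<^sup>2"
        using s0 by (intro power_mono) (auto simp: mult.commute[of s] mult_left_mono)
      also have "\<dots> = (norm h)\<^sup>2 - ?c\<^sup>2 / (norm g)\<^sup>2" by (rule sin_angle(1)[OF 3(2,1)])
      \<comment> \<open>The arithmetic-geometric mean inequality for \<open>?c / norm g\<close> and
        \<open>norm g\<close>.\<close>
      also have "\<dots> \<le> (norm h)\<^sup>2 - 2 * ?c + (norm g)\<^sup>2"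
        using sum_squares_bound[of "?c / norm g" "norm g"] 3 by (simp add: power_divide)
      also have "\<dots> \<le> (norm h)\<^sup>2 + 2 * Re (cinner h g) + (norm g)\<^sup>2"
        using abs_Re_le_cmod[of "cinner h g"] by linarith
      also have "\<dots> = (norm (h + g))\<^sup>2"
        unfolding Re_cinner power2_norm_eq_inner by (simp add: inner_add inner_commute)
      finally show ?thesis by (rule power2_le_imp_le) simp
    qed simp
  qed
qed

text \<open>The map from \<open>h + g\<close> to \<open>s\<close> times \<open>h\<close> is
  contractive by \<open>sep\<close>. Its lifting takes the values \<open>s\<close> at
  \<open>A\<close> and 0 at \<open>B\<close>; division by \<open>s\<close> normalizes it.\<close>

lemma separating_multiplier:
  fixes A B :: "complex mat"
  assumes "disc_matrix A n" "disc_matrix B m" and s: "s > 0"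
    and sep: "\<And>h g. h \<in> model_space A \<Longrightarrow> g \<in> model_space B \<Longrightarrow> s * norm h \<le> norm (h + g)"
  obtains f where "\<And>z. cmod z < 1 \<Longrightarrow> cmod (f z) \<le> 1 / s" "scalar_at A f 1" "scalar_at B f 0"
proof -
  interpret A: disc_matrix A n by fact
  interpret B: disc_matrix B m by fact
  define G where "G = {(\<lambda>j::nat. if j = 0 then h + g else 0, cscale (of_real s) h) |h g. h \<in> model_space A \<and> g \<in> model_space B}"
  have memI: "(r, x) \<in> G" if "h \<in> model_space A" "g \<in> model_space B"
    "r = (\<lambda>j. if j = 0 then h + g else 0)" "x = cscale (of_real s) h" for r :: "nat \<Rightarrow> hardy" and x h g
    using that unfolding G_def by blast
  have "lift_graph 1 G"
    unfolding lift_graph_def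
  proof (intro conjI allI impI)
    show "(\<lambda>j. 0, 0) \<in> G"
      by (rule memI[OF A.model_space_subspace(1) B.model_space_subspace(1)]) auto
  next
    fix r x r' x' assume "(r, x) \<in> G" "(r', x') \<in> G"
    then obtain h g h' g' where "h \<in> model_space A" "g \<in> model_space B" "h' \<in> model_space A" "g' \<in> model_space B"
      "r = (\<lambda>j. if j = 0 then h + g else 0)" "x = cscale (of_real s) h"
      "r' = (\<lambda>j. if j = 0 then h' + g' else 0)" "x' = cscale (of_real s) h'" unfolding G_def by blast
    then show "(\<lambda>j. r j + r' j, x + x') \<in> G"
      by (intro memI[OF A.model_space_subspace(2)[of h h'] B.model_space_subspace(2)[of g g']])
        (auto simp: cscale_add)
  next
    fix r x c assume "(r, x) \<in> G"
    then obtain h g where "h \<in> model_space A" "g \<in> model_space B"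
      "r = (\<lambda>j. if j = 0 then h + g else 0)" "x = cscale (of_real s) h" unfolding G_def by blast
    then show "(\<lambda>j. cscale c (r j), cscale c x) \<in> G"
      by (intro memI[OF A.model_space_subspace(3)[of h c] B.model_space_subspace(3)[of g c]])
        (auto simp: cscale_add cscale_cscale mult.commute)
  next
    fix r x assume "(r, x) \<in> G"
    then obtain h g where hg: "h \<in> model_space A" "g \<in> model_space B"
      "r = (\<lambda>j. if j = 0 then h + g else 0)" "x = cscale (of_real s) h" unfolding G_def by blast
    then show "(\<lambda>j. bshift (r j), bshift x) \<in> G"
      by (intro memI[OF A.bshift_model_space[of h] B.bshift_model_space[of g]])
        (auto simp: bshift_add bshift_cscale)
    show "(norm x)\<^sup>2 \<le> (\<Sum>j<1. (norm (r j))\<^sup>2)"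
      using power_mono[OF sep[OF hg(1,2)], of 2] s by (simp add: hg)
  qed
  then obtain p where p: "\<And>z. cmod z < 1 \<Longrightarrow> (\<Sum>j<1. (cmod (hardy_fun (p j) z))\<^sup>2) \<le> 1"
    and rep: "\<And>r x. (r, x) \<in> G \<Longrightarrow> coef x 0 = (\<Sum>j<(1::nat). cinner (r j) (p j))"
    using contractive_lifting by blast
  have A1: "scalar_at A (hardy_fun (p 0)) (of_real s)"
  proof (rule A.scalar_at_if_reproducing)
    fix h assume "h \<in> model_space A"
    from rep[OF memI[OF this B.model_space_subspace(1) refl refl]]
    show "cinner h (p 0) = cnj (of_real s) * coef h 0" by simp
  qed
  have B0: "scalar_at B (hardy_fun (p 0)) 0"
  proof (rule B.scalar_at_if_reproducing)
    fix g assume "g \<in> model_space B"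
    from rep[OF memI[OF A.model_space_subspace(1) this refl refl]]
    show "cinner g (p 0) = cnj 0 * coef g 0" by simp
  qed
  show ?thesis
  proof (rule that[of "\<lambda>z. of_real (1 / s) * hardy_fun (p 0) z"])
    show "scalar_at A (\<lambda>z. of_real (1 / s) * hardy_fun (p 0) z) 1"
      using A.scalar_at_mult[OF A.scalar_at_const A1, of "of_real (1 / s)"] s by simp
    show "scalar_at B (\<lambda>z. of_real (1 / s) * hardy_fun (p 0) z) 0"
      using B.scalar_at_mult[OF B.scalar_at_const B0, of "of_real (1 / s)"] by simp
    fix z :: complex assume z: "cmod z < 1"
    have "cmod (hardy_fun (p 0) z) \<le> 1"
      using p[OF z] by (simp add: abs_square_le_1)
    then show "cmod (of_real (1 / s) * hardy_fun (p 0) z) \<le> 1 / s"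
      using s by (simp add: norm_mult norm_divide divide_right_mono)
  qed
qed

text \<open>The map sending a tuple from the model spaces to \<open>1 / C\<close> times its sum is
  contractive by \<open>bound\<close>. The components of its lifting take the value
  \<open>1 / C\<close> at \<open>A j\<close> and are rescaled by \<open>C\<close>.\<close>

lemma bessel_multipliers:
  fixes A :: "nat \<Rightarrow> complex mat"
  assumes D: "\<And>n. disc_matrix (A n) (dim_row (A n))" and C: "C \<ge> 1"
    and bound: "\<And>h. (\<And>j. j < N \<Longrightarrow> h j \<in> model_space (A j)) \<Longrightarrow>
      (norm (\<Sum>j<N. h j))\<^sup>2 \<le> C\<^sup>2 * (\<Sum>j<N. (norm (h j))\<^sup>2)"
  obtains f where "\<And>z. cmod z < 1 \<Longrightarrow> (\<Sum>j<N. (cmod (f j z))\<^sup>2) \<le> C\<^sup>2" "\<And>j. j < N \<Longrightarrow> scalar_at (A j) (f j) 1"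
proof -
  note sub = disc_matrix.model_space_subspace[OF D]
  define G where "G = {(r, cscale (of_real (1 / C)) (\<Sum>j<N. r j)) |r. \<forall>j. r j \<in> model_space (A j)}"
  have mem: "(r, x) \<in> G \<longleftrightarrow> (\<forall>j. r j \<in> model_space (A j)) \<and> x = cscale (of_real (1 / C)) (\<Sum>j<N. r j)" for r x
    by (auto simp: G_def)
  have cscale_sum: "cscale c (\<Sum>j<N. r j) = (\<Sum>j<N. cscale c (r j))" for c r
    by (rule hardy_eqI) (simp add: sum_distrib_left)
  have bshift_sum: "bshift (\<Sum>j<N. r j) = (\<Sum>j<N. bshift (r j))" for r
    by (rule hardy_eqI) simp
  have "lift_graph N G"
    unfolding lift_graph_def mem
  proof (intro conjI allI impI; (elim conjE)?)
    fix r x assume r: "\<forall>j. r j \<in> model_space (A j)" and x: "x = cscale (of_real (1 / C)) (\<Sum>j<N. r j)"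
    have "(norm x)\<^sup>2 = (norm (\<Sum>j<N. r j))\<^sup>2 / C\<^sup>2"
      using C by (simp add: x norm_divide power_divide)
    also have "\<dots> \<le> (\<Sum>j<N. (norm (r j))\<^sup>2)"
      using bound[of r] r C by (simp add: divide_le_eq mult.commute)
    finally show "(norm x)\<^sup>2 \<le> (\<Sum>j<N. (norm (r j))\<^sup>2)" .
  qed (auto simp: sub sum.distrib cscale_add bshift_cscale bshift_sum cscale_sum cscale_cscale mult.commute
      intro: disc_matrix.bshift_model_space[OF D])
  then obtain p where p: "\<And>z. cmod z < 1 \<Longrightarrow> (\<Sum>j<N. (cmod (hardy_fun (p j) z))\<^sup>2) \<le> 1"
    and rep: "\<And>r x. (r, x) \<in> G \<Longrightarrow> coef x 0 = (\<Sum>j<N. cinner (r j) (p j))"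
    using contractive_lifting by blast
  show ?thesis
  proof (rule that[of "\<lambda>j z. of_real C * hardy_fun (p j) z"])
    fix z :: complex assume z: "cmod z < 1"
    have "C\<^sup>2 * (\<Sum>j<N. (cmod (hardy_fun (p j) z))\<^sup>2) \<le> C\<^sup>2 * 1"
      using p[OF z] by (rule mult_left_mono) simp
    then show "(\<Sum>j<N. (cmod (of_real C * hardy_fun (p j) z))\<^sup>2) \<le> C\<^sup>2"
      by (simp add: norm_mult power_mult_distrib sum_distrib_left)
  next
    fix k assume k: "k < N"
    interpret disc_matrix "A k" "dim_row (A k)" by (rule D)
    have "scalar_at (A k) (hardy_fun (p k)) (of_real (1 / C))"
    proof (rule scalar_at_if_reproducing)
      fix h assume h: "h \<in> model_space (A k)"
      \<comment> \<open>A tuple concentrated at \<open>k\<close> isolates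
        \<open>p k\<close>.\<close>
      define r where "r j = (if j = k then h else 0)" for j
      have "(\<Sum>j<N. r j) = h" using k by (simp add: r_def)
      moreover have "(r, cscale (of_real (1 / C)) (\<Sum>j<N. r j)) \<in> G"
        using h sub(1) by (auto simp: mem r_def)
      ultimately have "coef (cscale (of_real (1 / C)) h) 0 = (\<Sum>j<N. cinner (r j) (p j))"
        using rep[of r "cscale (of_real (1 / C)) (\<Sum>j<N. r j)"] by (simp only:)
      also have "\<dots> = (\<Sum>j<N. if j = k then cinner h (p k) else 0)"
        by (intro sum.cong) (auto simp: r_def)
      finally show "cinner h (p k) = cnj (of_real (1 / C)) * coef h 0" using k by simp
    qed
    from scalar_at_mult[OF scalar_at_const this, of "of_real C"]
    show "scalar_at (A k) (\<lambda>z. of_real C * hardy_fun (p k) z) 1" using C by simp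
  qed
qed

theorem separated_bessel_imp_interpolating:
  fixes A :: "nat \<Rightarrow> complex mat"
  assumes D: "\<And>n. disc_matrix (A n) (dim_row (A n))"
    and ws: "weakly_separated (\<lambda>n. model_space (A n))" and bs: "bessel_system (\<lambda>n. model_space (A n))"
  shows "interpolating A"
proof -
  have unit: "\<exists>u\<in>model_space (A n). norm u = 1" for n
    using disc_matrix.model_space_unit_vector[OF D[of n]] by metis
  obtain C where C: "C \<ge> 1" and bessel: "\<And>N h. (\<And>j. j < N \<Longrightarrow> h j \<in> model_space (A j)) \<Longrightarrow>
      (norm (\<Sum>j<N. h j))\<^sup>2 \<le> C\<^sup>2 * (\<Sum>j<N. (norm (h j))\<^sup>2)"
    by (rule bessel_system_finite[OF bs unit])
      (use disc_matrix.model_space_subspace(3)[OF D] in auto)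
  obtain s where s: "0 < s" and sep: "\<And>n j h g. n \<noteq> j \<Longrightarrow> h \<in> model_space (A n) \<Longrightarrow> g \<in> model_space (A j) \<Longrightarrow> s * norm h \<le> norm (h + g)"
    by (rule weakly_separated_bound[OF ws unit]) auto
  define good where "good n j f \<longleftrightarrow> (\<forall>z. cmod z < 1 \<longrightarrow> cmod (f z) \<le> 1 / s) \<and>
    scalar_at (A n) f 1 \<and> scalar_at (A j) f 0" for n j f
  define \<psi> where "\<psi> n j = (SOME f. good n j f)" for n j
  have good: "good n j (\<psi> n j)" if nj: "n \<noteq> j" for n j
  proof -
    have "\<exists>f. good n j f"
    proof (rule separating_multiplier[OF D[of n] D[of j] s])
      fix h g assume "h \<in> model_space (A n)" "g \<in> model_space (A j)"
      then show "s * norm h \<le> norm (h + g)" by (rule sep[OF nj])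
    next
      fix f assume "\<And>z. cmod z < 1 \<Longrightarrow> cmod (f z) \<le> 1 / s" "scalar_at (A n) f 1" "scalar_at (A j) f 0"
      then show "\<exists>f. good n j f" by (intro exI[of _ f]) (simp add: good_def)
    qed
    then show ?thesis unfolding \<psi>_def by (rule someI_ex)
  qed
  have \<psi>: "\<And>n j z. n \<noteq> j \<Longrightarrow> cmod z < 1 \<Longrightarrow> cmod (\<psi> n j z) \<le> 1 / s"
    "\<And>n j. n \<noteq> j \<Longrightarrow> scalar_at (A n) (\<psi> n j) 1" "\<And>n j. n \<noteq> j \<Longrightarrow> scalar_at (A j) (\<psi> n j) 0"
    using good by (simp_all add: good_def)
  \<comment> \<open>The exponential bounds the products \<open>P n\<close>; the last factor
    \<open>C\<^sup>2\<close> bounds the sum of the squares of the \<open>\<phi> n\<close>.\<close>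
  have "interpolates A UNIV w (W * exp ((1 + 1 / s) * C\<^sup>2) * C\<^sup>2)" if W: "\<And>n. cmod (w n) \<le> W" for w W
  proof (rule interpolates_of_finite[where A = A, OF D])
    fix N
    have W0: "W \<ge> 0" using order_trans[OF norm_ge_zero W[of 0]] .
    have "\<exists>\<phi>. (\<forall>z. cmod z < 1 \<longrightarrow> (\<Sum>j<N. (cmod (\<phi> j z))\<^sup>2) \<le> C\<^sup>2) \<and> (\<forall>j<N. scalar_at (A j) (\<phi> j) 1)"
    proof (rule bessel_multipliers[where A = A and N = N and C = C, OF D C])
      fix h :: "nat \<Rightarrow> hardy" assume "\<And>j. j < N \<Longrightarrow> h j \<in> model_space (A j)"
      then show "(norm (\<Sum>j<N. h j))\<^sup>2 \<le> C\<^sup>2 * (\<Sum>j<N. (norm (h j))\<^sup>2)" by (rule bessel)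
    qed blast
    then obtain \<phi> where \<phi>: "\<And>z. cmod z < 1 \<Longrightarrow> (\<Sum>j<N. (cmod (\<phi> j z))\<^sup>2) \<le> C\<^sup>2"
      "\<And>j. j < N \<Longrightarrow> scalar_at (A j) (\<phi> j) 1" by blast
    \<comment> \<open>\<open>b n j\<close> is 1 at \<open>A n\<close> because of \<open>\<psi> n j\<close>, vanishes at \<open>A j\<close>, and is close enough to 1 for the
      products \<open>P n\<close> to be bounded independently of \<open>N\<close>.\<close>
    define b where "b n j z = 1 - \<phi> j z * \<phi> j z * (1 - \<psi> n j z)" for n j z
    define P where "P n z = (\<Prod>j\<in>{..<N} - {n}. b n j z)" for n z
    \<comment> \<open>Squares of \<open>\<phi> n\<close> appear because only the sum of
      \<open>|\<phi> n|\<^sup>2\<close> is controlled.\<close>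
    define F where "F z = (\<Sum>n<N. w n * (P n z * (\<phi> n z * \<phi> n z)))" for z
    have holo_\<phi>: "\<phi> j holomorphic_on ball 0 1" if "j < N" for j
      using \<phi>(2)[OF that] by (simp add: scalar_at_def)
    have holo_b: "b n j holomorphic_on ball 0 1" if "j \<in> {..<N} - {n}" for n j
      unfolding b_def using that \<psi>(2)[of n j]
      by (intro holomorphic_intros holo_\<phi>) (auto simp: scalar_at_def)
    have holo_P: "P n holomorphic_on ball 0 1" for n
      unfolding P_def by (intro holomorphic_intros holo_b)
    have P_self: "scalar_at (A n) (P n) 1" if n: "n < N" for n
    proof -
      interpret disc_matrix "A n" "dim_row (A n)" by (rule D)
      have "scalar_at (A n) (b n j) 1" if j: "j \<in> {..<N} - {n}" for j
      proof -
        \<comment> \<open>The value of \<open>\<phi> j\<close> at \<open>A n\<close> need not be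
          scalar, but the vanishing of \<open>1 - \<psi> n j\<close> there absorbs it.\<close>
        have "scalar_at (A n) (\<lambda>z. 1 - \<psi> n j z) (1 - 1)"
          using \<psi>(2)[of n j] j by (intro scalar_at_diff scalar_at_const) auto
        then have "scalar_at (A n) (\<lambda>z. \<phi> j z * \<phi> j z * (1 - \<psi> n j z)) 0"
          using j by (intro scalar_at_ideal(1) holomorphic_intros holo_\<phi>) auto
        from scalar_at_diff[OF scalar_at_const this, of 1] show ?thesis
          unfolding b_def by simp
      qed
      then have "scalar_at (A n) (\<lambda>z. \<Prod>j\<in>{..<N} - {n}. b n j z) (\<Prod>j\<in>{..<N} - {n}. 1)"
        by (rule scalar_at_prod)
      then show ?thesis unfolding P_def by simp
    qed
    have P_other: "scalar_at (A k) (P n) 0" if k: "k < N" "k \<noteq> n" for k n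
    proof -
      interpret disc_matrix "A k" "dim_row (A k)" by (rule D)
      have "scalar_at (A k) (b n k) (1 - 1 * 1 * (1 - 0))"
        unfolding b_def using \<phi>(2)[OF k(1)] \<psi>(3)[of n k] k
        by (intro scalar_at_diff scalar_at_mult scalar_at_const) auto
      \<comment> \<open>One vanishing factor suffices; the others form a holomorphic
        multiplier.\<close>
      then have "scalar_at (A k) (\<lambda>z. b n k z * (\<Prod>j\<in>{..<N} - {n} - {k}. b n j z)) 0"
        by (intro scalar_at_ideal(2) holomorphic_intros holo_b) auto
      moreover have "P n = (\<lambda>z. b n k z * (\<Prod>j\<in>{..<N} - {n} - {k}. b n j z))"
        unfolding P_def using k by (intro ext prod.remove) auto
      ultimately show ?thesis by (simp only:)
    qed
    have "scalar_at (A k) F (w k)" if k: "k < N" for k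
    proof -
      interpret disc_matrix "A k" "dim_row (A k)" by (rule D)
      have "scalar_at (A k) (\<lambda>z. \<Sum>n<N. w n * (P n z * (\<phi> n z * \<phi> n z))) (\<Sum>n<N. w n * (if n = k then 1 else 0))"
      proof (intro scalar_at_sum scalar_at_mult scalar_at_const)
        fix n assume "n \<in> {..<N}"
        then have n: "n < N" by simp
        show "scalar_at (A k) (\<lambda>z. P n z * (\<phi> n z * \<phi> n z)) (if n = k then 1 else 0)"
        proof (cases "n = k")
          case True
          then show ?thesis
            using scalar_at_mult[OF P_self[OF k] scalar_at_mult[OF \<phi>(2)[OF k] \<phi>(2)[OF k]]] by simp
        next
          case False
          then show ?thesis
            using P_other[OF k, of n] by (auto intro!: scalar_at_ideal(2) holomorphic_intros holo_\<phi> n)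
        qed
      qed
      moreover have "(\<Sum>n<N. w n * (if n = k then 1 else 0)) = (\<Sum>n<N. if n = k then w n else 0)"
        by (intro sum.cong) auto
      then have "(\<Sum>n<N. w n * (if n = k then 1 else 0)) = w k" using k by simp
      ultimately show ?thesis unfolding F_def by (simp only:)
    qed
    moreover have "F holomorphic_on ball 0 1"
      unfolding F_def by (intro holomorphic_intros holo_P holo_\<phi>) auto
    moreover have "cmod (F z) \<le> W * exp ((1 + 1 / s) * C\<^sup>2) * C\<^sup>2" if z: "cmod z < 1" for z
    proof -
      define S where "S = (\<Sum>j<N. (cmod (\<phi> j z))\<^sup>2)"
      \<comment> \<open>By \<open>1 + x \<le> exp x\<close> a product of such factors is bounded
        through the sum of squares, uniformly in \<open>N\<close>.\<close>
      have b_le: "cmod (b n j z) \<le> exp ((1 + 1 / s) * (cmod (\<phi> j z))\<^sup>2)" if "j \<noteq> n" for n j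
      proof -
        have "cmod (1 - \<psi> n j z) \<le> 1 + 1 / s"
          using norm_triangle_ineq4[of 1 "\<psi> n j z"] \<psi>(1)[of n j z] that z by simp
        then have "(cmod (\<phi> j z))\<^sup>2 * cmod (1 - \<psi> n j z) \<le> (cmod (\<phi> j z))\<^sup>2 * (1 + 1 / s)"
          by (rule mult_left_mono) simp
        moreover have "cmod (b n j z) \<le> 1 + (cmod (\<phi> j z))\<^sup>2 * cmod (1 - \<psi> n j z)"
          unfolding b_def by (rule order_trans[OF norm_triangle_ineq4]) (simp add: norm_mult power2_eq_square)
        ultimately have "cmod (b n j z) \<le> 1 + (1 + 1 / s) * (cmod (\<phi> j z))\<^sup>2"
          by (simp add: mult.commute)
        also have "\<dots> \<le> exp ((1 + 1 / s) * (cmod (\<phi> j z))\<^sup>2)" by (rule exp_ge_add_one_self)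
        finally show ?thesis .
      qed
      have P_le: "cmod (P n z) \<le> exp ((1 + 1 / s) * C\<^sup>2)" for n
      proof -
        have "cmod (P n z) = (\<Prod>j\<in>{..<N} - {n}. cmod (b n j z))" by (simp add: P_def prod_norm)
        also have "\<dots> \<le> (\<Prod>j\<in>{..<N} - {n}. exp ((1 + 1 / s) * (cmod (\<phi> j z))\<^sup>2))"
          by (rule prod_mono) (auto intro: b_le)
        also have "\<dots> = exp ((1 + 1 / s) * (\<Sum>j\<in>{..<N} - {n}. (cmod (\<phi> j z))\<^sup>2))"
          by (simp add: exp_sum sum_distrib_left)
        also have "\<dots> \<le> exp ((1 + 1 / s) * C\<^sup>2)"
        proof -
          have "(\<Sum>j\<in>{..<N} - {n}. (cmod (\<phi> j z))\<^sup>2) \<le> (\<Sum>j<N. (cmod (\<phi> j z))\<^sup>2)"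
            by (rule sum_mono2) auto
          also have "\<dots> \<le> C\<^sup>2" by (rule \<phi>(1)[OF z])
          finally show ?thesis using s by (simp add: mult_left_mono)
        qed
        finally show ?thesis .
      qed
      have "cmod (F z) \<le> (\<Sum>n<N. cmod (w n) * (cmod (P n z) * (cmod (\<phi> n z))\<^sup>2))"
        unfolding F_def by (rule order_trans[OF norm_sum]) (simp add: norm_mult power2_eq_square)
      also have "\<dots> \<le> (\<Sum>n<N. W * (exp ((1 + 1 / s) * C\<^sup>2) * (cmod (\<phi> n z))\<^sup>2))"
        using W W0 P_le by (intro sum_mono mult_mono mult_right_mono) auto
      also have "\<dots> = W * exp ((1 + 1 / s) * C\<^sup>2) * S"
        by (simp add: S_def sum_distrib_left mult.assoc)
      also have "\<dots> \<le> W * exp ((1 + 1 / s) * C\<^sup>2) * C\<^sup>2"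
        unfolding S_def using \<phi>(1)[OF z] W0 by (intro mult_left_mono) auto
      finally show ?thesis .
    qed
    ultimately show "interpolates A (UNIV \<inter> {..<N}) w (W * exp ((1 + 1 / s) * C\<^sup>2) * C\<^sup>2)"
      unfolding interpolates_def by (intro exI[of _ F]) auto
  qed
  note main = this
  show ?thesis
    unfolding interpolating_iff_interpolates
  proof (intro allI impI)
    fix w :: "nat \<Rightarrow> complex" assume "bounded (range w)"
    then obtain W where "\<And>n. cmod (w n) \<le> W" unfolding bounded_iff by auto
    from main[OF this] show "\<exists>M. interpolates A UNIV w M" ..
  qed
qed

theorem theorem1p4:
  fixes A :: "nat \<Rightarrow> complex mat"
  assumes "\<And>n. square_mat (A n)"
    and "\<And>n. dim_row (A n) > 0"
    and "\<And>n. spectrum (A n) \<subseteq> ball 0 1"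
  shows "interpolating A \<longleftrightarrow>
    weakly_separated (\<lambda>n. model_space (A n)) \<and> bessel_system (\<lambda>n. model_space (A n))"
proof -
  have D: "disc_matrix (A n) (dim_row (A n))" for n
    by unfold_locales (use assms[of n] in auto)
  show ?thesis
    using interpolating_imp_separated_bessel[where A = A, OF D] separated_bessel_imp_interpolating[where A = A, OF D] by blast
qed

end
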